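(* For every non-positive integer $\ell$, there is an isomorphism of $\mathfrak{sp}_{2n}$-modules $$H^0(\widetilde X,\mathcal O(\ell D_0))\cong\begin{cases} L(-\tfrac12\varpi_n), & \ell \text{ even},\\ L(\varpi_{n-1}-\tfrac32\varpi_n), & \ell\text{ odd}.\end{cases}$$
   Context: Work over $\mathbb C$, $n\ge2$. $\mathfrak g=\mathfrak{sp}_{2n}$ with Bourbaki numbering of simple roots $\alpha_1,\dots,\alpha_n$ ($\alpha_n$ long), Chevalley generators $e_i,h_i,f_i$, Cartan subalgebra $\mathfrak h$, and fundamental weights $\varpi_1,\dots,\varpi_n$. For a weight $\mu$ of $\mathfrak h$, $L(\mu)$ is the unique irreducible quotient of the Verma module of $\mathfrak g$ of highest weight $\mu$. $\widetilde X=\big((\mathbb A^n\smallsetminus\{0\})\times\mathbb A^1\big)/\mathbb C^\times$ for the action $u\cdot(Q_1,\dots,Q_{n+1})=(uQ_1,\dots,uQ_n,u^{-2}Q_{n+1})$ (the total space of $\mathcal O(-2)$ over $\mathbb P^{n-1}$); $D_0$ is the divisor $\{Q_1=0\}$, which generates the Picard group; $\mathcal O(\ell D_0)$ is identified with the sheaf whose sections over an open $U$ are regular functions $f$ on the preimage of $U$ with $f(u\cdot Q)=u^\ell f(Q)$. Thus $H^0(\widetilde X,\mathcal O(\ell D_0))$ has as a basis the monomials $Q^\mu=Q_1^{\mu_1}\cdots Q_{n+1}^{\mu_{n+1}}$ with all $\mu_i\ge0$ and $\sum_{i=1}^n\mu_i-2\mu_{n+1}=\ell$. The $\mathfrak g$-module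 structure on $H^0(\widetilde X,\mathcal O(\ell D_0))$ for $\ell\le 0$: writing $P_i=\partial/\partial Q_i$, the Chevalley generators act by $e_i=-Q_{i+1}P_i$, $h_i=-Q_iP_i+Q_{i+1}P_{i+1}$, $f_i=-Q_iP_{i+1}$ for $i=1,\dots,n-1$, and $e_n=\frac12P_n^2Q_{n+1}^{-1}$, $h_n=-Q_nP_n-\frac12$, $f_n=-\frac12Q_n^2Q_{n+1}$. *)

theory Defs
  imports "HOL-Analysis.Analysis" "HOL-Algebra.QuotRing" "Jordan_Normal_Form.Matrix"
begin

section \<open>The symplectic Lie algebra\<close>

text \<open>
  Matrices of the library are indexed from 0, so the coordinates \<open>1, \<dots>, n\<close> and their duals
  \<open>n + 1, \<dots>, 2 n\<close> of the defining representation are shifted by one in \<open>mat_unit\<close>.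
  The alternating form pairs coordinate \<open>i\<close> with coordinate \<open>n + i\<close>.
\<close>

definition symp_form :: "nat \<Rightarrow> complex mat" where
  "symp_form n = four_block_mat (0\<^sub>m n n) (1\<^sub>m n) (- 1\<^sub>m n) (0\<^sub>m n n)"

definition sp :: "nat \<Rightarrow> complex mat set" where
  "sp n = {X \<in> carrier_mat (2 * n) (2 * n).
     transpose_mat X * symp_form n + symp_form n * X = 0\<^sub>m (2 * n) (2 * n)}"

definition bracket :: "complex mat \<Rightarrow> complex mat \<Rightarrow> complex mat" where
  "bracket X Y = X * Y - Y * X"

definition mat_unit :: "nat \<Rightarrow> nat \<Rightarrow> nat \<Rightarrow> complex mat" where
  "mat_unit n i j = mat (2 * n) (2 * n) (\<lambda>(r, s). if r + 1 = i \<and> s + 1 = j then 1 else 0)"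

text \<open>
  With \<open>\<epsilon>\<^sub>j\<close> the \<open>j\<close>-th diagonal entry, the simple roots are
  \<open>\<alpha>\<^sub>i = \<epsilon>\<^sub>i - \<epsilon>\<^sub>i\<^sub>+\<^sub>1\<close> for \<open>i < n\<close> and \<open>\<alpha>\<^sub>n = 2 \<epsilon>\<^sub>n\<close>.
  The generators are meaningful for \<open>1 \<le> i \<le> n\<close>.
\<close>

definition chev_e :: "nat \<Rightarrow> nat \<Rightarrow> complex mat" where
  "chev_e n i = (if i < n then mat_unit n i (i + 1) - mat_unit n (n + i + 1) (n + i)
                 else mat_unit n n (2 * n))"

definition chev_f :: "nat \<Rightarrow> nat \<Rightarrow> complex mat" where
  "chev_f n i = (if i < n then mat_unit n (i + 1) i - mat_unit n (n + i) (n + i + 1)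
                 else mat_unit n (2 * n) n)"

definition chev_h :: "nat \<Rightarrow> nat \<Rightarrow> complex mat" where
  "chev_h n i =
     (if i < n then mat_unit n i i - mat_unit n (i + 1) (i + 1)
                    - mat_unit n (n + i) (n + i) + mat_unit n (n + i + 1) (n + i + 1)
      else mat_unit n n n - mat_unit n (2 * n) (2 * n))"

definition cartan :: "nat \<Rightarrow> complex mat set" where
  "cartan n = {H \<in> sp n. \<forall>i < 2 * n. \<forall>j < 2 * n. i \<noteq> j \<longrightarrow> H $$ (i, j) = 0}"

text \<open>The nilradical of the positive Borel subalgebra: the Lie subalgebra generated by the
  \<open>e\<^sub>i\<close>.\<close>

inductive_set n_plus :: "nat \<Rightarrow> complex mat set" for n where
  gen: "1 \<le> i \<Longrightarrow> i \<le> n \<Longrightarrow> chev_e n i \<in> n_plus n"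
| add: "X \<in> n_plus n \<Longrightarrow> Y \<in> n_plus n \<Longrightarrow> X + Y \<in> n_plus n"
| smult: "X \<in> n_plus n \<Longrightarrow> c \<cdot>\<^sub>m X \<in> n_plus n"
| bracket: "X \<in> n_plus n \<Longrightarrow> Y \<in> n_plus n \<Longrightarrow> bracket X Y \<in> n_plus n"

text \<open>
  Weights are functions on matrices of which only the values on \<open>cartan n\<close> matter.
  \<open>fund_weight i\<close> is \<open>\<epsilon>\<^sub>1 + \<dots> + \<epsilon>\<^sub>i\<close>; the lemma below says that this is the
  basis dual to the simple coroots \<open>h\<^sub>1, \<dots>, h\<^sub>n\<close>.
\<close>

definition fund_weight :: "nat \<Rightarrow> complex mat \<Rightarrow> complex" where
  "fund_weight i H = (\<Sum>j < i. H $$ (j, j))"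

lemma fund_weight_chev_h:
  assumes "1 \<le> i" "i \<le> n" "1 \<le> j" "j \<le> n"
  shows "fund_weight i (chev_h n j) = (if i = j then 1 else 0)"
proof -
  have entry: "chev_h n j $$ (k, k) = (if k = j - 1 then 1 else 0) - (if k = j then 1 else 0)"
    if "k < i" for k
    using that assms by (auto simp: chev_h_def mat_unit_def)
  have "fund_weight i (chev_h n j) =
      (\<Sum>k < i. (if k = j - 1 then 1 else 0) - (if k = j then 1 else 0))"
    unfolding fund_weight_def by (rule sum.cong) (auto simp: entry)
  also have "\<dots> = (if i = j then 1 else 0)"
    using assms by (auto simp: sum_subtractf)
  finally show ?thesis .
qed

section \<open>Modules\<close>

definition complex_ring :: "complex ring" where
  "complex_ring = \<lparr>carrier = UNIV, mult = (*), one = 1, zero = 0, add = (+)\<rparr>"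

text \<open>
  The fields \<open>mult\<close> and \<open>one\<close>, which every \<open>module\<close> record inherits from rings, carry no
  meaning here.
\<close>

record 'v sp_mod = "(complex, 'v) module" +
  act :: "complex mat \<Rightarrow> 'v \<Rightarrow> 'v"

definition sp_module :: "nat \<Rightarrow> 'v sp_mod \<Rightarrow> bool" where
  "sp_module n M \<longleftrightarrow> module complex_ring M \<and>
     (\<forall>X \<in> sp n. \<forall>v \<in> carrier M. act M X v \<in> carrier M) \<and>
     (\<forall>X \<in> sp n. \<forall>v \<in> carrier M. \<forall>w \<in> carrier M.
        act M X (v \<oplus>\<^bsub>M\<^esub> w) = act M X v \<oplus>\<^bsub>M\<^esub> act M X w) \<and>
     (\<forall>X \<in> sp n. \<forall>c. \<forall>v \<in> carrier M. act M X (c \<odot>\<^bsub>M\<^esub> v) = c \<odot>\<^bsub>M\<^esub> act M X v) \<and>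
     (\<forall>X \<in> sp n. \<forall>Y \<in> sp n. \<forall>v \<in> carrier M.
        act M (X + Y) v = act M X v \<oplus>\<^bsub>M\<^esub> act M Y v) \<and>
     (\<forall>X \<in> sp n. \<forall>c. \<forall>v \<in> carrier M. act M (c \<cdot>\<^sub>m X) v = c \<odot>\<^bsub>M\<^esub> act M X v) \<and>
     (\<forall>X \<in> sp n. \<forall>Y \<in> sp n. \<forall>v \<in> carrier M.
        act M (bracket X Y) v = act M X (act M Y v) \<ominus>\<^bsub>M\<^esub> act M Y (act M X v))"

definition sp_submodule :: "nat \<Rightarrow> 'v sp_mod \<Rightarrow> 'v set \<Rightarrow> bool" where
  "sp_submodule n M N \<longleftrightarrow> submodule N complex_ring M \<and> (\<forall>X \<in> sp n. \<forall>v \<in> N. act M X v \<in> N)"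

definition sp_irreducible :: "nat \<Rightarrow> 'v sp_mod \<Rightarrow> bool" where
  "sp_irreducible n M \<longleftrightarrow> sp_module n M \<and> carrier M \<noteq> {\<zero>\<^bsub>M\<^esub>} \<and>
     (\<forall>N. sp_submodule n M N \<longrightarrow> N = {\<zero>\<^bsub>M\<^esub>} \<or> N = carrier M)"

definition sp_iso :: "nat \<Rightarrow> 'v sp_mod \<Rightarrow> 'w sp_mod \<Rightarrow> bool" where
  "sp_iso n M M' \<longleftrightarrow> sp_module n M \<and> sp_module n M' \<and>
     (\<exists>\<phi>. bij_betw \<phi> (carrier M) (carrier M') \<and>
        (\<forall>v \<in> carrier M. \<forall>w \<in> carrier M. \<phi> (v \<oplus>\<^bsub>M\<^esub> w) = \<phi> v \<oplus>\<^bsub>M'\<^esub> \<phi> w) \<and>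
        (\<forall>c. \<forall>v \<in> carrier M. \<phi> (c \<odot>\<^bsub>M\<^esub> v) = c \<odot>\<^bsub>M'\<^esub> \<phi> v) \<and>
        (\<forall>X \<in> sp n. \<forall>v \<in> carrier M. \<phi> (act M X v) = act M' X (\<phi> v)))"

text \<open>
  The quotient by a submodule, realized on cosets. The unions are over all representatives;
  for a submodule each of them is a single coset.
\<close>

definition sp_quot :: "'v sp_mod \<Rightarrow> 'v set \<Rightarrow> 'v set sp_mod" where
  "sp_quot M N = \<lparr>carrier = a_rcosets\<^bsub>M\<^esub> N, mult = undefined, one = undefined,
     zero = N, add = set_add M,
     smult = (\<lambda>c A. \<Union>v \<in> A. N +>\<^bsub>M\<^esub> (c \<odot>\<^bsub>M\<^esub> v)),
     act = (\<lambda>X A. \<Union>v \<in> A. N +>\<^bsub>M\<^esub> act M X v)\<rparr>"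

section \<open>Universal enveloping algebra, Verma modules and their simple quotients\<close>

text \<open>
  The free unital associative algebra on the set \<open>sp n\<close>: finitely supported functions on words,
  multiplied by convolution along concatenation. The enveloping algebra is its quotient by the
  two-sided ideal that makes \<open>X \<mapsto> letter X\<close> linear and turns brackets into commutators.
\<close>

definition free_alg :: "nat \<Rightarrow> (complex mat list \<Rightarrow> complex) ring" where
  "free_alg n = \<lparr>carrier = {a. finite {w. a w \<noteq> 0} \<and> (\<forall>w. a w \<noteq> 0 \<longrightarrow> set w \<subseteq> sp n)},
     mult = (\<lambda>a b w. \<Sum>k \<le> length w. a (take k w) * b (drop k w)),
     one = (\<lambda>w. if w = [] then 1 else 0),
     zero = (\<lambda>w. 0),
     add = (\<lambda>a b w. a w + b w)\<rparr>"

definition letter :: "complex mat \<Rightarrow> complex mat list \<Rightarrow> complex" where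
  "letter X = (\<lambda>w. if w = [X] then 1 else 0)"

definition scalar :: "complex \<Rightarrow> complex mat list \<Rightarrow> complex" where
  "scalar c = (\<lambda>w. if w = [] then c else 0)"

definition env_relations :: "nat \<Rightarrow> (complex mat list \<Rightarrow> complex) set" where
  "env_relations n = (let F = free_alg n in
     {letter (X + Y) \<ominus>\<^bsub>F\<^esub> (letter X \<oplus>\<^bsub>F\<^esub> letter Y) | X Y. X \<in> sp n \<and> Y \<in> sp n}
     \<union> {letter (c \<cdot>\<^sub>m X) \<ominus>\<^bsub>F\<^esub> (scalar c \<otimes>\<^bsub>F\<^esub> letter X) | c X. X \<in> sp n}
     \<union> {(letter X \<otimes>\<^bsub>F\<^esub> letter Y \<ominus>\<^bsub>F\<^esub> letter Y \<otimes>\<^bsub>F\<^esub> letter X) \<ominus>\<^bsub>F\<^esub> letter (bracket X Y) | X Y.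
          X \<in> sp n \<and> Y \<in> sp n})"

definition env_ideal :: "nat \<Rightarrow> (complex mat list \<Rightarrow> complex) set" where
  "env_ideal n = Idl\<^bsub>free_alg n\<^esub> (env_relations n)"

definition env_alg :: "nat \<Rightarrow> (complex mat list \<Rightarrow> complex) set ring" where
  "env_alg n = free_alg n Quot env_ideal n"

definition env_of :: "nat \<Rightarrow> complex mat \<Rightarrow> (complex mat list \<Rightarrow> complex) set" where
  "env_of n X = env_ideal n +>\<^bsub>free_alg n\<^esub> letter X"

definition env_scalar :: "nat \<Rightarrow> complex \<Rightarrow> (complex mat list \<Rightarrow> complex) set" where
  "env_scalar n c = env_ideal n +>\<^bsub>free_alg n\<^esub> scalar c"

text \<open>The enveloping algebra as a module over itself by left multiplication.\<close>

definition env_module :: "nat \<Rightarrow> (complex mat list \<Rightarrow> complex) set sp_mod" where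
  "env_module n = \<lparr>carrier = carrier (env_alg n), mult = undefined, one = undefined,
     zero = zero (env_alg n), add = add (env_alg n),
     smult = (\<lambda>c u. env_scalar n c \<otimes>\<^bsub>env_alg n\<^esub> u),
     act = (\<lambda>X u. env_of n X \<otimes>\<^bsub>env_alg n\<^esub> u)\<rparr>"

definition left_ideal_gen :: "('a, 'b) ring_scheme \<Rightarrow> 'a set \<Rightarrow> 'a set" where
  "left_ideal_gen R S = \<Inter>{J. additive_subgroup J R \<and>
     (\<forall>r \<in> carrier R. \<forall>x \<in> J. r \<otimes>\<^bsub>R\<^esub> x \<in> J) \<and> S \<subseteq> J}"

text \<open>
  The Verma module of highest weight \<open>\<mu>\<close> is the quotient of the enveloping algebra by the left
  ideal generated by \<open>n_plus n\<close> and all \<open>H - \<mu> H\<close> with \<open>H \<in> cartan n\<close>.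
\<close>

definition verma_ideal ::
    "nat \<Rightarrow> (complex mat \<Rightarrow> complex) \<Rightarrow> (complex mat list \<Rightarrow> complex) set set" where
  "verma_ideal n \<mu> = left_ideal_gen (env_alg n)
     (env_of n ` n_plus n \<union>
      {env_of n H \<ominus>\<^bsub>env_alg n\<^esub> env_scalar n (\<mu> H) | H. H \<in> cartan n})"

definition verma ::
    "nat \<Rightarrow> (complex mat \<Rightarrow> complex) \<Rightarrow> (complex mat list \<Rightarrow> complex) set set sp_mod" where
  "verma n \<mu> = sp_quot (env_module n) (verma_ideal n \<mu>)"

definition simple_hw_module ::
    "nat \<Rightarrow> (complex mat \<Rightarrow> complex) \<Rightarrow> (complex mat list \<Rightarrow> complex) set set set sp_mod" where
  "simple_hw_module n \<mu> = sp_quot (verma n \<mu>)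
     (THE N. sp_submodule n (verma n \<mu>) N \<and> sp_irreducible n (sp_quot (verma n \<mu>) N))"

section \<open>Global sections on the total space of O(-2)\<close>

text \<open>
  Points of affine \<open>(n + 1)\<close>-space are functions \<open>Q\<close> on the naturals supported in
  \<open>{1..n + 1}\<close>; \<open>cover n\<close> is the open subset where \<open>(Q 1, \<dots>, Q n) \<noteq> 0\<close>.
\<close>

definition cover :: "nat \<Rightarrow> (nat \<Rightarrow> complex) set" where
  "cover n = {Q. (\<forall>i. i \<notin> {1..n + 1} \<longrightarrow> Q i = 0) \<and> (\<exists>i \<in> {1..n}. Q i \<noteq> 0)}"

definition gm_act :: "nat \<Rightarrow> complex \<Rightarrow> (nat \<Rightarrow> complex) \<Rightarrow> nat \<Rightarrow> complex" where
  "gm_act n u Q = (\<lambda>i. if i = n + 1 then u powi (-2) * Q i else u * Q i)"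

definition gm_orbit :: "nat \<Rightarrow> (nat \<Rightarrow> complex) \<Rightarrow> (nat \<Rightarrow> complex) set" where
  "gm_orbit n Q = {gm_act n u Q | u. u \<noteq> 0}"

definition tot_space :: "nat \<Rightarrow> (nat \<Rightarrow> complex) set set" where
  "tot_space n = gm_orbit n ` cover n"

definition preimage :: "nat \<Rightarrow> (nat \<Rightarrow> complex) set set \<Rightarrow> (nat \<Rightarrow> complex) set" where
  "preimage n U = {Q \<in> cover n. gm_orbit n Q \<in> U}"

definition polynomial_fun :: "nat \<Rightarrow> ((nat \<Rightarrow> complex) \<Rightarrow> complex) \<Rightarrow> bool" where
  "polynomial_fun n g \<longleftrightarrow> (\<exists>A c. finite (A :: (nat \<Rightarrow> nat) set) \<and>
     g = (\<lambda>Q. \<Sum>\<mu> \<in> A. c \<mu> * (\<Prod>i = 1..n + 1. Q i ^ \<mu> i)))"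

text \<open>
  Regularity on a Zariski open set \<open>V\<close>: near every point a quotient of polynomials. The
  neighbourhood may be taken to be the locus in \<open>V\<close> where the denominator does not vanish,
  since smaller principal opens are reached by multiplying numerator and denominator.
\<close>

definition regular_on :: "nat \<Rightarrow> (nat \<Rightarrow> complex) set \<Rightarrow> ((nat \<Rightarrow> complex) \<Rightarrow> complex) \<Rightarrow> bool" where
  "regular_on n V f \<longleftrightarrow> (\<forall>p \<in> V. \<exists>g h. polynomial_fun n g \<and> polynomial_fun n h \<and> h p \<noteq> 0 \<and>
     (\<forall>Q \<in> V. h Q \<noteq> 0 \<longrightarrow> f Q = g Q / h Q))"

text \<open>
  Sections of \<open>O(l D\<^sub>0)\<close> over an open subset \<open>U\<close> of \<open>tot_space n\<close>. Functions are extended by 0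
  outside the preimage of \<open>U\<close>, so that equality of sections is equality of functions.
\<close>

definition line_bundle_sections ::
    "nat \<Rightarrow> int \<Rightarrow> (nat \<Rightarrow> complex) set set \<Rightarrow> ((nat \<Rightarrow> complex) \<Rightarrow> complex) set" where
  "line_bundle_sections n l U = {f. regular_on n (preimage n U) f \<and>
     (\<forall>Q \<in> preimage n U. \<forall>u. u \<noteq> 0 \<longrightarrow> f (gm_act n u Q) = u powi l * f Q) \<and>
     (\<forall>Q. Q \<notin> preimage n U \<longrightarrow> f Q = 0)}"

definition H0 :: "nat \<Rightarrow> int \<Rightarrow> ((nat \<Rightarrow> complex) \<Rightarrow> complex) set" where
  "H0 n l = line_bundle_sections n l (tot_space n)"

definition H0_mod ::
    "nat \<Rightarrow> int \<Rightarrow> (complex mat \<Rightarrow> ((nat \<Rightarrow> complex) \<Rightarrow> complex) \<Rightarrow> (nat \<Rightarrow> complex) \<Rightarrow> complex)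
      \<Rightarrow> ((nat \<Rightarrow> complex) \<Rightarrow> complex) sp_mod" where
  "H0_mod n l \<rho> = \<lparr>carrier = H0 n l, mult = undefined, one = undefined,
     zero = (\<lambda>Q. 0), add = (\<lambda>f g Q. f Q + g Q), smult = (\<lambda>c f Q. c * f Q), act = \<rho>\<rparr>"

definition pd :: "nat \<Rightarrow> ((nat \<Rightarrow> complex) \<Rightarrow> complex) \<Rightarrow> (nat \<Rightarrow> complex) \<Rightarrow> complex" where
  "pd i f Q = deriv (\<lambda>z. f (Q(i := z))) (Q i)"

text \<open>
  \<open>sp_structure n l \<rho>\<close>: the map \<open>\<rho>\<close> is the module structure on global sections in which the
  Chevalley generators act by the given differential operators. It determines \<open>\<rho>\<close> on
  \<open>sp n\<close> and \<open>H0 n l\<close>, as the Chevalley generators generate \<open>sp n\<close>. The operator for \<open>e\<^sub>n\<close>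
  divides by the last coordinate, so it is evaluated on the dense open set where this
  coordinate is nonzero; that determines the resulting section.
\<close>

definition sp_structure ::
    "nat \<Rightarrow> int \<Rightarrow> (complex mat \<Rightarrow> ((nat \<Rightarrow> complex) \<Rightarrow> complex) \<Rightarrow> (nat \<Rightarrow> complex) \<Rightarrow> complex)
      \<Rightarrow> bool" where
  "sp_structure n l \<rho> \<longleftrightarrow> sp_module n (H0_mod n l \<rho>) \<and>
     (\<forall>f \<in> H0 n l. \<forall>Q \<in> cover n.
        (\<forall>i \<in> {1..<n}.
           \<rho> (chev_e n i) f Q = - Q (i + 1) * pd i f Q \<and>
           \<rho> (chev_h n i) f Q = - Q i * pd i f Q + Q (i + 1) * pd (i + 1) f Q \<and>
           \<rho> (chev_f n i) f Q = - Q i * pd (i + 1) f Q) \<and>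
        (Q (n + 1) \<noteq> 0 \<longrightarrow>
           \<rho> (chev_e n n) f Q = 1 / 2 * pd n (pd n (\<lambda>R. inverse (R (n + 1)) * f R)) Q) \<and>
        \<rho> (chev_h n n) f Q = - Q n * pd n f Q - 1 / 2 * f Q \<and>
        \<rho> (chev_f n n) f Q = - 1 / 2 * (Q n)\<^sup>2 * Q (n + 1) * f Q)"

end

theory Submission
  imports Defs "HOL-Computational_Algebra.Fundamental_Theorem_Algebra"
    "HOL-Computational_Algebra.Primes" "HOL-Library.Infinite_Set"
begin

text \<open>
  A function that is regular on the cover, affine space minus the locus
  \<open>Q\<^sub>1 = \<dots> = Q\<^sub>n = 0\<close>, is a polynomial, because this locus has codimension \<open>n \<ge> 2\<close>
  (\<open>regular_polynomial\<close>). Here this is seen through interpolation. Most lines parallel to a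
  coordinate axis stay inside the cover, and the restriction of the function to such a line is a
  polynomial whose degree is bounded by that of one global numerator. By continuity the resulting
  Lagrange formula holds at every point of the cover, and applied in each variable it writes the
  function as a polynomial with coefficients among its values on a finite grid. Homogeneity of
  weight \<open>-k\<close> leaves the monomials \<open>Q\<^sup>\<alpha> Q\<^bsub>n+1\<^esub>\<^bsup>(|\<alpha>|+k)/2\<^esup>\<close> with \<open>\<alpha>\<close> an exponent in
  the first \<open>n\<close> variables and \<open>|\<alpha>| + k\<close> even. So sections correspond to polynomials in \<open>n\<close>
  variables with the parity of \<open>k\<close> (\<open>to_sec_H0\<close>, \<open>H0_to_sec\<close>, \<open>to_sec_eqI\<close>).

  Under this correspondence the last variable disappears from the Chevalley operators, and they
  become the quadratic expressions in \<open>Q\<^sub>i\<close> and \<open>\<partial>\<^sub>i\<close> of the oscillator representation. That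
  one is defined for a whole matrix at once as \<open>\<Sum> X\<^sub>a\<^sub>b y\<^sub>a z\<^sub>b / 2\<close>, where \<open>y\<close> and \<open>z\<close> are
  dual bases of the symplectic space spanned by the \<open>Q\<^sub>i\<close> and \<open>\<partial>\<^sub>i\<close>; the canonical
  commutation relations make it compatible with brackets (\<open>osc_bracket\<close>). This gives a module
  structure, and every structure with the prescribed Chevalley operators agrees with it on the
  Chevalley generators.

  The module is irreducible (\<open>H0_irreducible\<close>). The operators \<open>Q\<^sub>i \<partial>\<^sub>i\<close>, which come from the
  Cartan subalgebra, separate monomials, so a nonzero submodule contains a monomial. The
  generators \<open>e\<^sub>i, f\<^sub>i\<close> with \<open>i < n\<close> move exponents between neighbouring variables, and
  \<open>e\<^sub>n, f\<^sub>n\<close> change the exponent of \<open>Q\<^sub>n\<close> by two, always with a nonzero factor; hence all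
  monomials of one parity are reached. The monomial \<open>1\<close> for even \<open>k\<close>, or
  \<open>Q\<^sub>n\<close> for odd \<open>k\<close>, is killed by all \<open>e\<^sub>i\<close>, and the eigenvalues of the \<open>h\<^sub>i\<close> on it are
  those of the two weights in question.

  It remains to see that an irreducible module with a highest weight vector of weight \<open>\<mu>\<close> is the
  simple quotient of the Verma module (\<open>irreducible_iso_simple_hw_module\<close>). The universal property
  of the Verma module (\<open>verma_hom\<close>) makes it a quotient by some submodule, which is then maximal.
  A Verma module has only one maximal submodule (\<open>maximal_submodule_unique\<close>): an element of the
  Cartan subalgebra on which all simple roots are \<open>1\<close> acts by pairwise different scalars on the
  layers below the highest weight vector, so every submodule is graded, the proper ones have no
  component along that vector, and hence a sum of two proper submodules is proper.
\<close>

section \<open>The symplectic Lie algebra and its Chevalley generators\<close>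

lemma mat_unit_carrier [simp]: "mat_unit n i j \<in> carrier_mat (2 * n) (2 * n)"
  by (simp add: mat_unit_def)

lemma mat_unit_dim [simp]: "dim_row (mat_unit n i j) = 2 * n" "dim_col (mat_unit n i j) = 2 * n"
  by (simp_all add: mat_unit_def)

lemma mat_unit_index [simp]:
  "p < 2 * n \<Longrightarrow> q < 2 * n \<Longrightarrow> mat_unit n i j $$ (p, q) = (if p + 1 = i \<and> q + 1 = j then 1 else 0)"
  by (simp add: mat_unit_def)

lemma mat_unit_mult:
  "mat_unit n i j * mat_unit n k l = (if j = k \<and> 1 \<le> j \<and> j \<le> 2 * n then mat_unit n i l else 0\<^sub>m (2 * n) (2 * n))"
proof (rule eq_matI)
  fix p q assume "p < dim_row (if j = k \<and> 1 \<le> j \<and> j \<le> 2 * n then mat_unit n i l else 0\<^sub>m (2 * n) (2 * n))"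
    and "q < dim_col (if j = k \<and> 1 \<le> j \<and> j \<le> 2 * n then mat_unit n i l else 0\<^sub>m (2 * n) (2 * n))"
  then have pq: "p < 2 * n" "q < 2 * n" by (auto split: if_splits)
  have "(mat_unit n i j * mat_unit n k l) $$ (p, q) =
      (\<Sum>t<2*n. mat_unit n i j $$ (p, t) * mat_unit n k l $$ (t, q))"
    using pq by (simp add: scalar_prod_def lessThan_atLeast0)
  also have "\<dots> = (\<Sum>t<2*n. if t = j - 1 then (if p + 1 = i \<and> j = k \<and> 1 \<le> j \<and> q + 1 = l then 1 else 0) else 0)"
    using pq by (intro sum.cong) auto
  also have "\<dots> = (if j - 1 < 2 * n \<and> p + 1 = i \<and> j = k \<and> 1 \<le> j \<and> q + 1 = l then 1 else 0)"
    by simp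
  finally show "(mat_unit n i j * mat_unit n k l) $$ (p, q) =
     (if j = k \<and> 1 \<le> j \<and> j \<le> 2 * n then mat_unit n i l else 0\<^sub>m (2 * n) (2 * n)) $$ (p, q)"
    using pq by (auto split: if_splits)
qed auto

lemma symp_form_carrier [simp]: "symp_form n \<in> carrier_mat (2 * n) (2 * n)"
  by (auto simp: symp_form_def mult_2)

lemma symp_form_index:
  "p < 2 * n \<Longrightarrow> q < 2 * n \<Longrightarrow>
     symp_form n $$ (p, q) = (if q = p + n then 1 else if p = q + n then -1 else 0)"
  by (auto simp: symp_form_def)

lemma sp_carrier: "X \<in> sp n \<Longrightarrow> X \<in> carrier_mat (2 * n) (2 * n)"
  by (simp add: sp_def)

lemma transpose_times_symp_form:
  assumes "X \<in> carrier_mat (2 * n) (2 * n)" "p < 2 * n" "q < 2 * n"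
  shows "(transpose_mat X * symp_form n) $$ (p, q) = (if n \<le> q then X $$ (q - n, p) else - X $$ (q + n, p))"
proof -
  have "(transpose_mat X * symp_form n) $$ (p, q) = (\<Sum>t<2*n. X $$ (t, p) * symp_form n $$ (t, q))"
    using assms carrier_matD[OF symp_form_carrier[of n]] by (simp add: scalar_prod_def lessThan_atLeast0)
  also have "\<dots> = (\<Sum>t<2*n. if t = (if n \<le> q then q - n else q + n)
      then (if n \<le> q then X $$ (q - n, p) else - X $$ (q + n, p)) else 0)"
    using assms by (intro sum.cong) (auto simp: symp_form_index)
  also have "\<dots> = (if n \<le> q then X $$ (q - n, p) else - X $$ (q + n, p))"
    using assms by auto
  finally show ?thesis .
qed

lemma symp_form_times:
  assumes "X \<in> carrier_mat (2 * n) (2 * n)" "p < 2 * n" "q < 2 * n"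
  shows "(symp_form n * X) $$ (p, q) = (if p < n then X $$ (p + n, q) else - X $$ (p - n, q))"
proof -
  have "(symp_form n * X) $$ (p, q) = (\<Sum>t<2*n. symp_form n $$ (p, t) * X $$ (t, q))"
    using assms carrier_matD[OF symp_form_carrier[of n]] by (simp add: scalar_prod_def lessThan_atLeast0)
  also have "\<dots> = (\<Sum>t<2*n. if t = (if p < n then p + n else p - n)
      then (if p < n then X $$ (p + n, q) else - X $$ (p - n, q)) else 0)"
    using assms by (intro sum.cong) (auto simp: symp_form_index)
  also have "\<dots> = (if p < n then X $$ (p + n, q) else - X $$ (p - n, q))"
    using assms by auto
  finally show ?thesis .
qed

text \<open>The block form of a symplectic matrix: with blocks \<open>A, B, C, D\<close> the condition is that
  \<open>D\<close> is minus the transpose of \<open>A\<close> and that \<open>B\<close> and \<open>C\<close> are symmetric.\<close>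

lemma sp_iff:
  "X \<in> sp n \<longleftrightarrow> X \<in> carrier_mat (2 * n) (2 * n) \<and>
     (\<forall>i<n. \<forall>j<n. X $$ (n + i, n + j) = - X $$ (j, i) \<and> X $$ (i, n + j) = X $$ (j, n + i) \<and>
        X $$ (n + i, j) = X $$ (n + j, i))" (is "_ \<longleftrightarrow> _ \<and> ?R")
proof (cases "X \<in> carrier_mat (2 * n) (2 * n)")
  case True
  let ?L = "\<lambda>p q. (if n \<le> q then X $$ (q - n, p) else - X $$ (q + n, p)) +
      (if p < n then X $$ (p + n, q) else - X $$ (p - n, q))"
  have "X \<in> sp n \<longleftrightarrow> (\<forall>p<2*n. \<forall>q<2*n. ?L p q = 0)"
  proof -
    have "transpose_mat X * symp_form n + symp_form n * X = 0\<^sub>m (2 * n) (2 * n) \<longleftrightarrow>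
        (\<forall>p<2*n. \<forall>q<2*n. (transpose_mat X * symp_form n + symp_form n * X) $$ (p, q) = 0)"
      using True carrier_matD[OF symp_form_carrier[of n]] by (auto simp: mat_eq_iff)
    also have "\<dots> \<longleftrightarrow> (\<forall>p<2*n. \<forall>q<2*n. ?L p q = 0)"
    proof -
      have "(transpose_mat X * symp_form n + symp_form n * X) $$ (p, q) = ?L p q"
        if "p < 2*n" "q < 2*n" for p q
        using that True carrier_matD[OF symp_form_carrier[of n]]
        by (simp add: transpose_times_symp_form symp_form_times del: index_mult_mat(1))
      then show ?thesis by simp
    qed
    finally show ?thesis using True by (simp add: sp_def)
  qed
  also have "\<dots> \<longleftrightarrow> ?R"
  proof
    assume L: "\<forall>p<2*n. \<forall>q<2*n. ?L p q = 0"
    show ?R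
    proof (intro allI impI)
      fix i j assume "i < n" "j < n"
      then show "X $$ (n + i, n + j) = - X $$ (j, i) \<and> X $$ (i, n + j) = X $$ (j, n + i) \<and>
        X $$ (n + i, j) = X $$ (n + j, i)"
        using L[rule_format, of i "n + j"] L[rule_format, of "n + i" "n + j"] L[rule_format, of i j]
        by (simp add: add.commute eq_neg_iff_add_eq_0)
    qed
  next
    assume R: ?R
    show "\<forall>p<2*n. \<forall>q<2*n. ?L p q = 0"
    proof (intro allI impI)
      fix p q assume pq: "p < 2 * n" "q < 2 * n"
      consider "p < n" "q < n" | "p < n" "n \<le> q" | "n \<le> p" "q < n" | "n \<le> p" "n \<le> q" by linarith
      then show "?L p q = 0"
      proof cases
        case 1 then show ?thesis using R[rule_format, of p q] by (simp add: add.commute)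
      next
        case 2 then show ?thesis using pq R[rule_format, of p "q - n"] by (simp add: add.commute)
      next
        case 3 then show ?thesis using pq R[rule_format, of q "p - n"] by (simp add: add.commute)
      next
        case 4 then show ?thesis using pq R[rule_format, of "p - n" "q - n"] by (simp add: add.commute)
      qed
    qed
  qed
  finally show ?thesis using True by simp
qed (simp add: sp_def)

lemma sp_add: "X \<in> sp n \<Longrightarrow> Y \<in> sp n \<Longrightarrow> X + Y \<in> sp n"
  unfolding sp_iff by auto

lemma sp_smult: "X \<in> sp n \<Longrightarrow> c \<cdot>\<^sub>m X \<in> sp n"
  unfolding sp_iff by auto

lemma bracket_carrier:
  "X \<in> carrier_mat (2 * n) (2 * n) \<Longrightarrow> Y \<in> carrier_mat (2 * n) (2 * n) \<Longrightarrow> bracket X Y \<in> carrier_mat (2 * n) (2 * n)"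
  unfolding bracket_def by auto

lemma bracket_index:
  assumes "X \<in> carrier_mat (2 * n) (2 * n)" "Y \<in> carrier_mat (2 * n) (2 * n)" "p < 2 * n" "q < 2 * n"
  shows "bracket X Y $$ (p, q) = (\<Sum>k<2*n. X $$ (p, k) * Y $$ (k, q)) - (\<Sum>k<2*n. Y $$ (p, k) * X $$ (k, q))"
  using assms by (simp add: bracket_def scalar_prod_def lessThan_atLeast0)

lemma sp_iff_transpose:
  "X \<in> sp n \<longleftrightarrow> X \<in> carrier_mat (2 * n) (2 * n) \<and> transpose_mat X * symp_form n = - (symp_form n * X)"
proof (cases "X \<in> carrier_mat (2 * n) (2 * n)")
  case True
  have c: "transpose_mat X * symp_form n \<in> carrier_mat (2 * n) (2 * n)" "symp_form n * X \<in> carrier_mat (2 * n) (2 * n)"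
    using True by (auto intro!: mult_carrier_mat[of _ _ "2*n"])
  show ?thesis using True unfolding sp_def mat_eq_iff using carrier_matD[OF c(1)] carrier_matD[OF c(2)]
    by (auto simp: eq_neg_iff_add_eq_0 simp del: index_mult_mat(1))
qed (simp add: sp_def)

lemma sp_bracket:
  assumes "X \<in> sp n" "Y \<in> sp n" shows "bracket X Y \<in> sp n"
proof -
  let ?J = "symp_form n"
  have X: "X \<in> carrier_mat (2*n) (2*n)" and Y: "Y \<in> carrier_mat (2*n) (2*n)"
    using assms by (auto simp: sp_carrier)
  have J: "?J \<in> carrier_mat (2*n) (2*n)" by simp
  have swap: "transpose_mat (A * B) * ?J = ?J * (B * A)" if AB: "A \<in> sp n" "B \<in> sp n" for A B
  proof -
    have A: "A \<in> carrier_mat (2*n) (2*n)" and B: "B \<in> carrier_mat (2*n) (2*n)"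
      using AB by (auto simp: sp_carrier)
    have At: "transpose_mat A \<in> carrier_mat (2*n) (2*n)" and Bt: "transpose_mat B \<in> carrier_mat (2*n) (2*n)"
      using A B by auto
    have "transpose_mat (A * B) * ?J = transpose_mat B * (transpose_mat A * ?J)"
      using transpose_mult[OF A B] assoc_mult_mat[OF Bt At J] by simp
    also have "\<dots> = transpose_mat B * (- (?J * A))" using AB by (simp add: sp_iff_transpose)
    also have "\<dots> = - (transpose_mat B * (?J * A))"
      using uminus_mult_right_mat[of "transpose_mat B" "?J * A"] carrier_matD[OF J] A B by auto
    also have "transpose_mat B * (?J * A) = (transpose_mat B * ?J) * A"
      using assoc_mult_mat[OF Bt J A] by simp
    also have "\<dots> = (- (?J * B)) * A" using AB by (simp add: sp_iff_transpose)
    also have "\<dots> = - ((?J * B) * A)"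
      using uminus_mult_left_mat[of "?J * B" A] A B by auto
    also have "(?J * B) * A = ?J * (B * A)" by (rule assoc_mult_mat[OF J B A])
    finally show ?thesis by simp
  qed
  have XY: "X * Y \<in> carrier_mat (2*n) (2*n)" and YX: "Y * X \<in> carrier_mat (2*n) (2*n)" using X Y by auto
  have "transpose_mat (X * Y - Y * X) * ?J = transpose_mat (X * Y) * ?J - transpose_mat (Y * X) * ?J"
    using transpose_minus[OF XY YX] minus_mult_distrib_mat[of "transpose_mat (X * Y)" "2*n" "2*n" "transpose_mat (Y * X)" ?J "2*n"]
      XY YX by auto
  also have "\<dots> = ?J * (Y * X) - ?J * (X * Y)" using swap assms by simp
  also have "\<dots> = - (?J * (X * Y) - ?J * (Y * X))"
    using carrier_matD[OF J] carrier_matD[OF XY] carrier_matD[OF YX]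
    by (intro eq_matI) (auto simp del: index_mult_mat(1))
  also have "?J * (X * Y) - ?J * (Y * X) = ?J * (X * Y - Y * X)"
    using mult_minus_distrib_mat[OF J XY YX] by simp
  finally show ?thesis using bracket_carrier[OF X Y] by (simp add: sp_iff_transpose bracket_def)
qed

text \<open>Root vectors and diagonal elements: \<open>mat_a\<close> has \<open>E\<^sub>i\<^sub>j\<close> as its upper left block, \<open>mat_b\<close> and
  \<open>mat_c\<close> have the symmetrization of \<open>E\<^sub>i\<^sub>j\<close> as upper right and lower left block. Indices
  start at 1, those of matrix entries at 0. On the diagonal \<open>mat_b n i i\<close> is twice a matrix unit.\<close>

definition mat_a :: "nat \<Rightarrow> nat \<Rightarrow> nat \<Rightarrow> complex mat" where
  "mat_a n i j = mat_unit n i j - mat_unit n (n + j) (n + i)"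
definition mat_b :: "nat \<Rightarrow> nat \<Rightarrow> nat \<Rightarrow> complex mat" where
  "mat_b n i j = mat_unit n i (n + j) + mat_unit n j (n + i)"
definition mat_c :: "nat \<Rightarrow> nat \<Rightarrow> nat \<Rightarrow> complex mat" where
  "mat_c n i j = mat_unit n (n + i) j + mat_unit n (n + j) i"

lemma mat_abc_carrier [simp]:
  "mat_a n i j \<in> carrier_mat (2*n) (2*n)" "mat_b n i j \<in> carrier_mat (2*n) (2*n)" "mat_c n i j \<in> carrier_mat (2*n) (2*n)"
  unfolding mat_a_def mat_b_def mat_c_def by (auto simp: mat_unit_def)

lemma mat_abc_dim [simp]:
  "dim_row (mat_a n i j) = 2*n" "dim_row (mat_b n i j) = 2*n" "dim_row (mat_c n i j) = 2*n"
  "dim_col (mat_a n i j) = 2*n" "dim_col (mat_b n i j) = 2*n" "dim_col (mat_c n i j) = 2*n"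
  unfolding mat_a_def mat_b_def mat_c_def by auto

lemma mat_abc_sp:
  assumes "1 \<le> i" "i \<le> n" "1 \<le> j" "j \<le> n"
  shows "mat_a n i j \<in> sp n" "mat_b n i j \<in> sp n" "mat_c n i j \<in> sp n"
proof -
  define r s where "r = i - 1" and "s = j - 1"
  have rs: "i = Suc r" "j = Suc s" "r < n" "s < n"
    using assms by (simp_all add: r_def s_def)
  have ne: "(n + p = r) = False" "(n + p = s) = False" for p using rs by auto
  have ne': "p < n \<Longrightarrow> (p = n + r) = False" "p < n \<Longrightarrow> (p = n + s) = False" for p by auto
  show "mat_a n i j \<in> sp n" "mat_b n i j \<in> sp n" "mat_c n i j \<in> sp n"
    unfolding sp_iff mat_a_def mat_b_def mat_c_def rs
    by (simp_all add: ne ne' conj_commute minus_carrier_mat split del: if_split)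
qed

lemma chev_e_eq: "i < n \<Longrightarrow> chev_e n i = mat_a n i (i + 1)" "chev_e n n = (1/2) \<cdot>\<^sub>m mat_b n n n"
  unfolding chev_e_def mat_a_def mat_b_def by (simp add: add.assoc, intro eq_matI, auto simp: mult_2[symmetric])

lemma chev_f_eq: "i < n \<Longrightarrow> chev_f n i = mat_a n (i + 1) i" "chev_f n n = (1/2) \<cdot>\<^sub>m mat_c n n n"
  unfolding chev_f_def mat_a_def mat_c_def by (simp add: add.assoc, intro eq_matI, auto simp: mult_2[symmetric])

lemma chev_h_eq: "i < n \<Longrightarrow> chev_h n i = mat_a n i i - mat_a n (i + 1) (i + 1)" "chev_h n n = mat_a n n n"
proof -
  show "chev_h n n = mat_a n n n" unfolding chev_h_def mat_a_def by (simp add: mult_2)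
  show "chev_h n i = mat_a n i i - mat_a n (i + 1) (i + 1)" if "i < n"
    by (rule eq_matI) (use that in \<open>simp_all add: chev_h_def mat_a_def\<close>)
qed

lemma sp_minus: "X \<in> sp n \<Longrightarrow> Y \<in> sp n \<Longrightarrow> X - Y \<in> sp n"
  unfolding sp_iff by auto

lemma chev_sp:
  assumes "1 \<le> i" "i \<le> n"
  shows "chev_e n i \<in> sp n" "chev_f n i \<in> sp n" "chev_h n i \<in> sp n"
  using assms by (cases "i < n"; auto simp: chev_e_eq chev_f_eq chev_h_eq intro!: mat_abc_sp sp_smult sp_minus)+

lemma mat_unit_mult_delta:
  "1 \<le> j \<Longrightarrow> j \<le> 2 * n \<Longrightarrow>
     mat_unit n i j * mat_unit n k l = (if j = k then 1 else 0) \<cdot>\<^sub>m mat_unit n i l"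
  by (auto simp: mat_unit_mult intro!: eq_matI)

lemma mat_distribs:
  assumes "A \<in> carrier_mat m m" "B \<in> carrier_mat m m" "C \<in> carrier_mat m m"
  shows "(A + B) * C = A * C + B * C" "C * (A + B) = C * A + C * B"
    "(A - B) * C = A * C - B * C" "C * (A - B) = C * A - (C :: complex mat) * B"
  using assms by (auto simp: add_mult_distrib_mat mult_add_distrib_mat minus_mult_distrib_mat mult_minus_distrib_mat)

lemma mult_pair:
  assumes "A \<in> carrier_mat m m" "B \<in> carrier_mat m m" "C \<in> carrier_mat m m" "D \<in> carrier_mat m m"
  shows "(A - B) * (C - D) = A * C - A * D - (B * C - (B :: complex mat) * D)"
    "(A - B) * (C + D) = A * C + A * D - (B * C + B * D)"
    "(C + D) * (A - B) = C * A - C * B + (D * A - D * B)"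
    "(A + B) * (C + D) = A * C + A * D + (B * C + B * D)"
  using assms
  by (simp_all add: mat_distribs[of _ m] minus_carrier_mat)
    (auto intro!: eq_matI simp del: index_mult_mat(1))

context
  fixes n i j k l :: nat
  assumes ijkl: "1 \<le> i" "i \<le> n" "1 \<le> j" "j \<le> n" "1 \<le> k" "k \<le> n" "1 \<le> l" "l \<le> n"
begin

lemma shifted_index_neq:
  "n + i \<noteq> j" "n + i \<noteq> k" "n + i \<noteq> l" "n + j \<noteq> i" "n + j \<noteq> k" "n + j \<noteq> l"
  "n + k \<noteq> i" "n + k \<noteq> j" "n + k \<noteq> l" "n + l \<noteq> i" "n + l \<noteq> j" "n + l \<noteq> k"
  "j \<noteq> n + i" "k \<noteq> n + i" "l \<noteq> n + i" "i \<noteq> n + j" "k \<noteq> n + j" "l \<noteq> n + j"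
  "i \<noteq> n + k" "j \<noteq> n + k" "l \<noteq> n + k" "i \<noteq> n + l" "j \<noteq> n + l" "k \<noteq> n + l"
  using ijkl by auto

lemma index_bounds: "i \<le> 2 * n" "j \<le> 2 * n" "k \<le> 2 * n" "l \<le> 2 * n"
   "n + i \<le> 2 * n" "n + j \<le> 2 * n" "n + k \<le> 2 * n" "n + l \<le> 2 * n"
   "1 \<le> n + i" "1 \<le> n + j" "1 \<le> n + k" "1 \<le> n + l"
  using ijkl by auto

lemma bracket_aa:
  "bracket (mat_a n i j) (mat_a n k l) =
     (if j = k then 1 else 0) \<cdot>\<^sub>m mat_a n i l - (if i = l then 1 else 0) \<cdot>\<^sub>m mat_a n k j"
  unfolding bracket_def mat_a_def
  apply (simp add: mult_pair[of _ "2*n"] mat_unit_mult_delta ijkl index_bounds shifted_index_neq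
      del: One_nat_def split del: if_split)
  apply (rule eq_matI)
    apply (simp_all add: eq_commute[of l] eq_commute[of k] algebra_simps
      del: One_nat_def split del: if_split)
  done

lemma bracket_ab:
  "bracket (mat_a n i j) (mat_b n k l) =
     (if j = k then 1 else 0) \<cdot>\<^sub>m mat_b n i l + (if j = l then 1 else 0) \<cdot>\<^sub>m mat_b n i k"
  unfolding bracket_def mat_a_def mat_b_def
  apply (simp add: mult_pair[of _ "2*n"] mat_unit_mult_delta ijkl index_bounds shifted_index_neq
      del: One_nat_def split del: if_split)
  apply (rule eq_matI)
    apply (simp_all add: eq_commute[of l] eq_commute[of k] algebra_simps
      del: One_nat_def split del: if_split)
  done

lemma bracket_ac:
  "bracket (mat_a n i j) (mat_c n k l) =
     (- (if i = k then 1 else 0)) \<cdot>\<^sub>m mat_c n j l + (- (if i = l then 1 else 0)) \<cdot>\<^sub>m mat_c n j k"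
  unfolding bracket_def mat_a_def mat_c_def
  apply (simp add: mult_pair[of _ "2*n"] mat_unit_mult_delta ijkl index_bounds shifted_index_neq
      del: One_nat_def split del: if_split)
  apply (rule eq_matI)
    apply (simp_all add: eq_commute[of l] eq_commute[of k] algebra_simps
      del: One_nat_def split del: if_split)
  done

lemma bracket_bc:
  "bracket (mat_b n i j) (mat_c n k l) =
     (if j = k then 1 else 0) \<cdot>\<^sub>m mat_a n i l + (if j = l then 1 else 0) \<cdot>\<^sub>m mat_a n i k
     + (if i = k then 1 else 0) \<cdot>\<^sub>m mat_a n j l + (if i = l then 1 else 0) \<cdot>\<^sub>m mat_a n j k"
  unfolding bracket_def mat_a_def mat_b_def mat_c_def
  apply (simp add: mult_pair[of _ "2*n"] mat_unit_mult_delta ijkl index_bounds shifted_index_neq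
      del: One_nat_def split del: if_split)
  apply (rule eq_matI)
    apply (simp_all add: eq_commute[of l] eq_commute[of k] algebra_simps
      del: One_nat_def split del: if_split)
  done

end

lemma smult_smult_one [simp]: "(1 :: complex) \<cdot>\<^sub>m A = A"
  by (rule eq_matI) auto

lemma mat_b_sym: "mat_b n i j = mat_b n j i" and mat_c_sym: "mat_c n i j = mat_c n j i"
  unfolding mat_b_def mat_c_def by (auto intro!: comm_add_mat[of _ "2*n" "2*n"])

lemma matrix_combination_closed:
  assumes "finite T" and G: "\<And>t. t \<in> T \<Longrightarrow> G t \<in> carrier_mat m m"
    and P: "\<And>t. t \<in> T \<Longrightarrow> c t \<noteq> 0 \<Longrightarrow> P (G t)" and zero: "P (0\<^sub>m m m)"
    and add: "\<And>X Y. P X \<Longrightarrow> P Y \<Longrightarrow> P (X + Y)" and smult: "\<And>c X. P X \<Longrightarrow> P (c \<cdot>\<^sub>m X)"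
  shows "P (mat m m (\<lambda>u. \<Sum>t\<in>T. c t * G t $$ u :: complex))"
  using assms(1) G P
proof (induction T rule: finite_induct)
  case empty
  have "mat m m (\<lambda>u. \<Sum>t\<in>{}. c t * G t $$ u) = 0\<^sub>m m m" by (auto intro!: eq_matI)
  then show ?case using zero by metis
next
  case (insert t T)
  let ?M = "\<lambda>T. mat m m (\<lambda>u. \<Sum>t\<in>T. c t * G t $$ u)"
  have IH: "P (?M T)" using insert by auto
  show ?case
  proof (cases "c t = 0")
    case True
    then have "?M (insert t T) = ?M T" using insert.hyps by simp
    then show ?thesis using IH by metis
  next
    case False
    have "?M (insert t T) = c t \<cdot>\<^sub>m G t + ?M T"
      using insert.hyps insert.prems(1)[of t] by (auto intro!: eq_matI)
    moreover have "P (c t \<cdot>\<^sub>m G t + ?M T)" using insert.prems(2)[of t] False IH add smult by auto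
    ultimately show ?thesis by metis
  qed
qed

text \<open>Premises restricted to the nonzero entries of \<open>X\<close> allow an application to diagonal matrices,
  where \<open>P\<close> is only known for diagonal elements.\<close>

lemma sp_spanning_closed:
  assumes X: "X \<in> sp n" and zero: "P (0\<^sub>m (2 * n) (2 * n))"
    and add: "\<And>X Y. P X \<Longrightarrow> P Y \<Longrightarrow> P (X + Y)" and smult: "\<And>c X. P X \<Longrightarrow> P (c \<cdot>\<^sub>m X)"
    and a: "\<And>i j. i < n \<Longrightarrow> j < n \<Longrightarrow> X $$ (i, j) \<noteq> 0 \<Longrightarrow> P (mat_a n (i + 1) (j + 1))"
    and b: "\<And>i j. i < n \<Longrightarrow> j < n \<Longrightarrow> X $$ (i, n + j) \<noteq> 0 \<Longrightarrow> P (mat_b n (i + 1) (j + 1))"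
    and c: "\<And>i j. i < n \<Longrightarrow> j < n \<Longrightarrow> X $$ (n + i, j) \<noteq> 0 \<Longrightarrow> P (mat_c n (i + 1) (j + 1))"
  shows "P X"
proof -
  let ?T = "{..<n} \<times> {..<n}"
  let ?M = "\<lambda>c G. mat (2 * n) (2 * n) (\<lambda>u. \<Sum>t\<in>?T. c t * G t $$ u)"
  define A where "A = ?M (\<lambda>t. X $$ t) (\<lambda>(i, j). mat_a n (i + 1) (j + 1))"
  \<comment> \<open>In the symmetric blocks both \<open>(i, j)\<close> and \<open>(j, i)\<close> contribute the same matrix, whence the halves.\<close>
  define B where "B = ?M (\<lambda>(i, j). X $$ (i, n + j) / 2) (\<lambda>(i, j). mat_b n (i + 1) (j + 1))"
  define C where "C = ?M (\<lambda>(i, j). X $$ (n + i, j) / 2) (\<lambda>(i, j). mat_c n (i + 1) (j + 1))"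
  have PA: "P A" unfolding A_def
    by (rule matrix_combination_closed) (auto simp: zero add smult a[simplified])
  have PB: "P B" unfolding B_def
    by (rule matrix_combination_closed) (auto simp: zero add smult b[simplified])
  have PC: "P C" unfolding C_def
    by (rule matrix_combination_closed) (auto simp: zero add smult c[simplified])
  have Xc: "X \<in> carrier_mat (2*n) (2*n)" using X by (rule sp_carrier)
  have r: "X $$ (n + i, n + j) = - X $$ (j, i)" "X $$ (i, n + j) = X $$ (j, n + i)" "X $$ (n + i, j) = X $$ (n + j, i)"
    if "i < n" "j < n" for i j
    using X that unfolding sp_iff by auto
  have pick: "(\<Sum>t\<in>?T. if t = u then f t else 0) = (if u \<in> ?T then f u else 0)" for u and f :: "nat \<times> nat \<Rightarrow> complex"
    by simp
  have pick': "(\<Sum>t\<in>?T. f t * (if t = u \<and> b then 1 else 0)) = (if u \<in> ?T \<and> b then f u else 0)"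
    for u b and f :: "nat \<times> nat \<Rightarrow> complex"
  proof -
    have "(\<Sum>t\<in>?T. f t * (if t = u \<and> b then 1 else 0)) = (\<Sum>t\<in>?T. if t = u then (if b then f t else 0) else 0)"
      by (rule sum.cong) auto
    then show ?thesis by simp
  qed
  have A_index: "A $$ (p, q) = (if (p, q) \<in> ?T then X $$ (p, q) else 0)
      - (if (q - n, p - n) \<in> ?T \<and> n \<le> p \<and> n \<le> q then X $$ (q - n, p - n) else 0)"
    if "p < 2 * n" "q < 2 * n" for p q
  proof -
    have "mat_a n (i + 1) (j + 1) $$ (p, q) = (if (i, j) = (p, q) \<and> True then 1 else 0) -
        (if (i, j) = (q - n, p - n) \<and> n \<le> p \<and> n \<le> q then 1 else 0)" for i j
    proof -
      have c: "(p + 1 = i + 1 \<and> q + 1 = j + 1) = ((i, j) = (p, q) \<and> True)"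
        "(p + 1 = n + (j + 1) \<and> q + 1 = n + (i + 1)) = ((i, j) = (q - n, p - n) \<and> n \<le> p \<and> n \<le> q)"
        by auto
      show ?thesis using that mat_unit_dim unfolding mat_a_def by (simp only: index_minus_mat mat_unit_index c)
    qed
    then have "A $$ (p, q) = (\<Sum>t\<in>?T. X $$ t * ((if t = (p, q) \<and> True then 1 else 0)
        - (if t = (q - n, p - n) \<and> n \<le> p \<and> n \<le> q then 1 else 0)))"
      unfolding A_def using that by (auto intro!: sum.cong split del: if_split)
    then show ?thesis by (simp only: right_diff_distrib sum_subtractf pick') simp
  qed
  have B_index: "B $$ (p, q) = (if (p, q - n) \<in> ?T \<and> n \<le> q then X $$ (p, n + (q - n)) / 2 else 0)
      + (if (q - n, p) \<in> ?T \<and> n \<le> q then X $$ (q - n, n + p) / 2 else 0)"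
    if "p < 2 * n" "q < 2 * n" for p q
  proof -
    have "mat_b n (i + 1) (j + 1) $$ (p, q) = (if (i, j) = (p, q - n) \<and> n \<le> q then 1 else 0) +
        (if (i, j) = (q - n, p) \<and> n \<le> q then 1 else 0)" for i j
    proof -
      have c: "(p + 1 = i + 1 \<and> q + 1 = n + (j + 1)) = ((i, j) = (p, q - n) \<and> n \<le> q)"
        "(p + 1 = j + 1 \<and> q + 1 = n + (i + 1)) = ((i, j) = (q - n, p) \<and> n \<le> q)"
        by auto
      show ?thesis using that mat_unit_dim unfolding mat_b_def by (simp only: index_add_mat mat_unit_index c)
    qed
    then have "B $$ (p, q) = (\<Sum>t\<in>?T. (case t of (i, j) \<Rightarrow> X $$ (i, n + j) / 2) *
        ((if t = (p, q - n) \<and> n \<le> q then 1 else 0) + (if t = (q - n, p) \<and> n \<le> q then 1 else 0)))"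
      unfolding B_def using that by (auto intro!: sum.cong split del: if_split)
    then show ?thesis by (simp only: distrib_left sum.distrib pick') simp
  qed
  have C_index: "C $$ (p, q) = (if (p - n, q) \<in> ?T \<and> n \<le> p then X $$ (n + (p - n), q) / 2 else 0)
      + (if (q, p - n) \<in> ?T \<and> n \<le> p then X $$ (n + q, p - n) / 2 else 0)"
    if "p < 2 * n" "q < 2 * n" for p q
  proof -
    have "mat_c n (i + 1) (j + 1) $$ (p, q) = (if (i, j) = (p - n, q) \<and> n \<le> p then 1 else 0) +
        (if (i, j) = (q, p - n) \<and> n \<le> p then 1 else 0)" for i j
    proof -
      have c: "(p + 1 = n + (i + 1) \<and> q + 1 = j + 1) = ((i, j) = (p - n, q) \<and> n \<le> p)"
        "(p + 1 = n + (j + 1) \<and> q + 1 = i + 1) = ((i, j) = (q, p - n) \<and> n \<le> p)"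
        by auto
      show ?thesis using that mat_unit_dim unfolding mat_c_def by (simp only: index_add_mat mat_unit_index c)
    qed
    then have "C $$ (p, q) = (\<Sum>t\<in>?T. (case t of (i, j) \<Rightarrow> X $$ (n + i, j) / 2) *
        ((if t = (p - n, q) \<and> n \<le> p then 1 else 0) + (if t = (q, p - n) \<and> n \<le> p then 1 else 0)))"
      unfolding C_def using that by (auto intro!: sum.cong split del: if_split)
    then show ?thesis by (simp only: distrib_left sum.distrib pick') simp
  qed
  have dims: "dim_row A = 2*n" "dim_row B = 2*n" "dim_row C = 2*n" "dim_col A = 2*n" "dim_col B = 2*n" "dim_col C = 2*n"
    by (simp_all add: A_def B_def C_def)
  have "X = A + (B + C)"
  proof (rule eq_matI)
    fix p q assume "p < dim_row (A + (B + C))" "q < dim_col (A + (B + C))"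
    then have pq: "p < 2 * n" "q < 2 * n" by (auto simp: dims)
    consider "p < n" "q < n" | "p < n" "n \<le> q" | "n \<le> p" "q < n" | "n \<le> p" "n \<le> q" by linarith
    then show "X $$ (p, q) = (A + (B + C)) $$ (p, q)"
    proof cases
      case 1 then show ?thesis using pq by (simp add: dims A_index B_index C_index)
    next
      case 2
      then have "q - n < n" using pq by auto
      then show ?thesis using 2 pq r(2)[of p "q - n"] by (simp add: dims A_index B_index C_index)
    next
      case 3
      then have "p - n < n" using pq by auto
      then show ?thesis using 3 pq r(3)[of "p - n" q] by (simp add: dims A_index B_index C_index)
    next
      case 4
      then have "p - n < n" "q - n < n" using pq by auto
      then show ?thesis using 4 pq r(1)[of "p - n" "q - n"] by (simp add: dims A_index B_index C_index)
    qed
  qed (use Xc dims in auto)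
  then show ?thesis using PA PB PC add by metis
qed

text \<open>Brackets of neighbouring \<open>e\<^sub>i\<close> and \<open>f\<^sub>i\<close> with \<open>i < n\<close> give all off-diagonal \<open>mat_a\<close>;
  \<open>[e\<^sub>n, f\<^sub>n]\<close> gives the diagonal ones; bracketing \<open>e\<^sub>n\<close> and \<open>f\<^sub>n\<close> with \<open>mat_a\<close> moves their
  indices and gives all \<open>mat_b\<close> and \<open>mat_c\<close>.\<close>

lemma sp_generated:
  assumes X: "X \<in> sp n" and n: "1 \<le> n"
    and e: "\<And>i. 1 \<le> i \<Longrightarrow> i \<le> n \<Longrightarrow> P (chev_e n i)" and f: "\<And>i. 1 \<le> i \<Longrightarrow> i \<le> n \<Longrightarrow> P (chev_f n i)"
    and add: "\<And>X Y. X \<in> sp n \<Longrightarrow> Y \<in> sp n \<Longrightarrow> P X \<Longrightarrow> P Y \<Longrightarrow> P (X + Y)"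
    and smult: "\<And>c X. X \<in> sp n \<Longrightarrow> P X \<Longrightarrow> P (c \<cdot>\<^sub>m X)"
    and bracket: "\<And>X Y. X \<in> sp n \<Longrightarrow> Y \<in> sp n \<Longrightarrow> P X \<Longrightarrow> P Y \<Longrightarrow> P (bracket X Y)"
  shows "P X"
proof -
  define R where "R X \<longleftrightarrow> X \<in> sp n \<and> P X" for X
  have Re: "R (chev_e n i)" and Rf: "R (chev_f n i)" if "1 \<le> i" "i \<le> n" for i
    using that e f by (auto simp: R_def chev_sp)
  have Radd: "R (X + Y)" if "R X" "R Y" for X Y using that add by (auto simp: R_def sp_add)
  have Rsm: "R (c \<cdot>\<^sub>m X)" if "R X" for X c using that smult by (auto simp: R_def sp_smult)
  have Rbr: "R (bracket X Y)" if "R X" "R Y" for X Y using that bracket by (auto simp: R_def sp_bracket)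
  have R_scale: "R Y" if "R X" "X = c \<cdot>\<^sub>m Y" "c \<noteq> 0" for X Y c
  proof -
    have "Y = (1 / c) \<cdot>\<^sub>m X" unfolding that(2) by (rule eq_matI) (use that in auto)
    then show ?thesis using Rsm[OF that(1)] by simp
  qed
  have b_nn: "R (mat_b n n n)" using R_scale[OF Re[of n], of "1/2"] n by (simp add: chev_e_eq)
  have c_nn: "R (mat_c n n n)" using R_scale[OF Rf[of n], of "1/2"] n by (simp add: chev_f_eq)
  have minus_null: "A - 0 \<cdot>\<^sub>m B = A" "A + 0 \<cdot>\<^sub>m B = A" "0 \<cdot>\<^sub>m B + A = A"
    if "A \<in> carrier_mat (2*n) (2*n)" "B \<in> carrier_mat (2*n) (2*n)" for A B :: "complex mat"
    using that by (auto intro!: eq_matI)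
  have up: "R (mat_a n i j)" if "1 \<le> i" "i < j" "j \<le> n" for i j
    using that(2,3)
  proof (induction j rule: less_induct)
    case (less j)
    show ?case
    proof (cases "j = i + 1")
      case True then show ?thesis using Re[of i] less.prems that(1) by (simp add: chev_e_eq)
    next
      case False
      then have j: "R (mat_a n i (j - 1))" using less by auto
      have s: "R (mat_a n (j - 1) j)" using Re[of "j - 1"] less.prems that(1) by (simp add: chev_e_eq)
      have "bracket (mat_a n i (j - 1)) (mat_a n (j - 1) j) = mat_a n i j"
        using bracket_aa[of i n "j - 1" "j - 1" j] less.prems that(1) False by (simp add: minus_null)
      then show ?thesis using Rbr[OF j s] by simp
    qed
  qed
  have down: "R (mat_a n j i)" if "1 \<le> i" "i < j" "j \<le> n" for i j
    using that(2,3)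
  proof (induction j rule: less_induct)
    case (less j)
    show ?case
    proof (cases "j = i + 1")
      case True then show ?thesis using Rf[of i] less.prems that(1) by (simp add: chev_f_eq)
    next
      case False
      then have j: "R (mat_a n (j - 1) i)" using less by auto
      have s: "R (mat_a n j (j - 1))" using Rf[of "j - 1"] less.prems that(1) by (simp add: chev_f_eq)
      have "bracket (mat_a n j (j - 1)) (mat_a n (j - 1) i) = mat_a n j i"
        using bracket_aa[of j n "j - 1" "j - 1" i] less.prems that(1) False by (simp add: minus_null)
      then show ?thesis using Rbr[OF s j] by simp
    qed
  qed
  have a_nn: "R (mat_a n n n)"
  proof (rule R_scale[OF Rbr[OF b_nn c_nn]])
    show "bracket (mat_b n n n) (mat_c n n n) = 4 \<cdot>\<^sub>m mat_a n n n"
      using bracket_bc[of n n n n n] n by (auto intro!: eq_matI)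
  qed simp
  have a_ii: "R (mat_a n i i)" if "1 \<le> i" "i \<le> n" for i
  proof (cases "i = n")
    case False
    have "mat_a n i i = bracket (mat_a n i n) (mat_a n n i) + mat_a n n n"
      using bracket_aa[of i n n n i] that by (auto intro!: eq_matI)
    then show ?thesis using Radd[OF Rbr[OF up down] a_nn] that False by simp
  qed (simp add: a_nn)
  have a: "R (mat_a n i j)" if "1 \<le> i" "i \<le> n" "1 \<le> j" "j \<le> n" for i j
    using that up[of i j] down[of j i] a_ii[of i] by (cases i j rule: linorder_cases) auto
  have b_n: "R (mat_b n n j)" if "1 \<le> j" "j \<le> n" for j
  proof (rule R_scale[OF Rbr[OF a[of j n] b_nn]])
    show "bracket (mat_a n j n) (mat_b n n n) = 2 \<cdot>\<^sub>m mat_b n n j"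
      using bracket_ab[of j n n n n] that by (auto intro!: eq_matI simp: mat_b_sym[of n j n])
  qed (use that n in auto)
  have b: "R (mat_b n i j)" if "1 \<le> i" "i \<le> n" "1 \<le> j" "j \<le> n" for i j
  proof (cases "j = n")
    case True then show ?thesis using b_n[of i] that by (simp add: mat_b_sym[of n i n])
  next
    case False
    have "bracket (mat_a n i n) (mat_b n n j) = mat_b n i j"
      using bracket_ab[of i n n n j] that False by (simp add: minus_null)
    then show ?thesis using Rbr[OF a[of i n] b_n[of j]] that n by simp
  qed
  have c_n: "R (mat_c n n j)" if "1 \<le> j" "j \<le> n" for j
  proof (rule R_scale[OF Rbr[OF a[of n j] c_nn]])
    show "bracket (mat_a n n j) (mat_c n n n) = (-2) \<cdot>\<^sub>m mat_c n n j"
      using bracket_ac[of n n j n n] that by (auto intro!: eq_matI simp: mat_c_sym[of n j n])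
  qed (use that n in auto)
  have c: "R (mat_c n i j)" if "1 \<le> i" "i \<le> n" "1 \<le> j" "j \<le> n" for i j
  proof (cases "j = n")
    case True then show ?thesis using c_n[of i] that by (simp add: mat_c_sym[of n i n])
  next
    case False
    have "bracket (mat_a n n i) (mat_c n n j) = (-1) \<cdot>\<^sub>m mat_c n i j"
      using bracket_ac[of n n i n j] that False by (simp add: minus_null)
    then show ?thesis using R_scale[OF Rbr[OF a[of n i] c_n[of j]]] that n by simp
  qed
  have "R X"
    using X
  proof (rule sp_spanning_closed)
    have "0\<^sub>m (2 * n) (2 * n) = 0 \<cdot>\<^sub>m mat_a n n n" by (auto intro!: eq_matI)
    then show "R (0\<^sub>m (2 * n) (2 * n))" using Rsm[OF a_nn] by simp
  qed (auto intro: Radd Rsm a b c)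
  then show ?thesis by (simp add: R_def)
qed

lemma cartan_sp: "H \<in> cartan n \<Longrightarrow> H \<in> sp n"
  by (simp add: cartan_def)

lemma chev_h_cartan: "1 \<le> i \<Longrightarrow> i \<le> n \<Longrightarrow> chev_h n i \<in> cartan n"
  unfolding cartan_def using chev_sp(3)[of i n] by (auto simp: chev_h_def)

text \<open>As \<open>h\<^sub>n\<close> is the last diagonal element and the other \<open>h\<^sub>i\<close> are differences of neighbours,
  descending induction reaches all of them.\<close>

lemma cartan_spanned:
  assumes H: "H \<in> cartan n" and n: "1 \<le> n"
    and h: "\<And>i. 1 \<le> i \<Longrightarrow> i \<le> n \<Longrightarrow> P (chev_h n i)"
    and add: "\<And>X Y. P X \<Longrightarrow> P Y \<Longrightarrow> P (X + Y)" and smult: "\<And>c X. P X \<Longrightarrow> P (c \<cdot>\<^sub>m X)"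
  shows "P H"
proof -
  have a: "P (mat_a n i i)" if "1 \<le> i" "i \<le> n" for i
    using that(2,1)
  proof (induction i rule: inc_induct)
    case base then show ?case using h[of n] n by (simp add: chev_h_eq)
  next
    case (step i)
    have "mat_a n i i = chev_h n i + mat_a n (Suc i) (Suc i)"
      using step by (auto intro!: eq_matI simp: chev_h_eq)
    then show ?case using step h[of i] add by auto
  qed
  show ?thesis
    using cartan_sp[OF H]
  proof (rule sp_spanning_closed)
    have "0\<^sub>m (2 * n) (2 * n) = 0 \<cdot>\<^sub>m chev_h n n" using chev_sp(3)[of n n, THEN sp_carrier] n by (auto intro!: eq_matI)
    then show "P (0\<^sub>m (2 * n) (2 * n))" using smult[OF h[of n]] n by simp
    show "P (mat_a n (i + 1) (j + 1))" if "i < n" "j < n" "H $$ (i, j) \<noteq> 0" for i j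
      using that H a[of "i + 1"] by (cases "i = j") (auto simp: cartan_def)
    show "P (mat_b n (i + 1) (j + 1))" if "i < n" "j < n" "H $$ (i, n + j) \<noteq> 0" for i j
      using that H unfolding cartan_def by auto
    show "P (mat_c n (i + 1) (j + 1))" if "i < n" "j < n" "H $$ (n + i, j) \<noteq> 0" for i j
      using that H unfolding cartan_def by auto
  qed (auto intro: add smult)
qed

lemma bracket_diagonal_index:
  assumes H: "H \<in> cartan n" and X: "X \<in> carrier_mat (2 * n) (2 * n)" and pq: "p < 2 * n" "q < 2 * n"
  shows "bracket H X $$ (p, q) = (H $$ (p, p) - H $$ (q, q)) * X $$ (p, q)"
proof -
  have d: "H $$ (i, j) = 0" if "i < 2 * n" "j < 2 * n" "i \<noteq> j" for i j
    using H that by (auto simp: cartan_def)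
  have "(\<Sum>k<2*n. H $$ (p, k) * X $$ (k, q)) = (\<Sum>k<2*n. if k = p then H $$ (p, p) * X $$ (p, q) else 0)"
    using pq d by (intro sum.cong) auto
  moreover have "(\<Sum>k<2*n. X $$ (p, k) * H $$ (k, q)) = (\<Sum>k<2*n. if k = q then X $$ (p, q) * H $$ (q, q) else 0)"
    using pq d by (intro sum.cong) auto
  ultimately show ?thesis
    using bracket_index[OF sp_carrier[OF cartan_sp[OF H]] X pq] pq by (simp add: algebra_simps)
qed

text \<open>The scalar is the negative of the simple root \<open>\<epsilon>\<^sub>i - \<epsilon>\<^bsub>i+1\<^esub>\<close> or \<open>2 \<epsilon>\<^sub>n\<close>, with entries of
  \<open>H\<close> counted from 0.\<close>

lemma bracket_cartan_chev_f:
  assumes H: "H \<in> cartan n" and i: "1 \<le> i" "i \<le> n"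
  shows "bracket H (chev_f n i) =
    (if i < n then H $$ (i, i) - H $$ (i - 1, i - 1) else - 2 * H $$ (n - 1, n - 1)) \<cdot>\<^sub>m chev_f n i"
proof (rule eq_matI)
  have C: "chev_f n i \<in> carrier_mat (2*n) (2*n)" using i by (intro sp_carrier chev_sp)
  fix p q
  assume "p < dim_row ((if i < n then H $$ (i, i) - H $$ (i - 1, i - 1) else - 2 * H $$ (n - 1, n - 1)) \<cdot>\<^sub>m chev_f n i)"
    "q < dim_col ((if i < n then H $$ (i, i) - H $$ (i - 1, i - 1) else - 2 * H $$ (n - 1, n - 1)) \<cdot>\<^sub>m chev_f n i)"
  then have pq: "p < 2 * n" "q < 2 * n" using carrier_matD[OF C] by auto
  have opp: "H $$ (n + j, n + j) = - H $$ (j, j)" if "j < n" for j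
    using cartan_sp[OF H] that unfolding sp_iff by auto
  have "(H $$ (p, p) - H $$ (q, q)) * chev_f n i $$ (p, q) =
     (if i < n then H $$ (i, i) - H $$ (i - 1, i - 1) else - 2 * H $$ (n - 1, n - 1)) * chev_f n i $$ (p, q)"
  proof (cases "i < n")
    case True
    have "chev_f n i $$ (p, q) = 0" if "\<not> (p = i \<and> q = i - 1)" "\<not> (p = n + (i - 1) \<and> q = n + i)"
    proof -
      have "\<not> (p + 1 = i + 1 \<and> q + 1 = i)" "\<not> (p + 1 = n + i \<and> q + 1 = n + i + 1)" using that i True by auto
      then show ?thesis using True pq unfolding chev_f_def by (simp only: if_True index_minus_mat mat_unit_dim mat_unit_index if_False diff_self)
    qed
    then show ?thesis using True i opp[of i] opp[of "i - 1"] by fastforce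
  next
    case False
    then have [simp]: "i = n" using i by simp
    have "chev_f n n $$ (p, q) = 0" if "\<not> (p = n + (n - 1) \<and> q = n - 1)"
    proof -
      have "\<not> (p + 1 = 2 * n \<and> q + 1 = n)" using that i by auto
      then show ?thesis using pq unfolding chev_f_def by (simp only: less_irrefl if_False mat_unit_index)
    qed
    then show ?thesis using i opp[of "n - 1"] by fastforce
  qed
  then show "bracket H (chev_f n i) $$ (p, q) =
    ((if i < n then H $$ (i, i) - H $$ (i - 1, i - 1) else - 2 * H $$ (n - 1, n - 1)) \<cdot>\<^sub>m chev_f n i) $$ (p, q)"
    using pq C by (simp add: bracket_diagonal_index[OF H C pq])
qed (use chev_sp(2)[OF i, THEN sp_carrier] bracket_carrier[OF cartan_sp[OF H, THEN sp_carrier], of "chev_f n i"] in auto)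

lemma bracket_smult:
  assumes "X \<in> carrier_mat m m" "Y \<in> carrier_mat m m"
  shows "bracket (c \<cdot>\<^sub>m X) Y = c \<cdot>\<^sub>m bracket X Y" "bracket X (c \<cdot>\<^sub>m Y) = c \<cdot>\<^sub>m bracket X Y"
    "bracket Y X = (-1) \<cdot>\<^sub>m bracket X Y"
  using assms unfolding bracket_def
  by (auto intro!: eq_matI simp: algebra_simps)

lemma bracket_chev_e_f:
  assumes "1 \<le> i" "i \<le> n" "1 \<le> j" "j \<le> n"
  shows "bracket (chev_e n i) (chev_f n j) = (if i = j then 1 else 0) \<cdot>\<^sub>m chev_h n i"
proof -
  have null: "(0 :: complex) \<cdot>\<^sub>m A = 0\<^sub>m (2*n) (2*n)" if "A \<in> carrier_mat (2*n) (2*n)" for A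
    using that by (intro eq_matI) simp_all
  have null': "0\<^sub>m (2*n) (2*n) - 0\<^sub>m (2*n) (2*n) = (0\<^sub>m (2*n) (2*n) :: complex mat)"
    "0\<^sub>m (2*n) (2*n) + 0\<^sub>m (2*n) (2*n) = (0\<^sub>m (2*n) (2*n) :: complex mat)"
    "c \<cdot>\<^sub>m 0\<^sub>m (2*n) (2*n) = (0\<^sub>m (2*n) (2*n) :: complex mat)" for c
    by (intro eq_matI; simp)+
  have hc: "chev_h n i \<in> carrier_mat (2*n) (2*n)" using assms by (intro sp_carrier chev_sp)
  consider "i < n" "j < n" | "i < n" "j = n" | "i = n" "j < n" | "i = n" "j = n" using assms by linarith
  then show ?thesis
  proof cases
    case 1
    then have "bracket (chev_e n i) (chev_f n j) =
        (if i = j then 1 else 0) \<cdot>\<^sub>m mat_a n i j - (if i = j then 1 else 0) \<cdot>\<^sub>m mat_a n (j + 1) (i + 1)"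
      using assms bracket_aa[of i n "i + 1" "j + 1" j] by (simp add: chev_e_eq chev_f_eq)
    then show ?thesis using 1 by (cases "i = j") (simp_all add: chev_h_eq null null' hc minus_carrier_mat)
  next
    case 2
    have "bracket (mat_a n i (i + 1)) (mat_c n n n) = 0\<^sub>m (2*n) (2*n)"
      using assms 2 bracket_ac[of i n "i + 1" n n] by (simp add: null null')
    then have "bracket (chev_e n i) (chev_f n j) = 0\<^sub>m (2*n) (2*n)"
      using 2 bracket_smult(2)[of "mat_a n i (i + 1)" "2*n" "mat_c n n n" "1/2"] null'(3)[of "1/2"]
      by (simp add: chev_e_eq chev_f_eq)
    then show ?thesis using 2 null[OF hc] by simp
  next
    case 3
    have "bracket (mat_a n (j + 1) j) (mat_b n n n) = 0\<^sub>m (2*n) (2*n)"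
      using assms 3 bracket_ab[of "j + 1" n j n n] by (simp add: null null')
    then have "bracket (mat_b n n n) (mat_a n (j + 1) j) = 0\<^sub>m (2*n) (2*n)"
      using bracket_smult(3)[of "mat_a n (j + 1) j" "2*n" "mat_b n n n"] null'(3)[of "-1"] by simp
    then have "bracket (chev_e n i) (chev_f n j) = 0\<^sub>m (2*n) (2*n)"
      using 3 bracket_smult(1)[of "mat_b n n n" "2*n" "mat_a n (j + 1) j" "1/2"] null'(3)[of "1/2"]
      by (simp add: chev_e_eq chev_f_eq)
    then show ?thesis using 3 null[OF hc] by simp
  next
    case 4
    have "bracket (chev_e n n) (chev_f n n) = (1/2) \<cdot>\<^sub>m ((1/2) \<cdot>\<^sub>m bracket (mat_b n n n) (mat_c n n n))"
      by (simp add: chev_e_eq chev_f_eq bracket_smult(1)[of _ "2*n"] bracket_smult(2)[of _ "2*n"])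
    also have "bracket (mat_b n n n) (mat_c n n n) = mat_a n n n + mat_a n n n + mat_a n n n + mat_a n n n"
      using assms 4 bracket_bc[of n n n n n] by simp
    also have "(1/2) \<cdot>\<^sub>m ((1/2) \<cdot>\<^sub>m (mat_a n n n + mat_a n n n + mat_a n n n + mat_a n n n)) = mat_a n n n"
      by (rule eq_matI) simp_all
    finally show ?thesis using 4 by (simp add: chev_h_eq)
  qed
qed

lemma n_plus_sp: "X \<in> n_plus n \<Longrightarrow> X \<in> sp n"
  by (induction rule: n_plus.induct) (auto simp: chev_sp sp_add sp_smult sp_bracket)

text \<open>Half the sum of the positive coroots, the element of the Cartan subalgebra on which every simple
  root takes the value 1.\<close>

definition grading_elt :: "nat \<Rightarrow> complex mat" where
  "grading_elt n = mat (2 * n) (2 * n) (\<lambda>(p, q). if p \<noteq> q then 0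
     else if p < n then of_nat (n - p) - 1 / 2 else 1 / 2 - of_nat (2 * n - p))"

lemma grading_elt_cartan: "grading_elt n \<in> cartan n"
  unfolding cartan_def sp_iff grading_elt_def by auto

lemma bracket_grading_elt_chev_f:
  assumes "1 \<le> i" "i \<le> n"
  shows "bracket (grading_elt n) (chev_f n i) = (-1) \<cdot>\<^sub>m chev_f n i"
  unfolding bracket_cartan_chev_f[OF grading_elt_cartan assms]
proof (rule arg_cong[where f = "\<lambda>c. c \<cdot>\<^sub>m _"])
  show "(if i < n then grading_elt n $$ (i, i) - grading_elt n $$ (i - 1, i - 1)
      else - 2 * grading_elt n $$ (n - 1, n - 1)) = -1"
    using assms by (auto simp: grading_elt_def of_nat_diff)
qed

section \<open>Modules, quotients and homomorphisms\<close>

lemma complex_ring_simps [simp]: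
  "carrier complex_ring = UNIV" "x \<otimes>\<^bsub>complex_ring\<^esub> y = x * y" "\<one>\<^bsub>complex_ring\<^esub> = 1"
  "\<zero>\<^bsub>complex_ring\<^esub> = 0" "x \<oplus>\<^bsub>complex_ring\<^esub> y = x + y"
  by (simp_all add: complex_ring_def)

lemma complex_ring_cring: "cring complex_ring"
proof (rule cringI)
  show "abelian_group complex_ring"
    by (rule abelian_groupI) (auto simp: algebra_simps intro: exI[of _ "- _"] add.left_inverse)
  show "comm_monoid complex_ring"
    by (rule comm_monoidI) (auto simp: algebra_simps)
qed (auto simp: algebra_simps)

lemma complex_ring_a_inv [simp]: "\<ominus>\<^bsub>complex_ring\<^esub> x = - x"
proof -
  interpret cring complex_ring by (rule complex_ring_cring)
  show ?thesis by (rule minus_equality) auto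
qed

locale sp_rep =
  fixes n :: nat and M :: "'v sp_mod" (structure)
  assumes sp_module: "sp_module n M"
begin

sublocale module complex_ring M
  using sp_module by (simp add: sp_module_def)

lemma act_closed [simp, intro]: "X \<in> sp n \<Longrightarrow> v \<in> carrier M \<Longrightarrow> act M X v \<in> carrier M"
  and act_add: "X \<in> sp n \<Longrightarrow> v \<in> carrier M \<Longrightarrow> w \<in> carrier M \<Longrightarrow> act M X (v \<oplus> w) = act M X v \<oplus> act M X w"
  and act_smult: "X \<in> sp n \<Longrightarrow> v \<in> carrier M \<Longrightarrow> act M X (c \<odot> v) = c \<odot> act M X v"
  and act_add_mat: "X \<in> sp n \<Longrightarrow> Y \<in> sp n \<Longrightarrow> v \<in> carrier M \<Longrightarrow> act M (X + Y) v = act M X v \<oplus> act M Y v"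
  and act_smult_mat: "X \<in> sp n \<Longrightarrow> v \<in> carrier M \<Longrightarrow> act M (c \<cdot>\<^sub>m X) v = c \<odot> act M X v"
  and act_bracket: "X \<in> sp n \<Longrightarrow> Y \<in> sp n \<Longrightarrow> v \<in> carrier M \<Longrightarrow>
      act M (bracket X Y) v = act M X (act M Y v) \<ominus> act M Y (act M X v)"
  using sp_module by (simp_all add: sp_module_def)

lemma l_distr: "x \<in> carrier M \<Longrightarrow> (a + b) \<odot> x = a \<odot> x \<oplus> b \<odot> x"
  and r_distr: "x \<in> carrier M \<Longrightarrow> y \<in> carrier M \<Longrightarrow> a \<odot> (x \<oplus> y) = a \<odot> x \<oplus> a \<odot> y"
  and smult_smult: "x \<in> carrier M \<Longrightarrow> a \<odot> (b \<odot> x) = (a * b) \<odot> x"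
  and smult_1 [simp]: "x \<in> carrier M \<Longrightarrow> 1 \<odot> x = x"
  and smult_0 [simp]: "x \<in> carrier M \<Longrightarrow> 0 \<odot> x = \<zero>"
  and smult_zero [simp]: "c \<odot> \<zero> = \<zero>"
  using smult_l_distr[of a b x] smult_r_distr[of a x y] smult_assoc1[of a b x] smult_one[of x] smult_l_null[of x]
    smult_r_null[of c] by simp_all

lemma neg_eq: "x \<in> carrier M \<Longrightarrow> \<ominus> x = (-1) \<odot> x"
  using smult_l_minus[of 1 x] by simp

lemma diff_eq: "x \<in> carrier M \<Longrightarrow> y \<in> carrier M \<Longrightarrow> x \<ominus> y = x \<oplus> (-1) \<odot> y"
  by (simp add: minus_eq neg_eq)

lemma diff_eq_zero_iff: "x \<in> carrier M \<Longrightarrow> y \<in> carrier M \<Longrightarrow> x \<ominus> y = \<zero> \<longleftrightarrow> x = y"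
  by (metis a_inv_closed minus_eq minus_equality minus_minus r_neg)

lemma act_zero [simp]: "X \<in> sp n \<Longrightarrow> act M X \<zero> = \<zero>"
  using act_smult[of X \<zero> 0] by simp

lemma act_swap:
  assumes "X \<in> sp n" "Y \<in> sp n" "v \<in> carrier M"
  shows "act M X (act M Y v) = act M Y (act M X v) \<oplus> act M (bracket X Y) v"
  using assms by (simp add: act_bracket minus_eq a_assoc a_comm l_neg r_neg a_lcomm[of "act M Y (act M X v)"] r_neg2)

lemma sp_submoduleI:
  assumes "N \<subseteq> carrier M" "\<zero> \<in> N" "\<And>x y. x \<in> N \<Longrightarrow> y \<in> N \<Longrightarrow> x \<oplus> y \<in> N"
    "\<And>c x. x \<in> N \<Longrightarrow> c \<odot> x \<in> N" "\<And>X x. X \<in> sp n \<Longrightarrow> x \<in> N \<Longrightarrow> act M X x \<in> N"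
  shows "sp_submodule n M N"
proof -
  have "submodule N complex_ring M"
    by (rule submoduleI) (use assms neg_eq in \<open>auto simp: subset_iff\<close>)
  then show ?thesis using assms by (simp add: sp_submodule_def)
qed

lemma sp_submodule_facts:
  assumes "sp_submodule n M N"
  shows "N \<subseteq> carrier M" "\<zero> \<in> N" "\<And>x y. x \<in> N \<Longrightarrow> y \<in> N \<Longrightarrow> x \<oplus> y \<in> N"
    "\<And>c x. x \<in> N \<Longrightarrow> c \<odot> x \<in> N" "\<And>X x. X \<in> sp n \<Longrightarrow> x \<in> N \<Longrightarrow> act M X x \<in> N"
    "additive_subgroup N M"
proof -
  have s: "submodule N complex_ring M" using assms by (simp add: sp_submodule_def)
  then show sub: "N \<subseteq> carrier M" "\<And>x y. x \<in> N \<Longrightarrow> y \<in> N \<Longrightarrow> x \<oplus> y \<in> N"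
    "\<And>c x. x \<in> N \<Longrightarrow> c \<odot> x \<in> N"
    using submoduleE[OF s] by auto
  show "additive_subgroup N M" using s by (intro additive_subgroupI) (auto simp: submodule_def)
  then show "\<zero> \<in> N" by (rule additive_subgroup.zero_closed)
  show "\<And>X x. X \<in> sp n \<Longrightarrow> x \<in> N \<Longrightarrow> act M X x \<in> N" using assms by (simp add: sp_submodule_def)
qed

lemma carrier_sp_submodule: "sp_submodule n M (carrier M)"
  by (rule sp_submoduleI) auto

end

text \<open>The axioms only speak about representatives, so a structure whose elements are given
  by surjective labels, compatibly with all operations, inherits them.\<close>

lemma sp_module_image:
  fixes M :: "'v sp_mod" and Q :: "'w sp_mod"
  assumes M: "sp_module n M" and carr: "carrier Q = \<pi> ` carrier M" and zero: "\<zero>\<^bsub>Q\<^esub> = \<pi> \<zero>\<^bsub>M\<^esub>"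
    and add: "\<And>v w. v \<in> carrier M \<Longrightarrow> w \<in> carrier M \<Longrightarrow> \<pi> v \<oplus>\<^bsub>Q\<^esub> \<pi> w = \<pi> (v \<oplus>\<^bsub>M\<^esub> w)"
    and smult: "\<And>c v. v \<in> carrier M \<Longrightarrow> c \<odot>\<^bsub>Q\<^esub> \<pi> v = \<pi> (c \<odot>\<^bsub>M\<^esub> v)"
    and act: "\<And>X v. X \<in> sp n \<Longrightarrow> v \<in> carrier M \<Longrightarrow> act Q X (\<pi> v) = \<pi> (act M X v)"
  shows "sp_module n Q"
proof -
  interpret M: sp_rep n M by (rule sp_rep.intro[OF M])
  have ag: "abelian_group Q"
  proof (rule abelian_groupI)
    show "\<exists>y\<in>carrier Q. y \<oplus>\<^bsub>Q\<^esub> x = \<zero>\<^bsub>Q\<^esub>" if "x \<in> carrier Q" for x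
      using that add[OF M.a_inv_closed] by (force simp: carr zero M.l_neg)
  qed (auto simp: carr zero add M.a_ac)
  have mod: "module complex_ring Q"
    by (rule moduleI[OF complex_ring_cring ag])
      (auto simp: carr add smult M.l_distr M.r_distr M.smult_smult)
  interpret Q: module complex_ring Q by (rule mod)
  have inv: "\<ominus>\<^bsub>Q\<^esub> \<pi> v = \<pi> (\<ominus>\<^bsub>M\<^esub> v)" if "v \<in> carrier M" for v
    by (rule Q.minus_equality) (use that in \<open>auto simp: carr add zero M.l_neg\<close>)
  show ?thesis unfolding sp_module_def
    using mod by (auto simp: carr add smult act inv M.act_add M.act_smult M.act_add_mat M.act_smult_mat
        M.act_bracket a_minus_def sp_add sp_smult sp_bracket)
qed

definition sp_hom :: "nat \<Rightarrow> 'v sp_mod \<Rightarrow> 'w sp_mod \<Rightarrow> ('v \<Rightarrow> 'w) \<Rightarrow> bool" where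
  "sp_hom n M M' \<phi> \<longleftrightarrow> (\<forall>v \<in> carrier M. \<phi> v \<in> carrier M') \<and>
     (\<forall>v \<in> carrier M. \<forall>w \<in> carrier M. \<phi> (v \<oplus>\<^bsub>M\<^esub> w) = \<phi> v \<oplus>\<^bsub>M'\<^esub> \<phi> w) \<and>
     (\<forall>c. \<forall>v \<in> carrier M. \<phi> (c \<odot>\<^bsub>M\<^esub> v) = c \<odot>\<^bsub>M'\<^esub> \<phi> v) \<and>
     (\<forall>X \<in> sp n. \<forall>v \<in> carrier M. \<phi> (act M X v) = act M' X (\<phi> v))"

lemma sp_homD:
  assumes "sp_hom n M M' \<phi>"
  shows "\<And>v. v \<in> carrier M \<Longrightarrow> \<phi> v \<in> carrier M'"
    "\<And>v w. v \<in> carrier M \<Longrightarrow> w \<in> carrier M \<Longrightarrow> \<phi> (v \<oplus>\<^bsub>M\<^esub> w) = \<phi> v \<oplus>\<^bsub>M'\<^esub> \<phi> w"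
    "\<And>c v. v \<in> carrier M \<Longrightarrow> \<phi> (c \<odot>\<^bsub>M\<^esub> v) = c \<odot>\<^bsub>M'\<^esub> \<phi> v"
    "\<And>X v. X \<in> sp n \<Longrightarrow> v \<in> carrier M \<Longrightarrow> \<phi> (act M X v) = act M' X (\<phi> v)"
  using assms by (simp_all add: sp_hom_def)

lemma sp_hom_zero:
  assumes "sp_module n M" "sp_module n M'" "sp_hom n M M' \<phi>"
  shows "\<phi> \<zero>\<^bsub>M\<^esub> = \<zero>\<^bsub>M'\<^esub>"
proof -
  interpret M: sp_rep n M by (rule sp_rep.intro) fact
  interpret M': sp_rep n M' by (rule sp_rep.intro) fact
  show ?thesis using sp_homD(1)[OF assms(3), of "\<zero>\<^bsub>M\<^esub>"] sp_homD(3)[OF assms(3), of "\<zero>\<^bsub>M\<^esub>" 0] by simp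
qed

lemma sp_submodule_vimage:
  assumes "sp_module n M" "sp_module n M'" "sp_hom n M M' \<phi>" "sp_submodule n M' N"
  shows "sp_submodule n M {v \<in> carrier M. \<phi> v \<in> N}"
proof -
  interpret M: sp_rep n M by (rule sp_rep.intro) fact
  interpret M': sp_rep n M' by (rule sp_rep.intro) fact
  show ?thesis
    by (rule M.sp_submoduleI)
      (auto simp: sp_homD[OF assms(3)] sp_hom_zero[OF assms(1-3)] M'.sp_submodule_facts[OF assms(4)])
qed

lemma sp_submodule_image:
  assumes "sp_module n M" "sp_module n M'" "sp_hom n M M' \<phi>" "sp_submodule n M N"
  shows "sp_submodule n M' (\<phi> ` N)"
proof -
  interpret M: sp_rep n M by (rule sp_rep.intro) fact
  interpret M': sp_rep n M' by (rule sp_rep.intro) fact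
  note N = M.sp_submodule_facts[OF assms(4)]
  note h = sp_homD[OF assms(3)]
  have N': "x \<in> carrier M" if "x \<in> N" for x using that N by auto
  show ?thesis
  proof (rule M'.sp_submoduleI)
    show "\<phi> ` N \<subseteq> carrier M'" using N' h by auto
    show "\<zero>\<^bsub>M'\<^esub> \<in> \<phi> ` N" using sp_hom_zero[OF assms(1-3)] N by (metis imageI)
    show "x \<oplus>\<^bsub>M'\<^esub> y \<in> \<phi> ` N" if xy: "x \<in> \<phi> ` N" "y \<in> \<phi> ` N" for x y
    proof -
      obtain a b where "x = \<phi> a" "y = \<phi> b" "a \<in> N" "b \<in> N" using xy by auto
      then have "x \<oplus>\<^bsub>M'\<^esub> y = \<phi> (a \<oplus>\<^bsub>M\<^esub> b)" "a \<oplus>\<^bsub>M\<^esub> b \<in> N" using h N' N by auto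
      then show ?thesis by simp
    qed
    show "c \<odot>\<^bsub>M'\<^esub> x \<in> \<phi> ` N" if x: "x \<in> \<phi> ` N" for c x
    proof -
      obtain a where a: "x = \<phi> a" "a \<in> N" using x by auto
      then have "c \<odot>\<^bsub>M'\<^esub> x = \<phi> (c \<odot>\<^bsub>M\<^esub> a)" using h(3) N' by simp
      then show ?thesis using N(4)[OF a(2)] by simp
    qed
    show "act M' X x \<in> \<phi> ` N" if X: "X \<in> sp n" "x \<in> \<phi> ` N" for X x
    proof -
      obtain a where a: "x = \<phi> a" "a \<in> N" using X by auto
      then have "act M' X x = \<phi> (act M X a)" using h(4) N' X by simp
      then show ?thesis using N(5)[OF X(1) a(2)] by simp
    qed
  qed
qed

lemma sp_submodule_zero: "sp_module n M \<Longrightarrow> sp_submodule n M {\<zero>\<^bsub>M\<^esub>}"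
proof -
  assume "sp_module n M"
  then interpret M: sp_rep n M by (rule sp_rep.intro)
  show ?thesis by (rule M.sp_submoduleI) auto
qed

context sp_rep
begin

context
  fixes N assumes N: "sp_submodule n M N"
begin

lemma abelian_subgroup_N: "abelian_subgroup N M"
  using sp_submodule_facts(6)[OF N] abelian_group_axioms
  by (intro abelian_subgroupI3) (auto simp: additive_subgroup_def)

interpretation N: abelian_subgroup N M by (rule abelian_subgroup_N)

lemma coset_eq_iff:
  assumes "v \<in> carrier M" "w \<in> carrier M"
  shows "N +> v = N +> w \<longleftrightarrow> v \<ominus> w \<in> N"
  using assms N.a_rcos_module[of w v] N.a_repr_independence'[of v w] N.a_repr_independenceD[of v w]
  by (metis minus_eq)

lemma coset_mem_iff:
  assumes "v \<in> carrier M"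
  shows "w \<in> N +> v \<longleftrightarrow> w \<in> carrier M \<and> N +> w = N +> v"
  using assms N.a_elemrcos_carrier N.a_repr_independence' N.a_rcos_self by metis

lemma quot_simps:
  "carrier (sp_quot M N) = (\<lambda>v. N +> v) ` carrier M"
  "\<zero>\<^bsub>sp_quot M N\<^esub> = N +> \<zero>"
  "\<And>v w. v \<in> carrier M \<Longrightarrow> w \<in> carrier M \<Longrightarrow> (N +> v) \<oplus>\<^bsub>sp_quot M N\<^esub> (N +> w) = N +> (v \<oplus> w)"
  "\<And>c v. v \<in> carrier M \<Longrightarrow> c \<odot>\<^bsub>sp_quot M N\<^esub> (N +> v) = N +> (c \<odot> v)"
  "\<And>X v. X \<in> sp n \<Longrightarrow> v \<in> carrier M \<Longrightarrow> act (sp_quot M N) X (N +> v) = N +> act M X v"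
proof -
  show "carrier (sp_quot M N) = (\<lambda>v. N +> v) ` carrier M"
    by (auto simp: sp_quot_def A_RCOSETS_def' a_r_coset_def')
  show "\<zero>\<^bsub>sp_quot M N\<^esub> = N +> \<zero>"
    using sp_submodule_facts(1)[OF N] by (simp add: sp_quot_def)
  show "(N +> v) \<oplus>\<^bsub>sp_quot M N\<^esub> (N +> w) = N +> (v \<oplus> w)" if "v \<in> carrier M" "w \<in> carrier M" for v w
    using N.a_rcos_sum[OF that] by (simp add: sp_quot_def)
  have eq: "(\<Union>w \<in> N +> v. N +> f w) = N +> f v"
    if v: "v \<in> carrier M" and f: "\<And>w. w \<in> carrier M \<Longrightarrow> w \<ominus> v \<in> N \<Longrightarrow> N +> f w = N +> f v" for v f
  proof -
    have "N +> f w = N +> f v" if "w \<in> N +> v" for w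
      using that f v by (auto simp: coset_mem_iff coset_eq_iff)
    moreover have "v \<in> N +> v" using v by (rule N.a_rcos_self)
    ultimately show ?thesis by blast
  qed
  show "c \<odot>\<^bsub>sp_quot M N\<^esub> (N +> v) = N +> (c \<odot> v)" if v: "v \<in> carrier M" for c v
  proof -
    have "(\<Union>w \<in> N +> v. N +> (c \<odot> w)) = N +> (c \<odot> v)"
    proof (rule eq[OF v])
      fix w assume w: "w \<in> carrier M" "w \<ominus> v \<in> N"
      have "c \<odot> w \<ominus> c \<odot> v = c \<odot> (w \<ominus> v)" using w v by (simp add: diff_eq r_distr smult_smult)
      then show "N +> (c \<odot> w) = N +> (c \<odot> v)"
        using w v sp_submodule_facts(4)[OF N w(2)] by (simp add: coset_eq_iff)
    qed
    then show ?thesis by (simp add: sp_quot_def)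
  qed
  show "act (sp_quot M N) X (N +> v) = N +> act M X v" if X: "X \<in> sp n" and v: "v \<in> carrier M" for X v
  proof -
    have "(\<Union>w \<in> N +> v. N +> act M X w) = N +> act M X v"
    proof (rule eq[OF v])
      fix w assume w: "w \<in> carrier M" "w \<ominus> v \<in> N"
      have "act M X w \<ominus> act M X v = act M X (w \<ominus> v)" using w v X by (simp add: diff_eq act_add act_smult)
      then show "N +> act M X w = N +> act M X v"
        using w v sp_submodule_facts(5)[OF N X w(2)] X by (simp add: coset_eq_iff)
    qed
    then show ?thesis by (simp add: sp_quot_def)
  qed
qed

lemma sp_module_quot: "sp_module n (sp_quot M N)"
  by (rule sp_module_image[OF sp_module, where \<pi> = "\<lambda>v. N +> v"]) (auto simp: quot_simps)

lemma sp_hom_quot: "sp_hom n M (sp_quot M N) (\<lambda>v. N +> v)"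
  by (auto simp: sp_hom_def quot_simps)

lemma coset_zero_iff: "v \<in> carrier M \<Longrightarrow> N +> v = \<zero>\<^bsub>sp_quot M N\<^esub> \<longleftrightarrow> v \<in> N"
  by (simp add: quot_simps coset_eq_iff diff_eq)

end

end

text \<open>All representatives of a coset have the same image, so an arbitrary choice defines the
  induced homomorphism.\<close>

lemma sp_hom_factor:
  assumes M: "sp_module n M" and M': "sp_module n M'" and \<phi>: "sp_hom n M M' \<phi>" and N: "sp_submodule n M N"
    and kill: "\<And>v. v \<in> N \<Longrightarrow> \<phi> v = \<zero>\<^bsub>M'\<^esub>"
  obtains \<psi> where "sp_hom n (sp_quot M N) M' \<psi>" "\<And>v. v \<in> carrier M \<Longrightarrow> \<psi> (N +>\<^bsub>M\<^esub> v) = \<phi> v"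
proof -
  interpret M: sp_rep n M by (rule sp_rep.intro) fact
  interpret M': sp_rep n M' by (rule sp_rep.intro) fact
  note h = sp_homD[OF \<phi>]
  define \<psi> where "\<psi> A = \<phi> (SOME v. v \<in> A)" for A
  have \<psi>: "\<psi> (N +>\<^bsub>M\<^esub> v) = \<phi> v" if v: "v \<in> carrier M" for v
  proof -
    have "v \<in> N +>\<^bsub>M\<^esub> v" using M.coset_mem_iff[OF N v, of v] v by simp
    then have "(SOME w. w \<in> N +>\<^bsub>M\<^esub> v) \<in> N +>\<^bsub>M\<^esub> v" by (rule someI[of "\<lambda>w. w \<in> N +>\<^bsub>M\<^esub> v"])
    moreover define w where "w = (SOME w. w \<in> N +>\<^bsub>M\<^esub> v)"
    ultimately have w: "w \<in> carrier M" "w \<ominus>\<^bsub>M\<^esub> v \<in> N"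
      using M.coset_mem_iff[OF N v, of w] M.coset_eq_iff[OF N _ v, of w] by auto
    have "w = v \<oplus>\<^bsub>M\<^esub> (w \<ominus>\<^bsub>M\<^esub> v)"
      using w v by (simp add: M.minus_eq M.a_lcomm[of v w] M.r_neg)
    then have "\<phi> w = \<phi> v \<oplus>\<^bsub>M'\<^esub> \<phi> (w \<ominus>\<^bsub>M\<^esub> v)" using h(2)[of v "w \<ominus>\<^bsub>M\<^esub> v"] w v by simp
    then show ?thesis using kill[OF w(2)] h(1)[OF v] by (simp add: \<psi>_def w_def[symmetric])
  qed
  have "sp_hom n (sp_quot M N) M' \<psi>"
    by (auto simp: sp_hom_def M.quot_simps[OF N] \<psi> h)
  then show ?thesis using \<psi> that by blast
qed

lemma sp_iso_quot_kernel:
  assumes M: "sp_module n M" and M': "sp_module n M'" and \<phi>: "sp_hom n M M' \<phi>"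
    and surj: "\<phi> ` carrier M = carrier M'"
  defines "N \<equiv> {v \<in> carrier M. \<phi> v = \<zero>\<^bsub>M'\<^esub>}"
  shows "sp_submodule n M N" "sp_iso n M' (sp_quot M N)"
proof -
  interpret M: sp_rep n M by (rule sp_rep.intro) fact
  interpret M': sp_rep n M' by (rule sp_rep.intro) fact
  note h = sp_homD[OF \<phi>]
  show N: "sp_submodule n M N"
    using sp_submodule_vimage[OF M M' \<phi> sp_submodule_zero[OF M']] by (simp add: N_def)
  define g where "g m = N +>\<^bsub>M\<^esub> (SOME v. v \<in> carrier M \<and> \<phi> v = m)" for m
  have eq: "N +>\<^bsub>M\<^esub> v = N +>\<^bsub>M\<^esub> w \<longleftrightarrow> \<phi> v = \<phi> w" if "v \<in> carrier M" "w \<in> carrier M" for v w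
  proof -
    have "N +>\<^bsub>M\<^esub> v = N +>\<^bsub>M\<^esub> w \<longleftrightarrow> \<phi> v \<oplus>\<^bsub>M'\<^esub> (-1) \<odot>\<^bsub>M'\<^esub> \<phi> w = \<zero>\<^bsub>M'\<^esub>"
      using that M.coset_eq_iff[OF N that] by (simp add: N_def M.diff_eq h)
    also have "\<dots> \<longleftrightarrow> \<phi> v \<ominus>\<^bsub>M'\<^esub> \<phi> w = \<zero>\<^bsub>M'\<^esub>" using that h by (simp add: M'.diff_eq)
    also have "\<dots> \<longleftrightarrow> \<phi> v = \<phi> w" using that h(1) by (simp add: M'.diff_eq_zero_iff)
    finally show ?thesis .
  qed
  have g: "g (\<phi> v) = N +>\<^bsub>M\<^esub> v" if "v \<in> carrier M" for v
  proof -
    have "(SOME w. w \<in> carrier M \<and> \<phi> w = \<phi> v) \<in> carrier M \<and> \<phi> (SOME w. w \<in> carrier M \<and> \<phi> w = \<phi> v) = \<phi> v"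
      by (rule someI[of _ v]) (use that in auto)
    then show ?thesis using eq that by (simp add: g_def)
  qed
  have c: "carrier M' = \<phi> ` carrier M" using surj by simp
  have g1: "bij_betw g (carrier M') (carrier (sp_quot M N))"
  proof (rule bij_betw_imageI)
    show "inj_on g (carrier M')"
    proof (rule inj_onI)
      fix x y assume xy: "x \<in> carrier M'" "y \<in> carrier M'" "g x = g y"
      obtain v w where "x = \<phi> v" "y = \<phi> w" "v \<in> carrier M" "w \<in> carrier M" using xy(1,2) unfolding c by blast
      then show "x = y" using xy(3) g eq by simp
    qed
    have "g ` carrier M' = (\<lambda>v. g (\<phi> v)) ` carrier M" unfolding c by (rule image_image)
    also have "\<dots> = (\<lambda>v. N +>\<^bsub>M\<^esub> v) ` carrier M" by (rule image_cong[OF refl g])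
    finally show "g ` carrier M' = carrier (sp_quot M N)" unfolding M.quot_simps(1)[OF N] .
  qed
  have g2: "g (x \<oplus>\<^bsub>M'\<^esub> y) = g x \<oplus>\<^bsub>sp_quot M N\<^esub> g y" if xy: "x \<in> carrier M'" "y \<in> carrier M'" for x y
  proof -
    obtain v w where vw: "x = \<phi> v" "y = \<phi> w" "v \<in> carrier M" "w \<in> carrier M" using xy unfolding c by blast
    then have "x \<oplus>\<^bsub>M'\<^esub> y = \<phi> (v \<oplus>\<^bsub>M\<^esub> w)" using h(2) by simp
    then show ?thesis using vw g M.quot_simps(3)[OF N] by simp
  qed
  have g3: "g (k \<odot>\<^bsub>M'\<^esub> x) = k \<odot>\<^bsub>sp_quot M N\<^esub> g x" if x: "x \<in> carrier M'" for k x
  proof -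
    obtain v where v: "x = \<phi> v" "v \<in> carrier M" using x unfolding c by blast
    then have "k \<odot>\<^bsub>M'\<^esub> x = \<phi> (k \<odot>\<^bsub>M\<^esub> v)" using h(3) by simp
    then show ?thesis using v g M.quot_simps(4)[OF N] by simp
  qed
  have g4: "g (act M' X x) = act (sp_quot M N) X (g x)" if X: "X \<in> sp n" "x \<in> carrier M'" for X x
  proof -
    obtain v where v: "x = \<phi> v" "v \<in> carrier M" using X unfolding c by blast
    then have "act M' X x = \<phi> (act M X v)" using h(4) X by simp
    then show ?thesis using v g M.quot_simps(5)[OF N] X by simp
  qed
  show "sp_iso n M' (sp_quot M N)"
    unfolding sp_iso_def
    by (intro conjI exI[of _ g] ballI allI M' M.sp_module_quot[OF N] g1 g2 g3 g4)
qed

lemma sp_irreducibleD: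
  assumes "sp_irreducible n M"
  shows "sp_module n M" "carrier M \<noteq> {\<zero>\<^bsub>M\<^esub>}"
    "\<And>N. sp_submodule n M N \<Longrightarrow> N = {\<zero>\<^bsub>M\<^esub>} \<or> N = carrier M"
  using assms by (simp_all add: sp_irreducible_def)

lemma sp_iso_irreducible:
  assumes iso: "sp_iso n M M'" and irr: "sp_irreducible n M"
  shows "sp_irreducible n M'"
proof -
  have M: "sp_module n M" and M': "sp_module n M'" using iso by (auto simp: sp_iso_def)
  obtain \<phi> where bij: "bij_betw \<phi> (carrier M) (carrier M')" and \<phi>: "sp_hom n M M' \<phi>"
  proof -
    obtain \<phi> where \<phi>: "bij_betw \<phi> (carrier M) (carrier M')"
      "\<forall>v \<in> carrier M. \<forall>w \<in> carrier M. \<phi> (v \<oplus>\<^bsub>M\<^esub> w) = \<phi> v \<oplus>\<^bsub>M'\<^esub> \<phi> w"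
      "\<forall>c. \<forall>v \<in> carrier M. \<phi> (c \<odot>\<^bsub>M\<^esub> v) = c \<odot>\<^bsub>M'\<^esub> \<phi> v"
      "\<forall>X \<in> sp n. \<forall>v \<in> carrier M. \<phi> (act M X v) = act M' X (\<phi> v)"
      using iso unfolding sp_iso_def by (elim conjE exE)
    have "sp_hom n M M' \<phi>"
      unfolding sp_hom_def using bij_betwE[OF \<phi>(1)] by (intro conjI \<phi>)
    then show ?thesis using \<phi>(1) that by simp
  qed
  have z: "\<phi> \<zero>\<^bsub>M\<^esub> = \<zero>\<^bsub>M'\<^esub>" by (rule sp_hom_zero[OF M M' \<phi>])
  interpret M: sp_rep n M by (rule sp_rep.intro) fact
  interpret M': sp_rep n M' by (rule sp_rep.intro) fact
  have im: "\<phi> ` carrier M = carrier M'" and inj: "inj_on \<phi> (carrier M)" using bij by (auto simp: bij_betw_def)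
  have "carrier M' \<noteq> {\<zero>\<^bsub>M'\<^esub>}"
  proof
    assume *: "carrier M' = {\<zero>\<^bsub>M'\<^esub>}"
    have "v = \<zero>\<^bsub>M\<^esub>" if v: "v \<in> carrier M" for v
    proof (rule inj_onD[OF inj _ v M.zero_closed])
      have "\<phi> v \<in> carrier M'" using v im by blast
      then show "\<phi> v = \<phi> \<zero>\<^bsub>M\<^esub>" unfolding * z by simp
    qed
    then show False using sp_irreducibleD(2)[OF irr] M.zero_closed by blast
  qed
  moreover have "N = {\<zero>\<^bsub>M'\<^esub>} \<or> N = carrier M'" if N: "sp_submodule n M' N" for N
  proof -
    let ?P = "{v \<in> carrier M. \<phi> v \<in> N}"
    have N_im: "N = \<phi> ` ?P"
    proof (intro equalityI subsetI)
      fix x assume x: "x \<in> N"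
      then have "x \<in> \<phi> ` carrier M" using M'.sp_submodule_facts(1)[OF N] im by auto
      then show "x \<in> \<phi> ` ?P" using x by auto
    qed auto
    have "?P = {\<zero>\<^bsub>M\<^esub>} \<or> ?P = carrier M"
      by (rule sp_irreducibleD(3)[OF irr sp_submodule_vimage[OF M M' \<phi> N]])
    then show ?thesis
    proof
      assume P: "?P = {\<zero>\<^bsub>M\<^esub>}"
      show ?thesis using N_im unfolding P by (simp add: z)
    next
      assume P: "?P = carrier M"
      show ?thesis using N_im unfolding P im by simp
    qed
  qed
  ultimately show ?thesis using M' unfolding sp_irreducible_def by (intro conjI allI impI) auto
qed

text \<open>Submodules with irreducible quotient are maximal: a larger submodule has as image a
  submodule of the quotient.\<close>

lemma irreducible_quot_maximal:
  assumes M: "sp_module n M" and N: "sp_submodule n M N" and irr: "sp_irreducible n (sp_quot M N)"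
  shows "N \<noteq> carrier M" "\<And>N'. sp_submodule n M N' \<Longrightarrow> N \<subseteq> N' \<Longrightarrow> N' = N \<or> N' = carrier M"
proof -
  interpret M: sp_rep n M by (rule sp_rep.intro) fact
  show "N \<noteq> carrier M"
  proof
    assume "N = carrier M"
    then have "N +>\<^bsub>M\<^esub> v = \<zero>\<^bsub>sp_quot M N\<^esub>" if "v \<in> carrier M" for v
      using M.coset_zero_iff[OF N that] that by simp
    then have "carrier (sp_quot M N) = (\<lambda>v. \<zero>\<^bsub>sp_quot M N\<^esub>) ` carrier M"
      unfolding M.quot_simps(1)[OF N] by (rule image_cong[OF refl])
    also have "\<dots> = {\<zero>\<^bsub>sp_quot M N\<^esub>}" using M.zero_closed by blast
    finally show False using irr by (simp add: sp_irreducible_def)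
  qed
  fix N' assume N': "sp_submodule n M N'" and sub: "N \<subseteq> N'"
  note c' = M.sp_submodule_facts[OF N']
  have "sp_submodule n (sp_quot M N) ((\<lambda>v. N +>\<^bsub>M\<^esub> v) ` N')"
    by (rule sp_submodule_image[OF M M.sp_module_quot[OF N] M.sp_hom_quot[OF N] N'])
  then consider "(\<lambda>v. N +>\<^bsub>M\<^esub> v) ` N' = {\<zero>\<^bsub>sp_quot M N\<^esub>}" | "(\<lambda>v. N +>\<^bsub>M\<^esub> v) ` N' = carrier (sp_quot M N)"
    using sp_irreducibleD(3)[OF irr] by blast
  then show "N' = N \<or> N' = carrier M"
  proof cases
    case 1
    have "v \<in> N" if "v \<in> N'" for v
      using 1 that c'(1) M.coset_zero_iff[OF N, of v] by blast
    then show ?thesis using sub by blast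
  next
    case 2
    have "v \<in> N'" if v: "v \<in> carrier M" for v
    proof -
      have "N +>\<^bsub>M\<^esub> v \<in> (\<lambda>v. N +>\<^bsub>M\<^esub> v) ` N'" using 2 v M.quot_simps(1)[OF N] by blast
      then obtain w where w: "w \<in> N'" "N +>\<^bsub>M\<^esub> v = N +>\<^bsub>M\<^esub> w" by blast
      have wc: "w \<in> carrier M" using w c' by auto
      then have "v \<ominus>\<^bsub>M\<^esub> w \<in> N'" using w v M.coset_eq_iff[OF N v wc] sub by auto
      then have "w \<oplus>\<^bsub>M\<^esub> (v \<ominus>\<^bsub>M\<^esub> w) \<in> N'" using w c'(3) by blast
      then show ?thesis using v wc by (simp add: M.minus_eq M.a_lcomm[of w v] M.r_neg)
    qed
    then show ?thesis using c'(1) by blast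
  qed
qed

section \<open>The free algebra and the enveloping algebra\<close>

lemma free_alg_simps:
  "carrier (free_alg n) = {a. finite {w. a w \<noteq> 0} \<and> (\<forall>w. a w \<noteq> 0 \<longrightarrow> set w \<subseteq> sp n)}"
  "a \<otimes>\<^bsub>free_alg n\<^esub> b = (\<lambda>w. \<Sum>k \<le> length w. a (take k w) * b (drop k w))"
  "\<one>\<^bsub>free_alg n\<^esub> = scalar 1"
  "\<zero>\<^bsub>free_alg n\<^esub> = (\<lambda>w. 0)"
  "a \<oplus>\<^bsub>free_alg n\<^esub> b = (\<lambda>w. a w + b w)"
  by (simp_all add: free_alg_def scalar_def)

lemma letter_mult:
  "letter X \<otimes>\<^bsub>free_alg n\<^esub> b = (\<lambda>w. case w of [] \<Rightarrow> 0 | y # ys \<Rightarrow> if y = X then b ys else 0)"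
proof
  fix w
  show "(letter X \<otimes>\<^bsub>free_alg n\<^esub> b) w = (case w of [] \<Rightarrow> 0 | y # ys \<Rightarrow> if y = X then b ys else 0)"
  proof (cases w)
    case (Cons y ys)
    have "(\<Sum>k \<le> length w. letter X (take k w) * b (drop k w)) =
        (\<Sum>k \<le> length w. if k = 1 then (if y = X then b ys else 0) else 0)"
    proof (rule sum.cong[OF refl])
      fix k assume "k \<in> {..length w}"
      then consider "k = 0" | "k = 1" | j where "k = Suc (Suc j)" "Suc j \<le> length ys"
        using Cons by (cases k rule: nat.exhaust; cases "k - 1") auto
      then show "letter X (take k w) * b (drop k w) = (if k = 1 then (if y = X then b ys else 0) else 0)"
      proof cases
        case 3
        then have "take (Suc j) ys \<noteq> []" by auto
        then show ?thesis using 3 Cons by (simp add: letter_def)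
      qed (simp_all add: letter_def Cons)
    qed
    also have "\<dots> = (if y = X then b ys else 0)" using Cons by (subst sum.delta) auto
    finally show ?thesis using Cons by (simp add: free_alg_simps del: sum.atMost_Suc)
  qed (simp add: free_alg_simps letter_def)
qed

lemma scalar_mult: "scalar c \<otimes>\<^bsub>free_alg n\<^esub> b = (\<lambda>w. c * b w)"
proof
  fix w
  have "(\<Sum>k \<le> length w. scalar c (take k w) * b (drop k w)) = (\<Sum>k \<le> length w. if k = 0 then c * b w else 0)"
    by (rule sum.cong) (auto simp: scalar_def)
  then show "(scalar c \<otimes>\<^bsub>free_alg n\<^esub> b) w = c * b w" by (simp add: free_alg_simps)
qed

lemma mult_scalar: "b \<otimes>\<^bsub>free_alg n\<^esub> scalar c = (\<lambda>w. b w * c)"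
proof
  fix w
  have "(\<Sum>k \<le> length w. b (take k w) * scalar c (drop k w)) = (\<Sum>k \<le> length w. if k = length w then b w * c else 0)"
    by (rule sum.cong) (auto simp: scalar_def)
  then show "(b \<otimes>\<^bsub>free_alg n\<^esub> scalar c) w = b w * c" by (simp add: free_alg_simps)
qed

lemma free_alg_support: "a \<in> carrier (free_alg n) \<Longrightarrow> a w \<noteq> 0 \<Longrightarrow> set w \<subseteq> sp n"
  by (simp add: free_alg_simps(1))

lemma free_alg_mult_closed:
  assumes a: "a \<in> carrier (free_alg n)" and b: "b \<in> carrier (free_alg n)"
  shows "a \<otimes>\<^bsub>free_alg n\<^esub> b \<in> carrier (free_alg n)"
proof -
  let ?A = "{w. a w \<noteq> 0}" and ?B = "{w. b w \<noteq> 0}"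
  have ex: "\<exists>x\<in>?A. \<exists>y\<in>?B. w = x @ y" if nz: "(a \<otimes>\<^bsub>free_alg n\<^esub> b) w \<noteq> 0" for w
  proof -
    obtain k where "a (take k w) * b (drop k w) \<noteq> 0"
      using nz unfolding free_alg_simps by (elim sum.not_neutral_contains_not_neutral)
    then have "a (take k w) \<noteq> 0" "b (drop k w) \<noteq> 0" by auto
    then show ?thesis by (intro bexI[of _ "take k w"] bexI[of _ "drop k w"]) simp_all
  qed
  have "{w. (a \<otimes>\<^bsub>free_alg n\<^esub> b) w \<noteq> 0} \<subseteq> (\<lambda>(x, y). x @ y) ` (?A \<times> ?B)"
  proof
    fix w assume "w \<in> {w. (a \<otimes>\<^bsub>free_alg n\<^esub> b) w \<noteq> 0}"
    then obtain x y where "x \<in> ?A" "y \<in> ?B" "w = x @ y" using ex by blast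
    then show "w \<in> (\<lambda>(x, y). x @ y) ` (?A \<times> ?B)"
      by (intro image_eqI[of _ _ "(x, y)"] SigmaI) simp_all
  qed
  moreover have "finite (?A \<times> ?B)" using a b by (simp add: free_alg_simps(1))
  ultimately have fin: "finite {w. (a \<otimes>\<^bsub>free_alg n\<^esub> b) w \<noteq> 0}"
    using finite_subset[OF _ finite_imageI] by fast
  have "set w \<subseteq> sp n" if w: "(a \<otimes>\<^bsub>free_alg n\<^esub> b) w \<noteq> 0" for w
  proof -
    obtain x y where "a x \<noteq> 0" "b y \<noteq> 0" "w = x @ y" using ex[OF w] by blast
    then show ?thesis using free_alg_support[OF a] free_alg_support[OF b] by simp
  qed
  with fin show ?thesis by (simp add: free_alg_simps(1))
qed

lemma free_alg_add_closed:
  assumes "a \<in> carrier (free_alg n)" "b \<in> carrier (free_alg n)"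
  shows "a \<oplus>\<^bsub>free_alg n\<^esub> b \<in> carrier (free_alg n)"
proof -
  have "{w. a w + b w \<noteq> 0} \<subseteq> {w. a w \<noteq> 0} \<union> {w. b w \<noteq> 0}" by auto
  moreover have "finite ({w. a w \<noteq> 0} \<union> {w. b w \<noteq> 0})"
    using assms by (simp add: free_alg_simps(1))
  ultimately have "finite {w. a w + b w \<noteq> 0}" by (rule finite_subset)
  moreover have "set w \<subseteq> sp n" if nz: "a w + b w \<noteq> 0" for w
    using nz free_alg_support[OF assms(1), of w] free_alg_support[OF assms(2), of w] by (cases "a w = 0") simp_all
  ultimately show ?thesis by (simp add: free_alg_simps)
qed

lemma scalar_closed: "scalar c \<in> carrier (free_alg n)"
proof -
  have "{w. scalar c w \<noteq> 0} \<subseteq> {[]}" by (auto simp: scalar_def)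
  then have "finite {w. scalar c w \<noteq> 0}" by (rule finite_subset) simp
  then show ?thesis by (simp add: free_alg_simps(1)) (simp add: scalar_def)
qed

lemma letter_closed: "X \<in> sp n \<Longrightarrow> letter X \<in> carrier (free_alg n)"
proof -
  assume "X \<in> sp n"
  moreover have "{w. letter X w \<noteq> 0} \<subseteq> {[X]}" by (auto simp: letter_def)
  then have "finite {w. letter X w \<noteq> 0}" by (rule finite_subset) simp
  ultimately show ?thesis by (simp add: free_alg_simps(1)) (simp add: letter_def)
qed

lemma free_alg_ring: "ring (free_alg n)"
proof (rule ringI)
  let ?F = "free_alg n"
  show "abelian_group ?F"
  proof (rule abelian_groupI)
    fix a assume a: "a \<in> carrier ?F"
    have "(\<lambda>w. - a w) \<in> carrier ?F" using a by (simp add: free_alg_simps)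
    moreover have "(\<lambda>w. - a w) \<oplus>\<^bsub>?F\<^esub> a = \<zero>\<^bsub>?F\<^esub>" by (simp add: free_alg_simps)
    ultimately show "\<exists>b\<in>carrier ?F. b \<oplus>\<^bsub>?F\<^esub> a = \<zero>\<^bsub>?F\<^esub>" by blast
  next
    show "\<zero>\<^bsub>?F\<^esub> \<in> carrier ?F" by (simp add: free_alg_simps)
  qed (simp_all add: free_alg_add_closed, simp_all add: free_alg_simps add_ac)
  show "monoid ?F"
  proof (rule monoidI)
    fix a b c :: "complex mat list \<Rightarrow> complex"
    show "a \<otimes>\<^bsub>?F\<^esub> b \<otimes>\<^bsub>?F\<^esub> c = a \<otimes>\<^bsub>?F\<^esub> (b \<otimes>\<^bsub>?F\<^esub> c)"
    proof
      fix w
      let ?f = "\<lambda>i j k. a (take i w) * b (take j (drop i w)) * c (drop (i + j) w)"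
      have "(a \<otimes>\<^bsub>?F\<^esub> b \<otimes>\<^bsub>?F\<^esub> c) w = (\<Sum>j=0..length w. \<Sum>i=0..j. ?f i (j - i) (length w - j))"
        unfolding free_alg_simps atMost_atLeast0 sum_distrib_right
        by (intro sum.cong) (auto simp: min_def drop_take)
      also have "\<dots> = (\<Sum>j=0..length w. \<Sum>i=0..length w - j. ?f j i (length w - j - i))"
        by (rule fps_mult_assoc_lemma)
      also have "\<dots> = (a \<otimes>\<^bsub>?F\<^esub> (b \<otimes>\<^bsub>?F\<^esub> c)) w"
        unfolding free_alg_simps atMost_atLeast0 sum_distrib_left
        by (intro sum.cong) (auto simp: mult.assoc add.commute)
      finally show "(a \<otimes>\<^bsub>?F\<^esub> b \<otimes>\<^bsub>?F\<^esub> c) w = (a \<otimes>\<^bsub>?F\<^esub> (b \<otimes>\<^bsub>?F\<^esub> c)) w" .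
    qed
    show "\<one>\<^bsub>?F\<^esub> \<otimes>\<^bsub>?F\<^esub> a = a" unfolding free_alg_simps(3) scalar_mult by simp
    show "a \<otimes>\<^bsub>?F\<^esub> \<one>\<^bsub>?F\<^esub> = a" unfolding free_alg_simps(3) mult_scalar by simp
    show "\<one>\<^bsub>?F\<^esub> \<in> carrier ?F" unfolding free_alg_simps(3) by (rule scalar_closed)
  qed (rule free_alg_mult_closed)
  fix a b c :: "complex mat list \<Rightarrow> complex"
  show "(a \<oplus>\<^bsub>?F\<^esub> b) \<otimes>\<^bsub>?F\<^esub> c = a \<otimes>\<^bsub>?F\<^esub> c \<oplus>\<^bsub>?F\<^esub> b \<otimes>\<^bsub>?F\<^esub> c"
    by (simp add: free_alg_simps distrib_right sum.distrib)
  show "c \<otimes>\<^bsub>?F\<^esub> (a \<oplus>\<^bsub>?F\<^esub> b) = c \<otimes>\<^bsub>?F\<^esub> a \<oplus>\<^bsub>?F\<^esub> c \<otimes>\<^bsub>?F\<^esub> b"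
    by (simp add: free_alg_simps distrib_left sum.distrib)
qed

lemma free_alg_minus:
  assumes "b \<in> carrier (free_alg n)"
  shows "a \<ominus>\<^bsub>free_alg n\<^esub> b = (\<lambda>w. a w - b w)"
proof -
  interpret ring "free_alg n" by (rule free_alg_ring)
  have "\<ominus>\<^bsub>free_alg n\<^esub> b = (\<lambda>w. - b w)"
    by (rule minus_equality) (use assms in \<open>auto simp: free_alg_simps\<close>)
  then show ?thesis by (simp add: a_minus_def free_alg_simps)
qed

text \<open>Only multiplication by letters from the left is available in the induction step; this
  matches the way in which words act on a module.\<close>

lemma free_alg_induct [consumes 1, case_names one add scalar letter]:
  assumes a: "a \<in> carrier (free_alg n)"
    and one: "P (scalar 1)"
    and add: "\<And>a b. a \<in> carrier (free_alg n) \<Longrightarrow> b \<in> carrier (free_alg n) \<Longrightarrow> P a \<Longrightarrow> P b \<Longrightarrow> P (a \<oplus>\<^bsub>free_alg n\<^esub> b)"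
    and scalar: "\<And>c a. a \<in> carrier (free_alg n) \<Longrightarrow> P a \<Longrightarrow> P (scalar c \<otimes>\<^bsub>free_alg n\<^esub> a)"
    and letter: "\<And>X a. X \<in> sp n \<Longrightarrow> a \<in> carrier (free_alg n) \<Longrightarrow> P a \<Longrightarrow> P (letter X \<otimes>\<^bsub>free_alg n\<^esub> a)"
  shows "P a"
proof -
  define word :: "complex mat list \<Rightarrow> complex mat list \<Rightarrow> complex" where "word u = (\<lambda>w. if w = u then 1 else 0)" for u
  have word: "word u \<in> carrier (free_alg n) \<and> P (word u)" if "set u \<subseteq> sp n" for u
    using that
  proof (induction u)
    case Nil
    have "word [] = scalar 1" by (auto simp: word_def scalar_def)
    then show ?case using one scalar_closed by simp
  next
    case (Cons X u)
    have "word (X # u) = letter X \<otimes>\<^bsub>free_alg n\<^esub> word u"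
      unfolding letter_mult by (auto simp: word_def split: list.splits)
    then show ?case using Cons letter[of X "word u"] free_alg_mult_closed[OF letter_closed] by auto
  qed
  have "finite {w. a w \<noteq> 0}" using a by (simp add: free_alg_simps)
  then show ?thesis using a
  proof (induction "{w. a w \<noteq> 0}" arbitrary: a rule: finite_induct)
    case empty
    then have "a = scalar 0 \<otimes>\<^bsub>free_alg n\<^esub> scalar 1" unfolding scalar_mult by auto
    then show ?case using scalar[OF scalar_closed one] by simp
  next
    case (insert u W)
    have mem: "a w \<noteq> 0 \<longleftrightarrow> w = u \<or> w \<in> W" for w using insert.hyps(4) by blast
    let ?b = "a(u := 0)"
    have supp: "W = {w. ?b w \<noteq> 0}" using mem insert.hyps(2) by auto
    have u: "set u \<subseteq> sp n" using insert.prems mem[of u] by (auto simp: free_alg_simps)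
    have b: "?b \<in> carrier (free_alg n)"
      using insert.prems insert.hyps(1) supp by (auto simp: free_alg_simps split: if_splits)
    have "P ?b" by (rule insert.hyps(3)[OF supp b])
    moreover have "a = ?b \<oplus>\<^bsub>free_alg n\<^esub> (scalar (a u) \<otimes>\<^bsub>free_alg n\<^esub> word u)"
      unfolding scalar_mult free_alg_simps(5) by (rule ext) (simp add: word_def)
    ultimately show ?case
      using add[OF b free_alg_mult_closed[OF scalar_closed]] word[OF u] scalar by metis
  qed
qed

subsection \<open>Evaluation of words on a vector\<close>

context sp_rep
begin

definition word_act :: "complex mat list \<Rightarrow> 'v \<Rightarrow> 'v" where
  "word_act w v = foldr (act M) w v"

lemma word_act_simps [simp]: "word_act [] v = v" "word_act (X # w) v = act M X (word_act w v)"
  by (simp_all add: word_act_def)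

lemma word_act_closed: "set w \<subseteq> sp n \<Longrightarrow> v \<in> carrier M \<Longrightarrow> word_act w v \<in> carrier M"
  by (induction w) auto

definition ev :: "'v \<Rightarrow> (complex mat list \<Rightarrow> complex) \<Rightarrow> 'v" where
  "ev v a = (\<Oplus>w\<in>{w. a w \<noteq> 0}. a w \<odot> word_act w v)"

text \<open>Sums over larger supports are needed to compare elements of the free algebra with different
  supports.\<close>

lemma ev_superset:
  assumes v: "v \<in> carrier M" and A: "finite A" "{w. a w \<noteq> 0} \<subseteq> A" "\<And>w. w \<in> A \<Longrightarrow> set w \<subseteq> sp n"
  shows "ev v a = (\<Oplus>w\<in>A. a w \<odot> word_act w v)"
  unfolding ev_def
  by (rule add.finprod_mono_neutral_cong_left) (use assms word_act_closed in auto)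

lemma additive_finsum:
  assumes "\<And>x y. x \<in> carrier M \<Longrightarrow> y \<in> carrier M \<Longrightarrow> f (x \<oplus> y) = f x \<oplus> f y"
    and "f \<zero> = \<zero>" "\<And>x. x \<in> carrier M \<Longrightarrow> f x \<in> carrier M"
    and "finite A" "\<And>w. w \<in> A \<Longrightarrow> g w \<in> carrier M"
  shows "f (\<Oplus>w\<in>A. g w) = (\<Oplus>w\<in>A. f (g w))"
  using assms(4,5)
proof (induction A rule: finite_induct)
  case (insert w A)
  have "(\<Oplus>w\<in>A. g w) \<in> carrier M" by (rule finsum_closed) (use insert in auto)
  moreover have "(\<Oplus>w\<in>insert w A. g w) = g w \<oplus> (\<Oplus>w\<in>A. g w)"
    by (rule finsum_insert) (use insert in auto)
  moreover have "(\<Oplus>w\<in>insert w A. f (g w)) = f (g w) \<oplus> (\<Oplus>w\<in>A. f (g w))"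
    by (rule finsum_insert) (use insert assms(3) in auto)
  ultimately show ?case using insert assms(1) by simp
qed (use assms in simp)

lemma ev_closed:
  assumes "v \<in> carrier M" "a \<in> carrier (free_alg n)" shows "ev v a \<in> carrier M"
  unfolding ev_def by (rule finsum_closed) (use assms word_act_closed in \<open>auto simp: free_alg_simps\<close>)

lemma ev_add:
  assumes v: "v \<in> carrier M" and a: "a \<in> carrier (free_alg n)" and b: "b \<in> carrier (free_alg n)"
  shows "ev v (a \<oplus>\<^bsub>free_alg n\<^esub> b) = ev v a \<oplus> ev v b"
proof -
  let ?A = "{w. a w \<noteq> 0} \<union> {w. b w \<noteq> 0}"
  have A: "finite ?A" "\<And>w. w \<in> ?A \<Longrightarrow> set w \<subseteq> sp n" using a b by (auto simp: free_alg_simps)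
  have "ev v (a \<oplus>\<^bsub>free_alg n\<^esub> b) = (\<Oplus>w\<in>?A. (a w + b w) \<odot> word_act w v)"
    unfolding free_alg_simps by (rule ev_superset[OF v A(1) _ A(2)]) auto
  also have "\<dots> = (\<Oplus>w\<in>?A. a w \<odot> word_act w v \<oplus> b w \<odot> word_act w v)"
    by (rule finsum_cong') (use A word_act_closed[OF _ v] in \<open>auto simp: l_distr\<close>)
  also have "\<dots> = (\<Oplus>w\<in>?A. a w \<odot> word_act w v) \<oplus> (\<Oplus>w\<in>?A. b w \<odot> word_act w v)"
    by (rule finsum_addf) (use A word_act_closed[OF _ v] in auto)
  also have "(\<Oplus>w\<in>?A. a w \<odot> word_act w v) = ev v a"
    by (rule ev_superset[OF v A(1) _ A(2), symmetric]) auto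
  also have "(\<Oplus>w\<in>?A. b w \<odot> word_act w v) = ev v b"
    by (rule ev_superset[OF v A(1) _ A(2), symmetric]) auto
  finally show ?thesis .
qed

lemma ev_scalar_mult:
  assumes v: "v \<in> carrier M" and a: "a \<in> carrier (free_alg n)"
  shows "ev v (scalar c \<otimes>\<^bsub>free_alg n\<^esub> a) = c \<odot> ev v a"
proof -
  let ?A = "{w. a w \<noteq> 0}"
  have A: "finite ?A" "\<And>w. w \<in> ?A \<Longrightarrow> set w \<subseteq> sp n" using a by (auto simp: free_alg_simps)
  have c: "a w \<odot> word_act w v \<in> carrier M" if "w \<in> ?A" for w
    using word_act_closed[OF A(2)[OF that] v] by simp
  have "ev v (scalar c \<otimes>\<^bsub>free_alg n\<^esub> a) = (\<Oplus>w\<in>?A. (c * a w) \<odot> word_act w v)"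
    unfolding scalar_mult by (rule ev_superset[OF v A(1) _ A(2)]) auto
  also have "\<dots> = (\<Oplus>w\<in>?A. c \<odot> (a w \<odot> word_act w v))"
    by (rule finsum_cong') (use A word_act_closed[OF _ v] in \<open>auto simp: smult_smult\<close>)
  also have "\<dots> = c \<odot> ev v a"
    unfolding ev_def by (rule additive_finsum[symmetric, where f = "\<lambda>x. c \<odot> x"]) (use A(1) c in \<open>auto simp: r_distr\<close>)
  finally show ?thesis .
qed

lemma ev_letter_mult:
  assumes v: "v \<in> carrier M" and a: "a \<in> carrier (free_alg n)" and X: "X \<in> sp n"
  shows "ev v (letter X \<otimes>\<^bsub>free_alg n\<^esub> a) = act M X (ev v a)"
proof -
  let ?A = "{w. a w \<noteq> 0}" and ?b = "letter X \<otimes>\<^bsub>free_alg n\<^esub> a"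
  have A: "finite ?A" "\<And>w. w \<in> ?A \<Longrightarrow> set w \<subseteq> sp n" using a by (auto simp: free_alg_simps)
  have c: "a w \<odot> word_act w v \<in> carrier M" "word_act w v \<in> carrier M" if "w \<in> ?A" for w
    using word_act_closed[OF A(2)[OF that] v] by simp_all
  have b: "?b (X # w) = a w" for w by (simp add: letter_mult)
  have "{w. ?b w \<noteq> 0} \<subseteq> (\<lambda>w. X # w) ` ?A"
  proof
    fix w assume w: "w \<in> {w. ?b w \<noteq> 0}"
    then show "w \<in> (\<lambda>w. X # w) ` ?A" by (cases w) (auto simp: letter_mult split: if_splits)
  qed
  moreover have "set w \<subseteq> sp n" if w: "w \<in> (\<lambda>w. X # w) ` ?A" for w
  proof -
    obtain u where "w = X # u" "u \<in> ?A" using w by blast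
    then show ?thesis using A(2)[of u] X by simp
  qed
  ultimately have "ev v ?b = (\<Oplus>w\<in>(\<lambda>w. X # w) ` ?A. ?b w \<odot> word_act w v)"
    by (rule ev_superset[OF v finite_imageI[OF A(1)]])
  also have "\<dots> = (\<Oplus>w\<in>?A. ?b (X # w) \<odot> word_act (X # w) v)"
    by (rule finsum_reindex) (use c X in \<open>auto simp: b\<close>)
  also have "\<dots> = (\<Oplus>w\<in>?A. act M X (a w \<odot> word_act w v))"
    by (rule finsum_cong') (use c X in \<open>auto simp: b act_smult\<close>)
  also have "\<dots> = act M X (ev v a)"
    unfolding ev_def by (rule additive_finsum[symmetric, where f = "act M X"]) (use A(1) c X in \<open>auto simp: act_add\<close>)
  finally show ?thesis .
qed

lemma ev_one: "v \<in> carrier M \<Longrightarrow> ev v (scalar 1) = v"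
proof -
  assume v: "v \<in> carrier M"
  have "ev v (scalar 1) = (\<Oplus>w\<in>{[]}. scalar 1 w \<odot> word_act w v)"
    by (rule ev_superset[OF v]) (auto simp: scalar_def)
  also have "\<dots> = v" using v by (simp add: finsum_insert[of "{}" "[]", simplified] scalar_def)
  finally show ?thesis .
qed

text \<open>Evaluation makes the module a module over the free algebra.\<close>

lemma ev_mult:
  assumes v: "v \<in> carrier M" and a: "a \<in> carrier (free_alg n)" and b: "b \<in> carrier (free_alg n)"
  shows "ev v (a \<otimes>\<^bsub>free_alg n\<^esub> b) = ev (ev v b) a"
proof -
  interpret F: ring "free_alg n" by (rule free_alg_ring)
  note evc = ev_closed[OF v b]
  show ?thesis using a
  proof (induction a rule: free_alg_induct)
    case one
    then show ?case using evc b by (simp add: ev_one scalar_mult)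
  next
    case (add a c)
    then show ?case using b evc v by (simp add: F.l_distr ev_add)
  next
    case (scalar k a)
    then show ?case using b evc v scalar_closed by (simp add: F.m_assoc ev_scalar_mult)
  next
    case (letter X a)
    then show ?case using b evc v letter_closed by (simp add: F.m_assoc ev_letter_mult)
  qed
qed

lemma ev_zero_vec: "a \<in> carrier (free_alg n) \<Longrightarrow> ev \<zero> a = \<zero>"
  by (induction a rule: free_alg_induct) (simp_all add: ev_one ev_add ev_scalar_mult ev_letter_mult)

lemma ev_minus:
  assumes v: "v \<in> carrier M" and a: "a \<in> carrier (free_alg n)" and b: "b \<in> carrier (free_alg n)"
  shows "ev v (a \<ominus>\<^bsub>free_alg n\<^esub> b) = ev v a \<ominus> ev v b"
proof -
  have "a \<ominus>\<^bsub>free_alg n\<^esub> b = a \<oplus>\<^bsub>free_alg n\<^esub> (scalar (-1) \<otimes>\<^bsub>free_alg n\<^esub> b)"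
    unfolding free_alg_minus[OF b] scalar_mult by (simp add: free_alg_simps)
  then show ?thesis
    using assms free_alg_mult_closed[OF scalar_closed b] by (simp add: ev_add ev_scalar_mult diff_eq ev_closed)
qed

lemma ev_letter: "v \<in> carrier M \<Longrightarrow> X \<in> sp n \<Longrightarrow> ev v (letter X) = act M X v"
proof -
  assume "v \<in> carrier M" "X \<in> sp n"
  moreover have "letter X = letter X \<otimes>\<^bsub>free_alg n\<^esub> scalar 1" unfolding mult_scalar by simp
  ultimately show ?thesis using ev_letter_mult[of v "scalar 1" X] by (simp add: scalar_closed ev_one)
qed

end

lemma env_relations_closed: "env_relations n \<subseteq> carrier (free_alg n)"
proof -
  interpret F: ring "free_alg n" by (rule free_alg_ring)
  show ?thesis unfolding env_relations_def Let_def
    by (auto intro!: F.minus_closed F.a_closed F.m_closed letter_closed scalar_closed sp_add sp_smult sp_bracket)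
qed

lemma env_ideal_ideal: "ideal (env_ideal n) (free_alg n)"
  unfolding env_ideal_def by (rule ring.genideal_ideal[OF free_alg_ring env_relations_closed])

text \<open>The annihilator of the whole module in the free algebra is a two-sided ideal, unlike that of a
  single vector, and the axioms of a module say that it contains the defining relations.\<close>

lemma (in sp_rep) ev_env_ideal:
  assumes "a \<in> env_ideal n" "v \<in> carrier M"
  shows "ev v a = \<zero>"
proof -
  interpret F: ring "free_alg n" by (rule free_alg_ring)
  define K where "K = {a \<in> carrier (free_alg n). \<forall>v\<in>carrier M. ev v a = \<zero>}"
  have "ideal K (free_alg n)"
  proof (rule idealI[OF free_alg_ring])
    show "subgroup K (add_monoid (free_alg n))"
    proof (rule F.add.subgroupI)
      show "K \<subseteq> carrier (free_alg n)" by (auto simp: K_def)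
      have "\<zero>\<^bsub>free_alg n\<^esub> \<in> K"
        unfolding K_def by (auto simp: ev_def free_alg_simps(4) finsum_empty) (simp add: free_alg_simps)
      then show "K \<noteq> {}" by blast
      show "\<ominus>\<^bsub>free_alg n\<^esub> a \<in> K" if "a \<in> K" for a
      proof -
        have a: "a \<in> carrier (free_alg n)" using that by (simp add: K_def)
        have "\<ominus>\<^bsub>free_alg n\<^esub> a = \<zero>\<^bsub>free_alg n\<^esub> \<ominus>\<^bsub>free_alg n\<^esub> a" using a by (simp add: F.minus_eq)
        also have "\<dots> = scalar (-1) \<otimes>\<^bsub>free_alg n\<^esub> a"
          unfolding free_alg_minus[OF a] scalar_mult by (simp add: free_alg_simps)
        finally show ?thesis using that a by (simp add: K_def ev_scalar_mult free_alg_mult_closed scalar_closed)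
      qed
      show "a \<oplus>\<^bsub>free_alg n\<^esub> b \<in> K" if "a \<in> K" "b \<in> K" for a b
        using that by (simp add: K_def ev_add)
    qed
    show "x \<otimes>\<^bsub>free_alg n\<^esub> a \<in> K" if "a \<in> K" "x \<in> carrier (free_alg n)" for a x
      using that by (simp add: K_def ev_mult ev_zero_vec)
    show "a \<otimes>\<^bsub>free_alg n\<^esub> x \<in> K" if "a \<in> K" "x \<in> carrier (free_alg n)" for a x
      using that by (simp add: K_def ev_mult ev_closed)
  qed
  moreover have "env_relations n \<subseteq> K"
  proof
    fix r assume r: "r \<in> env_relations n"
    have "ev v r = \<zero>" if v: "v \<in> carrier M" for v
      using r v unfolding env_relations_def Let_def
      by (auto simp: ev_minus ev_add ev_letter_mult ev_scalar_mult ev_letter letter_closed scalar_closed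
          F.m_closed F.a_closed F.minus_closed sp_add sp_smult sp_bracket act_add_mat act_smult_mat act_bracket
          diff_eq_zero_iff)
    then show "r \<in> K" using r env_relations_closed by (auto simp: K_def)
  qed
  ultimately have "env_ideal n \<subseteq> K"
    unfolding env_ideal_def by (rule F.genideal_minimal)
  then show ?thesis using assms by (auto simp: K_def)
qed

definition env_class :: "nat \<Rightarrow> (complex mat list \<Rightarrow> complex) \<Rightarrow> (complex mat list \<Rightarrow> complex) set" where
  "env_class n a = env_ideal n +>\<^bsub>free_alg n\<^esub> a"

lemma env_of_eq: "env_of n X = env_class n (letter X)" and env_scalar_eq: "env_scalar n c = env_class n (scalar c)"
  by (simp_all add: env_of_def env_scalar_def env_class_def)

lemma env_alg_simps:
  "carrier (env_alg n) = env_class n ` carrier (free_alg n)"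
  "\<zero>\<^bsub>env_alg n\<^esub> = env_class n \<zero>\<^bsub>free_alg n\<^esub>"
  "\<one>\<^bsub>env_alg n\<^esub> = env_class n (scalar 1)"
  "a \<in> carrier (free_alg n) \<Longrightarrow> b \<in> carrier (free_alg n) \<Longrightarrow>
     env_class n a \<oplus>\<^bsub>env_alg n\<^esub> env_class n b = env_class n (a \<oplus>\<^bsub>free_alg n\<^esub> b)"
  "a \<in> carrier (free_alg n) \<Longrightarrow> b \<in> carrier (free_alg n) \<Longrightarrow>
     env_class n a \<otimes>\<^bsub>env_alg n\<^esub> env_class n b = env_class n (a \<otimes>\<^bsub>free_alg n\<^esub> b)"
proof -
  interpret I: ideal "env_ideal n" "free_alg n" by (rule env_ideal_ideal)
  show "carrier (env_alg n) = env_class n ` carrier (free_alg n)"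
    by (auto simp: env_alg_def FactRing_def A_RCOSETS_def' a_r_coset_def' env_class_def)
  show "\<zero>\<^bsub>env_alg n\<^esub> = env_class n \<zero>\<^bsub>free_alg n\<^esub>"
    using I.a_subset by (simp add: env_alg_def FactRing_def env_class_def)
  show "\<one>\<^bsub>env_alg n\<^esub> = env_class n (scalar 1)"
    by (simp add: env_alg_def FactRing_def env_class_def free_alg_simps)
  show "env_class n a \<oplus>\<^bsub>env_alg n\<^esub> env_class n b = env_class n (a \<oplus>\<^bsub>free_alg n\<^esub> b)"
    if "a \<in> carrier (free_alg n)" "b \<in> carrier (free_alg n)"
    using I.a_rcos_sum[OF that] by (simp add: env_alg_def FactRing_def env_class_def)
  show "env_class n a \<otimes>\<^bsub>env_alg n\<^esub> env_class n b = env_class n (a \<otimes>\<^bsub>free_alg n\<^esub> b)"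
    if "a \<in> carrier (free_alg n)" "b \<in> carrier (free_alg n)"
    using I.rcoset_mult_add[OF that] by (simp add: env_alg_def FactRing_def env_class_def)
qed

lemma env_class_eqI:
  assumes "a \<in> carrier (free_alg n)" "b \<in> carrier (free_alg n)" "a \<ominus>\<^bsub>free_alg n\<^esub> b \<in> env_ideal n"
  shows "env_class n a = env_class n b"
proof -
  interpret I: ideal "env_ideal n" "free_alg n" by (rule env_ideal_ideal)
  have "a \<in> env_ideal n +>\<^bsub>free_alg n\<^esub> b"
    using assms I.a_rcos_module_minus[OF free_alg_ring assms(2,1)] by simp
  then show ?thesis unfolding env_class_def using I.a_repr_independence' assms(2) by metis
qed

lemma env_class_eqD:
  assumes "a \<in> carrier (free_alg n)" "b \<in> carrier (free_alg n)" "env_class n a = env_class n b"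
  shows "a \<ominus>\<^bsub>free_alg n\<^esub> b \<in> env_ideal n"
proof -
  interpret I: ideal "env_ideal n" "free_alg n" by (rule env_ideal_ideal)
  have "a \<in> env_ideal n +>\<^bsub>free_alg n\<^esub> b"
    using I.a_rcos_self[OF assms(1)] assms(3) by (simp add: env_class_def)
  then show ?thesis using I.a_rcos_module_minus[OF free_alg_ring assms(2,1)] by simp
qed

lemma env_of_relations:
  assumes X: "X \<in> sp n"
  shows "Y \<in> sp n \<Longrightarrow> env_class n (letter (X + Y)) = env_class n (letter X \<oplus>\<^bsub>free_alg n\<^esub> letter Y)"
    "env_class n (letter (c \<cdot>\<^sub>m X)) = env_class n (scalar c \<otimes>\<^bsub>free_alg n\<^esub> letter X)"
    "Y \<in> sp n \<Longrightarrow> env_class n (letter X \<otimes>\<^bsub>free_alg n\<^esub> letter Y \<ominus>\<^bsub>free_alg n\<^esub> letter Y \<otimes>\<^bsub>free_alg n\<^esub> letter X)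
      = env_class n (letter (bracket X Y))"
proof -
  interpret F: ring "free_alg n" by (rule free_alg_ring)
  have rel: "r \<in> env_ideal n" if "r \<in> env_relations n" for r
    using that F.genideal_self[OF env_relations_closed] unfolding env_ideal_def by blast
  note cl = letter_closed scalar_closed sp_add sp_smult sp_bracket X
  show "env_class n (letter (X + Y)) = env_class n (letter X \<oplus>\<^bsub>free_alg n\<^esub> letter Y)" if Y: "Y \<in> sp n"
  proof (rule env_class_eqI)
    have "letter (X + Y) \<ominus>\<^bsub>free_alg n\<^esub> (letter X \<oplus>\<^bsub>free_alg n\<^esub> letter Y) \<in> env_relations n"
      unfolding env_relations_def Let_def using X Y by blast
    then show "letter (X + Y) \<ominus>\<^bsub>free_alg n\<^esub> (letter X \<oplus>\<^bsub>free_alg n\<^esub> letter Y) \<in> env_ideal n" by (rule rel)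
  qed (simp_all add: cl Y)
  show "env_class n (letter (c \<cdot>\<^sub>m X)) = env_class n (scalar c \<otimes>\<^bsub>free_alg n\<^esub> letter X)"
  proof (rule env_class_eqI)
    have "letter (c \<cdot>\<^sub>m X) \<ominus>\<^bsub>free_alg n\<^esub> (scalar c \<otimes>\<^bsub>free_alg n\<^esub> letter X) \<in> env_relations n"
      unfolding env_relations_def Let_def using X by blast
    then show "letter (c \<cdot>\<^sub>m X) \<ominus>\<^bsub>free_alg n\<^esub> (scalar c \<otimes>\<^bsub>free_alg n\<^esub> letter X) \<in> env_ideal n" by (rule rel)
  qed (simp_all add: cl)
  show "env_class n (letter X \<otimes>\<^bsub>free_alg n\<^esub> letter Y \<ominus>\<^bsub>free_alg n\<^esub> letter Y \<otimes>\<^bsub>free_alg n\<^esub> letter X)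
      = env_class n (letter (bracket X Y))" if Y: "Y \<in> sp n"
  proof (rule env_class_eqI)
    have "(letter X \<otimes>\<^bsub>free_alg n\<^esub> letter Y \<ominus>\<^bsub>free_alg n\<^esub> letter Y \<otimes>\<^bsub>free_alg n\<^esub> letter X)
        \<ominus>\<^bsub>free_alg n\<^esub> letter (bracket X Y) \<in> env_relations n"
      unfolding env_relations_def Let_def using X Y by blast
    then show "(letter X \<otimes>\<^bsub>free_alg n\<^esub> letter Y \<ominus>\<^bsub>free_alg n\<^esub> letter Y \<otimes>\<^bsub>free_alg n\<^esub> letter X)
        \<ominus>\<^bsub>free_alg n\<^esub> letter (bracket X Y) \<in> env_ideal n" by (rule rel)
  qed (simp_all add: cl Y)
qed

section \<open>The enveloping algebra as a module, and Verma modules\<close>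

lemma env_module_simps:
  "carrier (env_module n) = env_class n ` carrier (free_alg n)"
  "\<zero>\<^bsub>env_module n\<^esub> = env_class n \<zero>\<^bsub>free_alg n\<^esub>"
  "a \<in> carrier (free_alg n) \<Longrightarrow> b \<in> carrier (free_alg n) \<Longrightarrow>
     env_class n a \<oplus>\<^bsub>env_module n\<^esub> env_class n b = env_class n (a \<oplus>\<^bsub>free_alg n\<^esub> b)"
  "a \<in> carrier (free_alg n) \<Longrightarrow>
     c \<odot>\<^bsub>env_module n\<^esub> env_class n a = env_class n (scalar c \<otimes>\<^bsub>free_alg n\<^esub> a)"
  "X \<in> sp n \<Longrightarrow> a \<in> carrier (free_alg n) \<Longrightarrow>
     act (env_module n) X (env_class n a) = env_class n (letter X \<otimes>\<^bsub>free_alg n\<^esub> a)"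
  by (simp_all add: env_module_def env_alg_simps env_of_eq env_scalar_eq scalar_closed letter_closed)

lemma env_class_mult_cong:
  assumes "a \<in> carrier (free_alg n)" "b \<in> carrier (free_alg n)" "c \<in> carrier (free_alg n)"
    "env_class n a = env_class n b"
  shows "env_class n (a \<otimes>\<^bsub>free_alg n\<^esub> c) = env_class n (b \<otimes>\<^bsub>free_alg n\<^esub> c)"
  using assms env_alg_simps(5)[of a n c] env_alg_simps(5)[of b n c] by simp

lemma sp_module_env: "sp_module n (env_module n)"
proof -
  interpret F: ring "free_alg n" by (rule free_alg_ring)
  let ?E = "env_module n"
  note cl = scalar_closed letter_closed
  have ag: "abelian_group ?E"
  proof (rule abelian_groupI)
    show "\<exists>y\<in>carrier ?E. y \<oplus>\<^bsub>?E\<^esub> x = \<zero>\<^bsub>?E\<^esub>" if x: "x \<in> carrier ?E" for x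
    proof -
      obtain a where a: "a \<in> carrier (free_alg n)" "x = env_class n a" using x by (auto simp: env_module_simps)
      then have "env_class n (\<ominus>\<^bsub>free_alg n\<^esub> a) \<oplus>\<^bsub>?E\<^esub> x = \<zero>\<^bsub>?E\<^esub>"
        by (simp add: env_module_simps F.l_neg)
      then show ?thesis using a by (auto simp: env_module_simps)
    qed
  qed (auto simp: env_module_simps F.a_ac)
  have mod: "module complex_ring ?E"
  proof (rule moduleI[OF complex_ring_cring ag], simp_all)
    show "c \<odot>\<^bsub>?E\<^esub> x \<in> carrier ?E" if "x \<in> carrier ?E" for c x
      using that by (auto simp: env_module_simps cl)
    show "(a + b) \<odot>\<^bsub>?E\<^esub> x = a \<odot>\<^bsub>?E\<^esub> x \<oplus>\<^bsub>?E\<^esub> b \<odot>\<^bsub>?E\<^esub> x" if "x \<in> carrier ?E" for a b x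
    proof -
      have "scalar (a + b) \<otimes>\<^bsub>free_alg n\<^esub> u = scalar a \<otimes>\<^bsub>free_alg n\<^esub> u \<oplus>\<^bsub>free_alg n\<^esub> scalar b \<otimes>\<^bsub>free_alg n\<^esub> u" for u
        unfolding scalar_mult free_alg_simps(5) by (simp add: distrib_right)
      then show ?thesis using that by (auto simp: env_module_simps cl)
    qed
    show "a \<odot>\<^bsub>?E\<^esub> (x \<oplus>\<^bsub>?E\<^esub> y) = a \<odot>\<^bsub>?E\<^esub> x \<oplus>\<^bsub>?E\<^esub> a \<odot>\<^bsub>?E\<^esub> y"
      if "x \<in> carrier ?E" "y \<in> carrier ?E" for a x y
      using that by (auto simp: env_module_simps cl F.r_distr)
    show "(a * b) \<odot>\<^bsub>?E\<^esub> x = a \<odot>\<^bsub>?E\<^esub> (b \<odot>\<^bsub>?E\<^esub> x)" if "x \<in> carrier ?E" for a b x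
    proof -
      have "scalar (a * b) \<otimes>\<^bsub>free_alg n\<^esub> u = scalar a \<otimes>\<^bsub>free_alg n\<^esub> (scalar b \<otimes>\<^bsub>free_alg n\<^esub> u)" for u
        unfolding scalar_mult by (simp add: mult.assoc)
      then show ?thesis using that by (auto simp: env_module_simps cl)
    qed
    show "1 \<odot>\<^bsub>?E\<^esub> x = x" if "x \<in> carrier ?E" for x
      using that by (auto simp: env_module_simps scalar_mult)
  qed
  interpret E: module complex_ring ?E by (rule mod)
  have inv: "\<ominus>\<^bsub>?E\<^esub> env_class n a = env_class n (\<ominus>\<^bsub>free_alg n\<^esub> a)" if "a \<in> carrier (free_alg n)" for a
    by (rule E.minus_equality) (use that in \<open>auto simp: env_module_simps F.l_neg\<close>)
  have comm: "letter X \<otimes>\<^bsub>free_alg n\<^esub> (scalar c \<otimes>\<^bsub>free_alg n\<^esub> a) = scalar c \<otimes>\<^bsub>free_alg n\<^esub> (letter X \<otimes>\<^bsub>free_alg n\<^esub> a)"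
    for X c a
    unfolding scalar_mult letter_mult by (rule ext) (simp split: list.split)
  show ?thesis unfolding sp_module_def
  proof (intro conjI mod ballI allI)
    fix X v assume X: "X \<in> sp n" and v: "v \<in> carrier ?E"
    then obtain a where a: "a \<in> carrier (free_alg n)" "v = env_class n a" by (auto simp: env_module_simps)
    show "act ?E X v \<in> carrier ?E" using X a by (simp add: env_module_simps cl)
    show "act ?E X (c \<odot>\<^bsub>?E\<^esub> v) = c \<odot>\<^bsub>?E\<^esub> act ?E X v" for c
      using X a by (simp add: env_module_simps cl comm)
    show "act ?E (c \<cdot>\<^sub>m X) v = c \<odot>\<^bsub>?E\<^esub> act ?E X v" for c
      using X a env_class_mult_cong[OF _ _ a(1) env_of_relations(2)[OF X, of c]]
      by (simp add: env_module_simps cl sp_smult F.m_assoc)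
    show "act ?E X (v \<oplus>\<^bsub>?E\<^esub> w) = act ?E X v \<oplus>\<^bsub>?E\<^esub> act ?E X w" if w: "w \<in> carrier ?E" for w
    proof -
      obtain b where "b \<in> carrier (free_alg n)" "w = env_class n b" using w by (auto simp: env_module_simps)
      then show ?thesis using X a by (simp add: env_module_simps cl F.r_distr)
    qed
    show "act ?E (X + Y) v = act ?E X v \<oplus>\<^bsub>?E\<^esub> act ?E Y v" if Y: "Y \<in> sp n" for Y
      using X Y a env_class_mult_cong[OF _ _ a(1) env_of_relations(1)[OF X Y]]
      by (simp add: env_module_simps cl sp_add F.l_distr)
    show "act ?E (bracket X Y) v = act ?E X (act ?E Y v) \<ominus>\<^bsub>?E\<^esub> act ?E Y (act ?E X v)" if Y: "Y \<in> sp n" for Y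
    proof -
      have "act ?E (bracket X Y) v = env_class n (letter (bracket X Y) \<otimes>\<^bsub>free_alg n\<^esub> a)"
        using X Y a by (simp add: env_module_simps sp_bracket)
      also have "\<dots> = env_class n ((letter X \<otimes>\<^bsub>free_alg n\<^esub> letter Y \<ominus>\<^bsub>free_alg n\<^esub> letter Y \<otimes>\<^bsub>free_alg n\<^esub> letter X) \<otimes>\<^bsub>free_alg n\<^esub> a)"
        by (rule env_class_mult_cong[OF _ _ a(1) env_of_relations(3)[OF X Y, symmetric]]) (use X Y in \<open>simp_all add: cl sp_bracket\<close>)
      also have "\<dots> = act ?E X (act ?E Y v) \<ominus>\<^bsub>?E\<^esub> act ?E Y (act ?E X v)"
        using X Y a by (simp add: env_module_simps cl E.minus_eq F.minus_eq inv F.l_distr F.l_minus F.m_assoc)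
      finally show ?thesis .
    qed
  qed
qed

lemma env_module_generated:
  assumes N: "sp_submodule n (env_module n) N" and one: "env_class n (scalar 1) \<in> N"
  shows "N = carrier (env_module n)"
proof -
  interpret E: sp_rep n "env_module n" by (rule sp_rep.intro[OF sp_module_env])
  note N' = E.sp_submodule_facts[OF N]
  have "env_class n a \<in> N" if "a \<in> carrier (free_alg n)" for a
    using that
  proof (induction a rule: free_alg_induct)
    case one then show ?case by (rule assms)
  next
    case (add a b) then show ?case using N'(3)[of "env_class n a" "env_class n b"] by (simp add: env_module_simps)
  next
    case (scalar c a) then show ?case using N'(4)[of "env_class n a" c] by (simp add: env_module_simps)
  next
    case (letter X a) then show ?case using N'(5)[of X "env_class n a"] by (simp add: env_module_simps)
  qed
  then show ?thesis using N'(1) by (auto simp: env_module_simps)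
qed

lemma env_module_left_closed:
  assumes N: "sp_submodule n (env_module n) N" and r: "r \<in> carrier (env_alg n)" and x: "x \<in> N"
  shows "r \<otimes>\<^bsub>env_alg n\<^esub> x \<in> N"
proof -
  interpret E: sp_rep n "env_module n" by (rule sp_rep.intro[OF sp_module_env])
  interpret F: ring "free_alg n" by (rule free_alg_ring)
  note N' = E.sp_submodule_facts[OF N]
  obtain b where b: "b \<in> carrier (free_alg n)" "x = env_class n b" using x N'(1) by (auto simp: env_module_simps)
  have "env_class n (a \<otimes>\<^bsub>free_alg n\<^esub> b) \<in> N" if "a \<in> carrier (free_alg n)" for a
    using that
  proof (induction a rule: free_alg_induct)
    case one then show ?case using x b by (simp add: scalar_mult)
  next
    case (add a c)
    then show ?case using b N'(3)[of "env_class n (a \<otimes>\<^bsub>free_alg n\<^esub> b)" "env_class n (c \<otimes>\<^bsub>free_alg n\<^esub> b)"]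
      by (simp add: env_module_simps F.l_distr)
  next
    case (scalar c a)
    then show ?case using b N'(4)[of "env_class n (a \<otimes>\<^bsub>free_alg n\<^esub> b)" c]
      by (simp add: env_module_simps F.m_assoc scalar_closed)
  next
    case (letter X a)
    then show ?case using b N'(5)[of X "env_class n (a \<otimes>\<^bsub>free_alg n\<^esub> b)"]
      by (simp add: env_module_simps F.m_assoc letter_closed)
  qed
  then show ?thesis using r b by (auto simp: env_alg_simps)
qed

text \<open>The enveloping algebra is the universal module with a distinguished vector: evaluation at \<open>v\<close>
  kills the ideal of relations, so it descends to cosets.\<close>

lemma env_module_hom:
  assumes M: "sp_module n M" and v: "v \<in> carrier M"
  obtains \<Omega> where "sp_hom n (env_module n) M \<Omega>" "\<Omega> (env_class n (scalar 1)) = v"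
    "\<And>X. X \<in> sp n \<Longrightarrow> \<Omega> (env_of n X) = act M X v" "\<And>c. \<Omega> (env_scalar n c) = c \<odot>\<^bsub>M\<^esub> v"
proof -
  interpret M: sp_rep n M by (rule sp_rep.intro[OF M])
  interpret F: ring "free_alg n" by (rule free_alg_ring)
  define \<Omega> where "\<Omega> U = M.ev v (SOME a. a \<in> carrier (free_alg n) \<and> U = env_class n a)" for U
  have \<Omega>: "\<Omega> (env_class n a) = M.ev v a" if a: "a \<in> carrier (free_alg n)" for a
  proof -
    define b where "b = (SOME b. b \<in> carrier (free_alg n) \<and> env_class n a = env_class n b)"
    have b: "b \<in> carrier (free_alg n) \<and> env_class n a = env_class n b"
      unfolding b_def by (rule someI[of _ a]) (use a in simp)
    then have "M.ev v (a \<ominus>\<^bsub>free_alg n\<^esub> b) = \<zero>\<^bsub>M\<^esub>"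
      using a by (intro M.ev_env_ideal[OF env_class_eqD v]) auto
    then have "M.ev v a = M.ev v b" using a b v by (simp add: M.ev_minus M.diff_eq_zero_iff M.ev_closed)
    then show ?thesis by (simp add: \<Omega>_def b_def)
  qed
  have "sp_hom n (env_module n) M \<Omega>"
    unfolding sp_hom_def
    using v by (auto simp: env_module_simps \<Omega> M.ev_closed M.ev_add M.ev_scalar_mult M.ev_letter_mult
        scalar_closed letter_closed)
  moreover have "\<Omega> (env_class n (scalar 1)) = v" using v by (simp add: \<Omega> scalar_closed M.ev_one)
  moreover have "\<Omega> (env_of n X) = act M X v" if "X \<in> sp n" for X
    using that v by (simp add: env_of_eq \<Omega> letter_closed M.ev_letter)
  moreover have "\<Omega> (env_scalar n c) = c \<odot>\<^bsub>M\<^esub> v" for c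
  proof -
    have "scalar c = scalar c \<otimes>\<^bsub>free_alg n\<^esub> scalar 1" unfolding mult_scalar by simp
    then show ?thesis using v M.ev_scalar_mult[OF v scalar_closed, of c 1] by (simp add: env_scalar_eq \<Omega> scalar_closed M.ev_one)
  qed
  ultimately show ?thesis using that by blast
qed

lemma additive_subgroup_env: "additive_subgroup N (env_module n) \<longleftrightarrow> additive_subgroup N (env_alg n)"
  by (simp add: additive_subgroup_def subgroup_def m_inv_def env_module_def)

lemma env_minus_eq: "x \<ominus>\<^bsub>env_alg n\<^esub> y = x \<ominus>\<^bsub>env_module n\<^esub> y"
  by (simp add: a_minus_def a_inv_def m_inv_def env_module_def)

text \<open>Subtraction is taken in the enveloping algebra as a module, so that homomorphisms out of it
  can be applied to the generators.\<close>

definition verma_gens :: "nat \<Rightarrow> (complex mat \<Rightarrow> complex) \<Rightarrow> (complex mat list \<Rightarrow> complex) set set" where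
  "verma_gens n \<mu> = env_of n ` n_plus n \<union>
      {env_of n H \<ominus>\<^bsub>env_module n\<^esub> env_scalar n (\<mu> H) | H. H \<in> cartan n}"

lemma env_of_closed: "X \<in> sp n \<Longrightarrow> env_of n X \<in> carrier (env_module n)"
  and env_scalar_closed: "env_scalar n c \<in> carrier (env_module n)"
  by (simp_all add: env_of_eq env_scalar_eq env_module_simps scalar_closed letter_closed)

lemma verma_gens_closed: "verma_gens n \<mu> \<subseteq> carrier (env_module n)"
proof -
  interpret E: sp_rep n "env_module n" by (rule sp_rep.intro[OF sp_module_env])
  show ?thesis unfolding verma_gens_def
    using n_plus_sp cartan_sp env_of_closed env_scalar_closed E.minus_closed by blast
qed

lemma verma_ideal_eq: "verma_ideal n \<mu> = left_ideal_gen (env_alg n) (verma_gens n \<mu>)"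
  by (simp add: verma_ideal_def verma_gens_def env_minus_eq)

text \<open>Submodules of the enveloping algebra are left ideals, since letters generate the algebra.\<close>

lemma verma_ideal_minimal:
  assumes N: "sp_submodule n (env_module n) N" and "verma_gens n \<mu> \<subseteq> N"
  shows "verma_ideal n \<mu> \<subseteq> N"
proof -
  interpret E: sp_rep n "env_module n" by (rule sp_rep.intro[OF sp_module_env])
  have "additive_subgroup N (env_alg n)"
    using E.sp_submodule_facts(6)[OF N] by (simp add: additive_subgroup_env)
  then show ?thesis unfolding verma_ideal_eq left_ideal_gen_def
    using assms env_module_left_closed[OF N] by blast
qed

lemma verma_gens_subset: "verma_gens n \<mu> \<subseteq> verma_ideal n \<mu>"
  unfolding verma_ideal_eq left_ideal_gen_def by blast

lemma verma_ideal_submodule: "sp_submodule n (env_module n) (verma_ideal n \<mu>)"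
proof -
  interpret E: sp_rep n "env_module n" by (rule sp_rep.intro[OF sp_module_env])
  let ?\<J> = "{J. additive_subgroup J (env_alg n) \<and>
     (\<forall>r \<in> carrier (env_alg n). \<forall>x \<in> J. r \<otimes>\<^bsub>env_alg n\<^esub> x \<in> J) \<and> verma_gens n \<mu> \<subseteq> J}"
  have eq: "verma_ideal n \<mu> = \<Inter>?\<J>" unfolding verma_ideal_eq left_ideal_gen_def ..
  have sub: "verma_ideal n \<mu> \<subseteq> carrier (env_module n)"
    by (rule verma_ideal_minimal[OF E.carrier_sp_submodule verma_gens_closed])
  have J: "additive_subgroup J (env_module n)" if "J \<in> ?\<J>" for J
    using that by (simp add: additive_subgroup_env)
  have zero: "\<zero>\<^bsub>env_module n\<^esub> \<in> J" if "J \<in> ?\<J>" for J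
    using additive_subgroup.zero_closed[OF J[OF that]] .
  have add: "x \<oplus>\<^bsub>env_module n\<^esub> y \<in> J" if "J \<in> ?\<J>" "x \<in> J" "y \<in> J" for J x y
    using additive_subgroup.a_closed[OF J[OF that(1)] that(2,3)] .
  have carr: "carrier (env_alg n) = carrier (env_module n)" by (simp add: env_module_def)
  show ?thesis
  proof (rule E.sp_submoduleI[OF sub])
    show "\<zero>\<^bsub>env_module n\<^esub> \<in> verma_ideal n \<mu>" unfolding eq using zero by (rule InterI)
    show "x \<oplus>\<^bsub>env_module n\<^esub> y \<in> verma_ideal n \<mu>" if "x \<in> verma_ideal n \<mu>" "y \<in> verma_ideal n \<mu>" for x y
      using that add unfolding eq Inter_iff by simp
    show "c \<odot>\<^bsub>env_module n\<^esub> x \<in> verma_ideal n \<mu>" if "x \<in> verma_ideal n \<mu>" for c x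
    proof -
      have "c \<odot>\<^bsub>env_module n\<^esub> x = env_scalar n c \<otimes>\<^bsub>env_alg n\<^esub> x" by (simp add: env_module_def)
      then show ?thesis using that env_scalar_closed[of n c] unfolding eq carr[symmetric] Inter_iff by simp
    qed
    show "act (env_module n) X x \<in> verma_ideal n \<mu>" if "X \<in> sp n" "x \<in> verma_ideal n \<mu>" for X x
    proof -
      have "act (env_module n) X x = env_of n X \<otimes>\<^bsub>env_alg n\<^esub> x" by (simp add: env_module_def)
      then show ?thesis using that env_of_closed[of X n] unfolding eq carr[symmetric] Inter_iff by simp
    qed
  qed
qed

definition verma_vector ::
  "nat \<Rightarrow> (complex mat \<Rightarrow> complex) \<Rightarrow> (complex mat list \<Rightarrow> complex) set set" where
  "verma_vector n \<mu> = verma_ideal n \<mu> +>\<^bsub>env_module n\<^esub> env_class n (scalar 1)"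

lemma sp_module_verma: "sp_module n (verma n \<mu>)"
  unfolding verma_def by (rule sp_rep.sp_module_quot[OF sp_rep.intro[OF sp_module_env] verma_ideal_submodule])

lemma verma_vector_closed: "verma_vector n \<mu> \<in> carrier (verma n \<mu>)"
proof -
  interpret E: sp_rep n "env_module n" by (rule sp_rep.intro[OF sp_module_env])
  show ?thesis unfolding verma_def verma_vector_def E.quot_simps(1)[OF verma_ideal_submodule]
    by (auto simp: env_module_simps scalar_closed)
qed

lemma act_verma_vector:
  assumes X: "X \<in> sp n"
  shows "act (verma n \<mu>) X (verma_vector n \<mu>) = verma_ideal n \<mu> +>\<^bsub>env_module n\<^esub> env_of n X"
proof -
  interpret E: sp_rep n "env_module n" by (rule sp_rep.intro[OF sp_module_env])
  have "letter X \<otimes>\<^bsub>free_alg n\<^esub> scalar 1 = letter X" unfolding mult_scalar by simp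
  then have "act (env_module n) X (env_class n (scalar 1)) = env_of n X"
    using X by (simp add: env_module_simps scalar_closed env_of_eq)
  then show ?thesis unfolding verma_def verma_vector_def
    using X E.quot_simps(5)[OF verma_ideal_submodule X, of "env_class n (scalar 1)"]
    by (simp add: env_module_simps scalar_closed)
qed

lemma n_plus_verma_vector:
  assumes X: "X \<in> n_plus n"
  shows "act (verma n \<mu>) X (verma_vector n \<mu>) = \<zero>\<^bsub>verma n \<mu>\<^esub>"
proof -
  interpret E: sp_rep n "env_module n" by (rule sp_rep.intro[OF sp_module_env])
  have "env_of n X \<in> verma_ideal n \<mu>" using X verma_gens_subset unfolding verma_gens_def by blast
  then show ?thesis unfolding act_verma_vector[OF n_plus_sp[OF X]] unfolding verma_def
    using E.coset_zero_iff[OF verma_ideal_submodule env_of_closed[OF n_plus_sp[OF X]]] by simp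
qed

lemma cartan_verma_vector:
  assumes H: "H \<in> cartan n"
  shows "act (verma n \<mu>) H (verma_vector n \<mu>) = \<mu> H \<odot>\<^bsub>verma n \<mu>\<^esub> verma_vector n \<mu>"
proof -
  interpret E: sp_rep n "env_module n" by (rule sp_rep.intro[OF sp_module_env])
  have "env_of n H \<ominus>\<^bsub>env_module n\<^esub> env_scalar n (\<mu> H) \<in> verma_ideal n \<mu>"
    using H verma_gens_subset unfolding verma_gens_def by blast
  then have "verma_ideal n \<mu> +>\<^bsub>env_module n\<^esub> env_of n H = verma_ideal n \<mu> +>\<^bsub>env_module n\<^esub> env_scalar n (\<mu> H)"
    using E.coset_eq_iff[OF verma_ideal_submodule] env_of_closed[OF cartan_sp[OF H]] env_scalar_closed by simp
  also have "env_scalar n (\<mu> H) = \<mu> H \<odot>\<^bsub>env_module n\<^esub> env_class n (scalar 1)"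
    by (simp add: env_module_simps scalar_closed env_scalar_eq mult_scalar)
  also have "verma_ideal n \<mu> +>\<^bsub>env_module n\<^esub> \<dots> = \<mu> H \<odot>\<^bsub>verma n \<mu>\<^esub> verma_vector n \<mu>"
    unfolding verma_def verma_vector_def
    by (rule E.quot_simps(4)[OF verma_ideal_submodule, symmetric]) (simp add: env_module_simps scalar_closed)
  finally show ?thesis unfolding act_verma_vector[OF cartan_sp[OF H]] .
qed

lemma verma_generated:
  assumes N: "sp_submodule n (verma n \<mu>) N" and v: "verma_vector n \<mu> \<in> N"
  shows "N = carrier (verma n \<mu>)"
proof -
  interpret E: sp_rep n "env_module n" by (rule sp_rep.intro[OF sp_module_env])
  interpret V: sp_rep n "verma n \<mu>" by (rule sp_rep.intro[OF sp_module_verma])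
  let ?\<pi> = "\<lambda>x. verma_ideal n \<mu> +>\<^bsub>env_module n\<^esub> x"
  have \<pi>: "sp_hom n (env_module n) (verma n \<mu>) ?\<pi>"
    unfolding verma_def by (rule E.sp_hom_quot[OF verma_ideal_submodule])
  have "sp_submodule n (env_module n) {x \<in> carrier (env_module n). ?\<pi> x \<in> N}"
    by (rule sp_submodule_vimage[OF sp_module_env sp_module_verma \<pi> N])
  moreover have "env_class n (scalar 1) \<in> {x \<in> carrier (env_module n). ?\<pi> x \<in> N}"
    using v by (simp add: verma_vector_def env_module_simps scalar_closed)
  ultimately have all: "{x \<in> carrier (env_module n). ?\<pi> x \<in> N} = carrier (env_module n)"
    by (rule env_module_generated)
  have "carrier (verma n \<mu>) = ?\<pi> ` carrier (env_module n)"
    unfolding verma_def by (rule E.quot_simps(1)[OF verma_ideal_submodule])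
  also have "\<dots> \<subseteq> N" using all by blast
  finally show ?thesis using V.sp_submodule_facts(1)[OF N] by blast
qed

text \<open>The universal property of Verma modules: the homomorphism from the enveloping algebra that sends
  1 to \<open>v\<close> kills the generators of the left ideal, hence the left ideal, and factors.\<close>

lemma verma_hom:
  assumes M: "sp_module n M" and v: "v \<in> carrier M"
    and np: "\<And>X. X \<in> n_plus n \<Longrightarrow> act M X v = \<zero>\<^bsub>M\<^esub>"
    and wt: "\<And>H. H \<in> cartan n \<Longrightarrow> act M H v = \<mu> H \<odot>\<^bsub>M\<^esub> v"
  obtains \<psi> where "sp_hom n (verma n \<mu>) M \<psi>" "\<psi> (verma_vector n \<mu>) = v"
proof -
  interpret M: sp_rep n M by (rule sp_rep.intro[OF M])
  interpret E: sp_rep n "env_module n" by (rule sp_rep.intro[OF sp_module_env])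
  obtain \<Omega> where \<Omega>: "sp_hom n (env_module n) M \<Omega>" "\<Omega> (env_class n (scalar 1)) = v"
    "\<And>X. X \<in> sp n \<Longrightarrow> \<Omega> (env_of n X) = act M X v" "\<And>c. \<Omega> (env_scalar n c) = c \<odot>\<^bsub>M\<^esub> v"
    by (rule env_module_hom[OF M v]) blast
  let ?K = "{x \<in> carrier (env_module n). \<Omega> x \<in> {\<zero>\<^bsub>M\<^esub>}}"
  have "sp_submodule n (env_module n) ?K"
    by (rule sp_submodule_vimage[OF sp_module_env M \<Omega>(1) sp_submodule_zero[OF M]])
  moreover have "verma_gens n \<mu> \<subseteq> ?K"
  proof
    fix g assume g: "g \<in> verma_gens n \<mu>"
    have "\<Omega> g = \<zero>\<^bsub>M\<^esub>"
    proof -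
      consider X where "X \<in> n_plus n" "g = env_of n X"
        | H where "H \<in> cartan n" "g = env_of n H \<ominus>\<^bsub>env_module n\<^esub> env_scalar n (\<mu> H)"
        using g unfolding verma_gens_def by blast
      then show ?thesis
      proof cases
        case 1 then show ?thesis using \<Omega>(3) np n_plus_sp by simp
      next
        case 2
        have c: "env_of n H \<in> carrier (env_module n)" "env_scalar n (\<mu> H) \<in> carrier (env_module n)"
          using 2 by (simp_all add: env_of_closed env_scalar_closed cartan_sp)
        have "\<Omega> g = \<Omega> (env_of n H) \<oplus>\<^bsub>M\<^esub> (-1) \<odot>\<^bsub>M\<^esub> \<Omega> (env_scalar n (\<mu> H))"
          using c 2(2) sp_homD[OF \<Omega>(1)] by (simp add: E.diff_eq)
        also have "\<dots> = \<mu> H \<odot>\<^bsub>M\<^esub> v \<ominus>\<^bsub>M\<^esub> \<mu> H \<odot>\<^bsub>M\<^esub> v"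
          using 2(1) v by (simp add: \<Omega> wt cartan_sp M.diff_eq)
        finally show ?thesis using v by (simp add: M.diff_eq_zero_iff)
      qed
    qed
    then show "g \<in> ?K" using g verma_gens_closed by blast
  qed
  ultimately have "verma_ideal n \<mu> \<subseteq> ?K" by (rule verma_ideal_minimal)
  then have kill: "\<Omega> x = \<zero>\<^bsub>M\<^esub>" if "x \<in> verma_ideal n \<mu>" for x using that by blast
  obtain \<psi> where "sp_hom n (verma n \<mu>) M \<psi>"
    "\<And>x. x \<in> carrier (env_module n) \<Longrightarrow> \<psi> (verma_ideal n \<mu> +>\<^bsub>env_module n\<^esub> x) = \<Omega> x"
    unfolding verma_def by (rule sp_hom_factor[OF sp_module_env M \<Omega>(1) verma_ideal_submodule kill]) blast+
  then show ?thesis using that \<Omega>(2) by (simp add: verma_vector_def env_module_simps scalar_closed)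
qed

section \<open>Uniqueness of the maximal submodule of a highest weight module\<close>

locale highest_weight = sp_rep n V for n and V :: "'v sp_mod" (structure) +
  fixes \<mu> :: "complex mat \<Rightarrow> complex" and v :: 'v
  assumes rank: "1 \<le> n" and v_closed [simp]: "v \<in> carrier V"
    and e_v: "\<And>i. 1 \<le> i \<Longrightarrow> i \<le> n \<Longrightarrow> act V (chev_e n i) v = \<zero>"
    and h_v: "\<And>H. H \<in> cartan n \<Longrightarrow> act V H v = \<mu> H \<odot> v"
    and generated: "\<And>N. sp_submodule n V N \<Longrightarrow> v \<in> N \<Longrightarrow> N = carrier V"
begin

text \<open>The \<open>k\<close>-th layer is spanned by the products of \<open>k\<close> lowering generators applied to \<open>v\<close>.\<close>

inductive layer :: "nat \<Rightarrow> 'v \<Rightarrow> bool" where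
  base: "layer 0 (c \<odot> v)"
| zero: "layer k \<zero>"
| lower: "layer k x \<Longrightarrow> 1 \<le> i \<Longrightarrow> i \<le> n \<Longrightarrow> layer (Suc k) (act V (chev_f n i) x)"
| add: "layer k x \<Longrightarrow> layer k y \<Longrightarrow> layer k (x \<oplus> y)"
| smult: "layer k x \<Longrightarrow> layer k (c \<odot> x)"

lemma layer_closed: "layer k x \<Longrightarrow> x \<in> carrier V"
  by (induction rule: layer.induct) (auto simp: chev_sp)

lemma layer_0: "layer k x \<Longrightarrow> k = 0 \<Longrightarrow> \<exists>c. x = c \<odot> v"
proof (induction rule: layer.induct)
  case (zero k)
  show ?case by (intro exI[of _ 0]) simp
next
  case (add k x y)
  then show ?case by (metis l_distr v_closed)
next
  case (smult k x c)
  then show ?case by (metis smult_smult v_closed)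
qed auto

lemma layer_cartan:
  assumes H: "H \<in> cartan n" shows "layer k x \<Longrightarrow> layer k (act V H x)"
proof (induction rule: layer.induct)
  case (base c)
  then show ?case using layer.base[of "c * \<mu> H"] by (simp add: act_smult h_v H cartan_sp smult_smult)
next
  case (lower k x i)
  have x: "x \<in> carrier V" using lower layer_closed by simp
  obtain s where s: "bracket H (chev_f n i) = s \<cdot>\<^sub>m chev_f n i"
    using bracket_cartan_chev_f[OF H lower(2,3)] by blast
  have "act V H (act V (chev_f n i) x) = act V (chev_f n i) (act V H x) \<oplus> s \<odot> act V (chev_f n i) x"
    using act_swap[OF cartan_sp[OF H] chev_sp(2)[OF lower(2,3)] x] s x lower by (simp add: act_smult_mat chev_sp)
  then show ?case using layer.add[OF layer.lower[OF lower(4,2,3)] layer.smult[OF layer.lower[OF lower(1,2,3)]]] by simp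
next
  case (add k x y)
  then show ?case using layer_closed cartan_sp[OF H] by (auto simp: act_add intro: layer.intros)
next
  case (smult k x c)
  then show ?case using layer_closed cartan_sp[OF H] by (auto simp: act_smult intro: layer.intros)
qed (use cartan_sp[OF H] in \<open>auto intro: layer.intros\<close>)

lemma layer_grading: "layer k x \<Longrightarrow> act V (grading_elt n) x = (\<mu> (grading_elt n) - of_nat k) \<odot> x"
proof (induction rule: layer.induct)
  case (base c)
  then show ?case by (simp add: act_smult h_v grading_elt_cartan cartan_sp smult_smult mult.commute)
next
  case (lower k x i)
  have x: "x \<in> carrier V" using lower layer_closed by simp
  have G: "grading_elt n \<in> sp n" by (rule cartan_sp[OF grading_elt_cartan])
  have "act V (grading_elt n) (act V (chev_f n i) x) =
      act V (chev_f n i) (act V (grading_elt n) x) \<oplus> (-1) \<odot> act V (chev_f n i) x"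
    using act_swap[OF G chev_sp(2)[OF lower(2,3)] x] x lower
    by (simp add: bracket_grading_elt_chev_f act_smult_mat chev_sp)
  also have "\<dots> = (\<mu> (grading_elt n) - of_nat k + (-1)) \<odot> act V (chev_f n i) x"
    using lower x l_distr[of "act V (chev_f n i) x" "\<mu> (grading_elt n) - of_nat k" "-1"]
    by (simp add: act_smult chev_sp)
  finally show ?case by (simp add: algebra_simps)
next
  case (add k x y)
  then show ?case using layer_closed cartan_sp[OF grading_elt_cartan] by (simp add: act_add r_distr)
next
  case (smult k x c)
  then show ?case using layer_closed cartan_sp[OF grading_elt_cartan] by (simp add: act_smult smult_smult mult.commute)
qed (use cartan_sp[OF grading_elt_cartan] in simp)

text \<open>Moving \<open>e\<^sub>j\<close> past the lowering generators leaves only terms with \<open>h\<^sub>j\<close>, which preserve layers,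
  and finally \<open>e\<^sub>j v = 0\<close>. There is no layer above layer 0, whence the case distinction.\<close>

lemma layer_raise:
  assumes j: "1 \<le> j" "j \<le> n"
  shows "layer k x \<Longrightarrow> (case k of 0 \<Rightarrow> act V (chev_e n j) x = \<zero> | Suc m \<Rightarrow> layer m (act V (chev_e n j) x))"
proof (induction rule: layer.induct)
  case (base c)
  then show ?case using j by (simp add: act_smult chev_sp e_v)
next
  case (zero k)
  then show ?case using j by (auto simp: chev_sp intro: layer.zero split: nat.split)
next
  case (lower k x i)
  have x: "x \<in> carrier V" using lower layer_closed by simp
  have "act V (chev_e n j) (act V (chev_f n i) x) =
      act V (chev_f n i) (act V (chev_e n j) x) \<oplus> (if j = i then 1 else 0) \<odot> act V (chev_h n j) x"
    using act_swap[OF chev_sp(1)[OF j] chev_sp(2)[OF lower(2,3)] x] x j lower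
    by (simp add: bracket_chev_e_f act_smult_mat chev_sp)
  moreover have "layer k (act V (chev_f n i) (act V (chev_e n j) x))"
  proof (cases "k = 0")
    case False
    then obtain m where "k = Suc m" by (cases rule: nat.exhaust[of k]) auto
    then show ?thesis using lower layer.lower[of m "act V (chev_e n j) x" i] by simp
  qed (use lower in \<open>auto simp: chev_sp intro: layer.zero\<close>)
  moreover have "layer k (act V (chev_h n j) x)"
    by (rule layer_cartan[OF chev_h_cartan[OF j]]) (use lower in simp)
  ultimately show ?case by (auto intro: layer.intros)
next
  case (add k x y)
  then show ?case using layer_closed j by (auto simp: act_add chev_sp intro: layer.intros split: nat.splits)
next
  case (smult k x c)
  then show ?case using layer_closed j by (auto simp: act_smult chev_sp intro: layer.intros split: nat.splits)
qed

inductive layers :: "'v \<Rightarrow> bool" where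
  layer: "layer k x \<Longrightarrow> layers x"
| add: "layers x \<Longrightarrow> layers y \<Longrightarrow> layers (x \<oplus> y)"

lemma layers_closed: "layers x \<Longrightarrow> x \<in> carrier V"
  by (induction rule: layers.induct) (auto simp: layer_closed)

lemma layers_smult: "layers x \<Longrightarrow> layers (c \<odot> x)"
proof (induction rule: layers.induct)
  case (add x y)
  then show ?case by (simp add: r_distr layers_closed layers.add)
qed (auto intro: layers.layer layer.smult)

lemma layers_act:
  assumes X: "X \<in> sp n" shows "layers x \<Longrightarrow> layers (act V X x)"
proof -
  have "\<forall>x. layers x \<longrightarrow> layers (act V X x)"
    using X rank
  proof (rule sp_generated)
    fix i assume i: "1 \<le> i" "i \<le> n"
    show "\<forall>x. layers x \<longrightarrow> layers (act V (chev_e n i) x)"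
    proof (intro allI impI)
      fix x assume "layers x"
      then show "layers (act V (chev_e n i) x)"
      proof (induction rule: layers.induct)
        case (layer k x)
        then show ?case using layer_raise[OF i layer] layer.zero[of 0]
          by (auto intro: layers.layer split: nat.splits)
      next
        case (add x y)
        then show ?case using act_add[OF chev_sp(1)[OF i] layers_closed layers_closed, of x y] layers.add by simp
      qed
    qed
    show "\<forall>x. layers x \<longrightarrow> layers (act V (chev_f n i) x)"
    proof (intro allI impI)
      fix x assume "layers x"
      then show "layers (act V (chev_f n i) x)"
      proof (induction rule: layers.induct)
        case (layer k x)
        show ?case by (rule layers.layer[OF layer.lower[OF layer i]])
      next
        case (add x y)
        then show ?case using act_add[OF chev_sp(2)[OF i] layers_closed layers_closed, of x y] layers.add by simp
      qed
    qed
  next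
    fix X Y assume "X \<in> sp n" "Y \<in> sp n" "\<forall>x. layers x \<longrightarrow> layers (act V X x)" "\<forall>x. layers x \<longrightarrow> layers (act V Y x)"
    then show "\<forall>x. layers x \<longrightarrow> layers (act V (X + Y) x)"
      "\<forall>x. layers x \<longrightarrow> layers (act V (bracket X Y) x)"
      by (simp_all add: act_add_mat act_bracket diff_eq layers_closed layers.add layers_smult)
  next
    fix c X assume "X \<in> sp n" "\<forall>x. layers x \<longrightarrow> layers (act V X x)"
    then show "\<forall>x. layers x \<longrightarrow> layers (act V (c \<cdot>\<^sub>m X) x)"
      by (simp add: act_smult_mat layers_closed layers_smult)
  qed
  then show "layers x \<Longrightarrow> layers (act V X x)" by simp
qed

lemma layers_all: "x \<in> carrier V \<Longrightarrow> layers x"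
proof -
  have "sp_submodule n V {x. layers x}"
    by (rule sp_submoduleI)
      (auto simp: layers_closed layers_smult layers_act intro: layers.intros layer.zero)
  moreover have "layers v" using layer.base[of 1] by (auto intro: layers.layer)
  ultimately have "{x. layers x} = carrier V" by (intro generated) auto
  then show "x \<in> carrier V \<Longrightarrow> layers x" by blast
qed

text \<open>The product of the operators \<open>g - \<mu> g + j\<close> over \<open>1 \<le> j \<le> K\<close>, where \<open>g\<close> is the grading
  element. On layer \<open>k\<close> it is the scalar \<open>\<Prod>j = 1..K. j - k\<close>, which is \<open>K!\<close> for \<open>k = 0\<close>
  and vanishes for \<open>1 \<le> k \<le> K\<close>. On the sum of the layers \<open>0, \<dots>, K\<close> it is therefore, up
  to a factor, the projection to the span of \<open>v\<close>. Being built from the action, it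
  preserves submodules.\<close>

primrec top_part :: "nat \<Rightarrow> 'v \<Rightarrow> 'v" where
  "top_part 0 x = x"
| "top_part (Suc K) x = act V (grading_elt n) (top_part K x)
     \<oplus> (of_nat (Suc K) - \<mu> (grading_elt n)) \<odot> top_part K x"

lemma top_part_closed: "x \<in> carrier V \<Longrightarrow> top_part K x \<in> carrier V"
  by (induction K) (auto simp: cartan_sp[OF grading_elt_cartan])

lemma top_part_add:
  "x \<in> carrier V \<Longrightarrow> y \<in> carrier V \<Longrightarrow> top_part K (x \<oplus> y) = top_part K x \<oplus> top_part K y"
  by (induction K)
    (auto simp: cartan_sp[OF grading_elt_cartan] act_add r_distr top_part_closed a_ac)

lemma top_part_submodule: "sp_submodule n V N \<Longrightarrow> x \<in> N \<Longrightarrow> top_part K x \<in> N"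
  by (induction K) (auto simp: sp_submodule_facts cartan_sp[OF grading_elt_cartan])

lemma top_part_layer:
  assumes x: "layer k x"
  shows "top_part K x = (\<Prod>j=1..K. of_nat j - of_nat k) \<odot> x"
proof (induction K)
  case 0
  then show ?case using layer_closed[OF x] by simp
next
  case (Suc K)
  let ?p = "\<Prod>j=1..K. of_nat j - of_nat k :: complex" and ?m = "\<mu> (grading_elt n)"
  have c: "x \<in> carrier V" by (rule layer_closed[OF x])
  have "top_part (Suc K) x = (?p * (?m - of_nat k)) \<odot> x \<oplus> ((of_nat (Suc K) - ?m) * ?p) \<odot> x"
    using c by (simp only: top_part.simps Suc act_smult[OF cartan_sp[OF grading_elt_cartan] c] layer_grading[OF x] smult_smult)
  also have "\<dots> = (?p * (?m - of_nat k) + (of_nat (Suc K) - ?m) * ?p) \<odot> x"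
    using c by (simp only: l_distr)
  also have "?p * (?m - of_nat k) + (of_nat (Suc K) - ?m) * ?p = (\<Prod>j=1..Suc K. of_nat j - of_nat k)"
    by (simp add: algebra_simps)
  finally show ?case .
qed

lemma top_part_eventually:
  "layers x \<Longrightarrow> \<exists>c K0. \<forall>K\<ge>K0. top_part K x = (c * fact K) \<odot> v"
proof (induction rule: layers.induct)
  case (layer k x)
  show ?case
  proof (cases k)
    case 0
    then obtain c where c: "x = c \<odot> v" using layer_0[OF layer] by blast
    have "top_part K x = (c * fact K) \<odot> v" for K
      unfolding top_part_layer[OF layer]
      by (simp add: 0 c smult_smult fact_prod mult.commute)
    then show ?thesis by blast
  next
    case (Suc m)
    have "top_part K x = (0 * fact K) \<odot> v" if "K \<ge> k" for K
    proof -
      have "(\<Prod>j=1..K. of_nat j - of_nat k :: complex) = 0" using that Suc by (intro prod_zero bexI[of _ k]) auto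
      then show ?thesis unfolding top_part_layer[OF layer] by (simp only: smult_0[OF layer_closed[OF layer]]) simp
    qed
    then show ?thesis by blast
  qed
next
  case (add x y)
  then obtain c K0 d K1 where c: "\<forall>K\<ge>K0. top_part K x = (c * fact K) \<odot> v" "\<forall>K\<ge>K1. top_part K y = (d * fact K) \<odot> v"
    by blast
  have "top_part K (x \<oplus> y) = ((c + d) * fact K) \<odot> v" if "K \<ge> max K0 K1" for K
    using that c add by (simp add: top_part_add layers_closed l_distr distrib_right)
  then show ?case by blast
qed

text \<open>Otherwise a nonzero multiple of \<open>v\<close> would lie in the submodule, which would then be everything.\<close>

lemma proper_submodule_top_part:
  assumes N: "sp_submodule n V N" "N \<noteq> carrier V" and x: "x \<in> N"
  shows "\<exists>K0. \<forall>K\<ge>K0. top_part K x = \<zero>"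
proof -
  note N' = sp_submodule_facts[OF N(1)]
  obtain c K0 where c: "\<forall>K\<ge>K0. top_part K x = (c * fact K) \<odot> v"
    using top_part_eventually layers_all x N'(1) by blast
  have "c = 0"
  proof (rule ccontr)
    assume "c \<noteq> 0"
    have "(1 / (c * fact K0)) \<odot> ((c * fact K0) \<odot> v) \<in> N"
      using c top_part_submodule[OF N(1) x, of K0] N'(4) by simp
    then have "v \<in> N" using \<open>c \<noteq> 0\<close> by (simp add: smult_smult)
    then show False using generated[OF N(1)] N(2) by blast
  qed
  then show ?thesis using c by auto
qed

text \<open>If two maximal submodules were different, their sum would be everything and \<open>v\<close> would be a sum
  of elements from each; but large \<open>top_part\<close> operators kill these and not \<open>v\<close>.\<close>

lemma maximal_submodule_unique:
  assumes N1: "sp_submodule n V N1" "N1 \<noteq> carrier V"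
      "\<And>N. sp_submodule n V N \<Longrightarrow> N1 \<subseteq> N \<Longrightarrow> N = N1 \<or> N = carrier V"
    and N2: "sp_submodule n V N2" "N2 \<noteq> carrier V"
      "\<And>N. sp_submodule n V N \<Longrightarrow> N2 \<subseteq> N \<Longrightarrow> N = N2 \<or> N = carrier V"
  shows "N1 = N2"
proof -
  note F1 = sp_submodule_facts[OF N1(1)] and F2 = sp_submodule_facts[OF N2(1)]
  have c1: "x \<in> carrier V" if "x \<in> N1" for x using that F1(1) by blast
  have c2: "x \<in> carrier V" if "x \<in> N2" for x using that F2(1) by blast
  define S where "S = {a \<oplus> b | a b. a \<in> N1 \<and> b \<in> N2}"
  have SI: "a \<oplus> b \<in> S" if "a \<in> N1" "b \<in> N2" for a b using that S_def by blast
  have SE: "\<exists>a b. x = a \<oplus> b \<and> a \<in> N1 \<and> b \<in> N2" if "x \<in> S" for x using that S_def by blast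
  have S: "sp_submodule n V S"
  proof (rule sp_submoduleI)
    show "S \<subseteq> carrier V" using SE c1 c2 by blast
    show "\<zero> \<in> S" using SI[OF F1(2) F2(2)] by simp
    show "x \<oplus> y \<in> S" if xy: "x \<in> S" "y \<in> S" for x y
    proof -
      obtain a b c d where *: "x = a \<oplus> b" "y = c \<oplus> d" "a \<in> N1" "b \<in> N2" "c \<in> N1" "d \<in> N2"
        using SE[OF xy(1)] SE[OF xy(2)] by blast
      then have "x \<oplus> y = (a \<oplus> c) \<oplus> (b \<oplus> d)" using c1 c2 by (simp add: a_ac)
      then show ?thesis using SI[OF F1(3)[OF *(3,5)] F2(3)[OF *(4,6)]] by simp
    qed
    show "c \<odot> x \<in> S" if x: "x \<in> S" for c x
    proof -
      obtain a b where *: "x = a \<oplus> b" "a \<in> N1" "b \<in> N2" using SE[OF x] by blast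
      then have "c \<odot> x = c \<odot> a \<oplus> c \<odot> b" using c1 c2 by (simp add: r_distr)
      then show ?thesis using SI[OF F1(4)[OF *(2)] F2(4)[OF *(3)]] by simp
    qed
    show "act V X x \<in> S" if X: "X \<in> sp n" "x \<in> S" for X x
    proof -
      obtain a b where *: "x = a \<oplus> b" "a \<in> N1" "b \<in> N2" using SE[OF X(2)] by blast
      then have "act V X x = act V X a \<oplus> act V X b" using c1 c2 X by (simp add: act_add)
      then show ?thesis using SI[OF F1(5)[OF X(1) *(2)] F2(5)[OF X(1) *(3)]] by simp
    qed
  qed
  have "N1 \<subseteq> S"
  proof
    fix x assume "x \<in> N1" then show "x \<in> S" using SI[of x, OF _ F2(2)] c1 by simp
  qed
  moreover have "N2 \<subseteq> S"
  proof
    fix x assume "x \<in> N2" then show "x \<in> S" using SI[OF F1(2), of x] c2 by simp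
  qed
  moreover have "S \<noteq> carrier V"
  proof
    assume "S = carrier V"
    then obtain a b where ab: "v = a \<oplus> b" "a \<in> N1" "b \<in> N2" using SE[of v] v_closed by blast
    obtain K0 K1 where K: "\<forall>K\<ge>K0. top_part K a = \<zero>" "\<forall>K\<ge>K1. top_part K b = \<zero>"
      using proper_submodule_top_part[OF N1(1,2) ab(2)] proper_submodule_top_part[OF N2(1,2) ab(3)] by blast
    let ?K = "max K0 K1"
    have "top_part ?K v = \<zero>" using K ab c1 c2 by (simp add: top_part_add)
    moreover have "layer 0 v" using layer.base[of 1] by simp
    then have "top_part ?K v = fact ?K \<odot> v" using top_part_layer[of 0 v ?K] by (simp add: fact_prod)
    ultimately have "(1 / fact ?K) \<odot> (fact ?K \<odot> v) = \<zero>" by simp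
    then have "v = \<zero>" by (simp add: smult_smult)
    then show False using generated[OF N1(1)] N1(2) F1(2) by simp
  qed
  ultimately show ?thesis using N1(3)[OF S] N2(3)[OF S] by blast
qed

end

lemma verma_highest_weight: "1 \<le> n \<Longrightarrow> highest_weight n (verma n \<mu>) \<mu> (verma_vector n \<mu>)"
  by (intro highest_weight.intro sp_rep.intro highest_weight_axioms.intro sp_module_verma verma_vector_closed
      n_plus_verma_vector cartan_verma_vector verma_generated n_plus.gen)

text \<open>The uniqueness of the maximal submodule is what makes the definite description in the definition
  of \<open>simple_hw_module\<close> denote the kernel of the map from the Verma module.\<close>

theorem irreducible_iso_simple_hw_module:
  assumes n: "1 \<le> n" and irr: "sp_irreducible n M" and v: "v \<in> carrier M" "v \<noteq> \<zero>\<^bsub>M\<^esub>"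
    and e: "\<And>i. 1 \<le> i \<Longrightarrow> i \<le> n \<Longrightarrow> act M (chev_e n i) v = \<zero>\<^bsub>M\<^esub>"
    and h: "\<And>H. H \<in> cartan n \<Longrightarrow> act M H v = \<mu> H \<odot>\<^bsub>M\<^esub> v"
  shows "sp_iso n M (simple_hw_module n \<mu>)"
proof -
  have M: "sp_module n M" by (rule sp_irreducibleD(1)[OF irr])
  interpret M: sp_rep n M by (rule sp_rep.intro[OF M])
  interpret V: highest_weight n "verma n \<mu>" \<mu> "verma_vector n \<mu>" by (rule verma_highest_weight[OF n])
  have np: "act M X v = \<zero>\<^bsub>M\<^esub>" if "X \<in> n_plus n" for X
    using that
  proof (induction rule: n_plus.induct)
    case (gen i) then show ?case by (rule e)
  qed (simp_all add: v n_plus_sp M.act_add_mat M.act_smult_mat M.act_bracket M.diff_eq)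
  obtain \<psi> where \<psi>: "sp_hom n (verma n \<mu>) M \<psi>" "\<psi> (verma_vector n \<mu>) = v"
    by (rule verma_hom[OF M v(1) np h]) blast+
  have "sp_submodule n M (\<psi> ` carrier (verma n \<mu>))"
    by (rule sp_submodule_image[OF sp_module_verma M \<psi>(1) V.carrier_sp_submodule])
  moreover have "v \<in> \<psi> ` carrier (verma n \<mu>)" using \<psi>(2) V.v_closed by blast
  ultimately have surj: "\<psi> ` carrier (verma n \<mu>) = carrier M"
    using sp_irreducibleD(3)[OF irr] v(2) by blast
  define N where "N = {x \<in> carrier (verma n \<mu>). \<psi> x = \<zero>\<^bsub>M\<^esub>}"
  have N: "sp_submodule n (verma n \<mu>) N" and iso: "sp_iso n M (sp_quot (verma n \<mu>) N)"
    using sp_iso_quot_kernel[OF sp_module_verma M \<psi>(1) surj] by (simp_all add: N_def)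
  have irr': "sp_irreducible n (sp_quot (verma n \<mu>) N)" by (rule sp_iso_irreducible[OF iso irr])
  have "(THE N. sp_submodule n (verma n \<mu>) N \<and> sp_irreducible n (sp_quot (verma n \<mu>) N)) = N"
  proof (rule the_equality)
    fix N' assume N': "sp_submodule n (verma n \<mu>) N' \<and> sp_irreducible n (sp_quot (verma n \<mu>) N')"
    show "N' = N"
      by (rule V.maximal_submodule_unique)
        (use N N' irr' irreducible_quot_maximal[OF sp_module_verma] in blast)+
  qed (use N irr' in blast)
  then show ?thesis using iso by (simp add: simple_hw_module_def)
qed

section \<open>Rational functions of one variable, interpolation, power sums\<close>

lemma poly_eq_cofinite:
  fixes p q :: "complex poly"
  assumes "finite {z. poly p z \<noteq> poly q z}"
  shows "p = q"
proof (rule ccontr)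
  assume "p \<noteq> q"
  then have "finite {z. poly (p - q) z = 0}" by (intro poly_roots_finite) simp
  with assms have "finite ({z. poly p z \<noteq> poly q z} \<union> {z. poly (p - q) z = 0})" by simp
  moreover have "{z. poly p z \<noteq> poly q z} \<union> {z. poly (p - q) z = 0} = UNIV" by auto
  ultimately have "finite (UNIV :: complex set)" by metis
  then show False using infinite_UNIV_char_0[where 'a = complex] by simp
qed

text \<open>An identity that fails at finitely many points only holds everywhere: near an exceptional point
  the function is a quotient of polynomials, and polynomials that agree outside a finite set are
  equal.\<close>

lemma locally_rational_cross:
  fixes f :: "complex \<Rightarrow> complex"
  assumes loc: "\<And>z0. \<exists>a b. poly b z0 \<noteq> 0 \<and> (\<forall>z. poly b z \<noteq> 0 \<longrightarrow> f z = poly a z / poly b z)"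
    and fin: "finite {z. f z * poly h z \<noteq> poly g z}"
  shows "f z * poly h z = poly g z"
proof -
  obtain a b where b: "poly b z \<noteq> 0" and ab: "\<And>w. poly b w \<noteq> 0 \<Longrightarrow> f w = poly a w / poly b w"
    using loc[of z] by blast
  have "b \<noteq> 0" using b by auto
  then have "finite ({w. f w * poly h w \<noteq> poly g w} \<union> {w. poly b w = 0})"
    using fin poly_roots_finite by simp
  moreover have ab': "poly a w = f w * poly b w" if "poly b w \<noteq> 0" for w
    using ab[OF that] that by simp
  have "{w. poly (a * h) w \<noteq> poly (g * b) w} \<subseteq> {w. f w * poly h w \<noteq> poly g w} \<union> {w. poly b w = 0}"
  proof
    fix w assume w: "w \<in> {w. poly (a * h) w \<noteq> poly (g * b) w}"
    have "poly (a * h) w = poly (g * b) w" if "poly b w \<noteq> 0" "f w * poly h w = poly g w"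
      using ab'[OF that(1)] that(2)[symmetric] by simp
    then show "w \<in> {w. f w * poly h w \<noteq> poly g w} \<union> {w. poly b w = 0}" using w by blast
  qed
  ultimately have "finite {w. poly (a * h) w \<noteq> poly (g * b) w}" by (rule rev_finite_subset)
  then have "a * h = g * b" by (rule poly_eq_cofinite)
  then have "poly (a * h) z = poly (g * b) z" by simp
  then have "(f z * poly h z) * poly b z = poly g z * poly b z" using ab'[OF b] by simp
  then show ?thesis using b by simp
qed

text \<open>A function without poles that is globally \<open>g / h\<close> is a polynomial: at a root of \<open>h\<close> the numerator
  vanishes as well, and the common linear factor can be cancelled. The degree bound is used to
  interpolate with a number of nodes that does not depend on the line.\<close>

lemma locally_rational_polynomial:
  fixes f :: "complex \<Rightarrow> complex"
  assumes loc: "\<And>z0. \<exists>a b. poly b z0 \<noteq> 0 \<and> (\<forall>z. poly b z \<noteq> 0 \<longrightarrow> f z = poly a z / poly b z)"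
    and "h \<noteq> 0" "finite {z. f z * poly h z \<noteq> poly g z}"
  shows "\<exists>q. degree q \<le> degree g \<and> (\<forall>z. f z = poly q z)"
  using assms(2,3)
proof (induction "degree h" arbitrary: g h)
  case 0
  then obtain c where c: "h = [:c:]" "c \<noteq> 0" by (metis degree_eq_zeroE pCons_0_0)
  have "f z = poly (Polynomial.smult (1 / c) g) z" for z
    using locally_rational_cross[OF loc 0(3), of z] c by (simp add: field_simps)
  then show ?case using degree_smult_le by blast
next
  case (Suc d)
  have "\<not> constant (poly h)" using Suc(2) constant_degree[of h] by simp
  then obtain w where w: "poly h w = 0" using fundamental_theorem_of_algebra by blast
  have cross: "f z * poly h z = poly g z" for z by (rule locally_rational_cross[OF loc Suc(4)])
  have "poly g w = 0" using cross[of w] w by simp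
  then obtain g' where g': "g = [:-w, 1:] * g'" using poly_eq_0_iff_dvd by (metis dvdE)
  obtain h' where h': "h = [:-w, 1:] * h'" using w poly_eq_0_iff_dvd by (metis dvdE)
  have "h' \<noteq> 0" using h' Suc(3) by auto
  have deg: "degree ([:-w, 1:] * p) = Suc (degree p)" if "p \<noteq> 0" for p :: "complex poly"
    using that by (subst degree_mult_eq) auto
  have "{z. f z * poly h' z \<noteq> poly g' z} \<subseteq> {w}"
  proof
    fix z assume z: "z \<in> {z. f z * poly h' z \<noteq> poly g' z}"
    have "(z - w) * (f z * poly h' z) = (z - w) * poly g' z"
      using cross[of z] unfolding g' h' by (simp add: algebra_simps)
    then show "z \<in> {w}" using z by simp
  qed
  then have "finite {z. f z * poly h' z \<noteq> poly g' z}" by (rule finite_subset) simp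
  moreover have "d = degree h'" using Suc(2) deg[OF \<open>h' \<noteq> 0\<close>] h' by simp
  ultimately obtain q where q: "degree q \<le> degree g'" "\<forall>z. f z = poly q z" using Suc(1) \<open>h' \<noteq> 0\<close> by blast
  have "degree g' \<le> degree g" using deg[of g'] g' by (cases "g' = 0") auto
  then show ?case using q by (meson le_trans)
qed

lemma lagrange_basis:
  fixes t :: "nat \<Rightarrow> complex"
  assumes "inj t"
  obtains L :: "nat \<Rightarrow> complex poly" where
    "\<And>q z. degree q \<le> N \<Longrightarrow> poly q z = (\<Sum>j\<le>N. poly (L j) z * poly q (t j))"
proof -
  define P where "P j = (\<Prod>k\<in>{..N} - {j}. [:- t k, 1:])" for j
  define L where "L j = Polynomial.smult (1 / poly (P j) (t j)) (P j)" for j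
  have nz: "poly (P j) (t j) \<noteq> 0" for j
    using assms by (auto simp: P_def poly_prod inj_eq)
  have L: "poly (L j) (t i) = (if i = j then 1 else 0)" if "i \<le> N" for i j
    using that nz[of j] by (auto simp: L_def P_def poly_prod)
  have degL: "degree (L j) \<le> N" if "j \<le> N" for j
  proof -
    have "degree (P j) \<le> sum (degree \<circ> (\<lambda>k. [:- t k, 1:])) ({..N} - {j})"
      unfolding P_def by (rule degree_prod_sum_le) simp
    also have "\<dots> = N" using that by simp
    finally show ?thesis using degree_smult_le[of "1 / poly (P j) (t j)" "P j"] by (simp add: L_def)
  qed
  have "poly q z = (\<Sum>j\<le>N. poly (L j) z * poly q (t j))" if q: "degree q \<le> N" for q z
  proof -
    let ?r = "\<Sum>j\<le>N. Polynomial.smult (poly q (t j)) (L j)"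
    have "q = ?r"
    proof (rule poly_eqI_degree[where A = "t ` {..N}"])
      show "poly q x = poly ?r x" if x: "x \<in> t ` {..N}" for x
      proof -
        obtain i where i: "x = t i" "i \<le> N" using x by auto
        have "poly ?r x = (\<Sum>j\<le>N. if j = i then poly q (t j) else 0)"
          unfolding poly_sum by (rule sum.cong) (auto simp: i L)
        then show ?thesis using i by simp
      qed
      have card: "card (t ` {..N}) = Suc N" using assms by (simp add: card_image inj_on_subset[OF assms])
      show "degree q < card (t ` {..N})" using q card by simp
      have "degree ?r \<le> N"
      proof (rule degree_sum_le)
        fix j assume "j \<in> {..N}"
        then show "degree (Polynomial.smult (poly q (t j)) (L j)) \<le> N"
          using degree_smult_le[of "poly q (t j)" "L j"] degL[of j] by simp
      qed simp
      then show "degree ?r < card (t ` {..N})" using card by simp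
    qed
    then have "poly q z = poly ?r z" by simp
    then show ?thesis by (simp add: poly_sum mult.commute)
  qed
  then show ?thesis using that by blast
qed

text \<open>The vanishing of the power sums gives that of \<open>\<Sum> a\<^sub>s p(x\<^sub>s)\<close> for every polynomial \<open>p\<close>, and \<open>p\<close>
  can be chosen to vanish at all nodes but one.\<close>

lemma power_sums_independent:
  fixes a x :: "'s \<Rightarrow> complex"
  assumes fin: "finite S" and inj: "inj_on x S" and zero: "\<And>t::nat. (\<Sum>s\<in>S. a s * x s ^ t) = 0" and s: "s \<in> S"
  shows "a s = 0"
proof -
  have *: "(\<Sum>s\<in>S. a s * poly p (x s)) = 0" for p
  proof -
    have "(\<Sum>s\<in>S. a s * poly p (x s)) = (\<Sum>s\<in>S. \<Sum>i\<le>degree p. coeff p i * (a s * x s ^ i))"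
      by (simp add: poly_altdef sum_distrib_left mult_ac)
    also have "\<dots> = (\<Sum>i\<le>degree p. coeff p i * (\<Sum>s\<in>S. a s * x s ^ i))"
      by (subst sum.swap) (simp add: sum_distrib_left)
    finally show ?thesis by (simp add: zero)
  qed
  define p where "p = (\<Prod>r\<in>S - {s}. [:- x r, 1:])"
  have "(\<Sum>r\<in>S. a r * poly p (x r)) = (\<Sum>r\<in>S. if r = s then a s * poly p (x s) else 0)"
    using fin by (intro sum.cong) (auto simp: p_def poly_prod)
  then have "a s * poly p (x s) = 0" using *[of p] fin s by simp
  moreover have "poly p (x s) \<noteq> 0"
    using fin inj s by (auto simp: p_def poly_prod dest: inj_onD)
  ultimately show ?thesis by simp
qed

section \<open>Polynomial functions\<close>

definition monomial_fun :: "nat \<Rightarrow> (nat \<Rightarrow> nat) \<Rightarrow> (nat \<Rightarrow> complex) \<Rightarrow> complex" where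
  "monomial_fun n \<mu> Q = (\<Prod>i = 1..n + 1. Q i ^ \<mu> i)"

lemma polynomial_fun_indexed:
  assumes "finite I"
  shows "polynomial_fun n (\<lambda>Q. \<Sum>x\<in>I. c x * monomial_fun n (e x) Q)"
proof -
  have "(\<Sum>x\<in>I. c x * monomial_fun n (e x) Q) =
      (\<Sum>\<mu>\<in>e ` I. (\<Sum>x\<in>{x\<in>I. e x = \<mu>}. c x) * (\<Prod>i = 1..n + 1. Q i ^ \<mu> i))" for Q
  proof -
    have "(\<Sum>x\<in>I. c x * monomial_fun n (e x) Q) = (\<Sum>\<mu>\<in>e ` I. \<Sum>x\<in>{x\<in>I. e x = \<mu>}. c x * monomial_fun n (e x) Q)"
      by (rule sum.image_gen[OF assms])
    then show ?thesis by (simp add: monomial_fun_def sum_distrib_right)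
  qed
  then show ?thesis unfolding polynomial_fun_def using assms by (intro exI[of _ "e ` I"] exI conjI) auto
qed

lemma polynomial_funE:
  assumes "polynomial_fun n g"
  obtains A c where "finite (A :: (nat \<Rightarrow> nat) set)" "\<And>Q. g Q = (\<Sum>\<mu>\<in>A. c \<mu> * monomial_fun n \<mu> Q)"
  using assms unfolding polynomial_fun_def monomial_fun_def by blast

lemma polynomial_fun_const: "polynomial_fun n (\<lambda>Q. c)"
  using polynomial_fun_indexed[of "{()}" n "\<lambda>_. c" "\<lambda>_ _. 0"] by (simp add: monomial_fun_def)

lemma polynomial_fun_coord:
  assumes "i \<in> {1..n + 1}" shows "polynomial_fun n (\<lambda>Q. Q i)"
proof -
  have "monomial_fun n (\<lambda>j. if j = i then 1 else 0) Q = Q i" for Q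
  proof -
    have "monomial_fun n (\<lambda>j. if j = i then 1 else 0) Q = (\<Prod>j = 1..n + 1. if j = i then Q j else 1)"
      unfolding monomial_fun_def by (rule prod.cong) auto
    then show ?thesis using assms by simp
  qed
  then show ?thesis
    using polynomial_fun_indexed[of "{()}" n "\<lambda>_. 1" "\<lambda>_ j. if j = i then 1 else 0"] by simp
qed

lemma polynomial_fun_add:
  assumes "polynomial_fun n f" "polynomial_fun n g" shows "polynomial_fun n (\<lambda>Q. f Q + g Q)"
proof -
  obtain A c where "finite A" and f: "\<And>Q. f Q = (\<Sum>\<mu>\<in>A. c \<mu> * monomial_fun n \<mu> Q)"
    by (rule polynomial_funE[OF assms(1)]) blast
  moreover obtain B d where "finite B" and g: "\<And>Q. g Q = (\<Sum>\<mu>\<in>B. d \<mu> * monomial_fun n \<mu> Q)"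
    by (rule polynomial_funE[OF assms(2)]) blast
  ultimately have "polynomial_fun n (\<lambda>Q. \<Sum>x\<in>A <+> B. (case x of Inl \<mu> \<Rightarrow> c \<mu> | Inr \<mu> \<Rightarrow> d \<mu>) *
      monomial_fun n (case x of Inl \<mu> \<Rightarrow> \<mu> | Inr \<mu> \<Rightarrow> \<mu>) Q)"
    by (intro polynomial_fun_indexed) simp
  then show ?thesis using \<open>finite A\<close> \<open>finite B\<close> by (simp add: sum.Plus f g)
qed

lemma polynomial_fun_mult:
  assumes "polynomial_fun n f" "polynomial_fun n g" shows "polynomial_fun n (\<lambda>Q. f Q * g Q)"
proof -
  obtain A c where A: "finite A" and f: "\<And>Q. f Q = (\<Sum>\<mu>\<in>A. c \<mu> * monomial_fun n \<mu> Q)"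
    by (rule polynomial_funE[OF assms(1)]) blast
  obtain B d where B: "finite B" and g: "\<And>Q. g Q = (\<Sum>\<mu>\<in>B. d \<mu> * monomial_fun n \<mu> Q)"
    by (rule polynomial_funE[OF assms(2)]) blast
  have m: "monomial_fun n (\<lambda>i. \<mu> i + \<nu> i) Q = monomial_fun n \<mu> Q * monomial_fun n \<nu> Q" for \<mu> \<nu> Q
    by (simp add: monomial_fun_def power_add prod.distrib)
  have "polynomial_fun n (\<lambda>Q. \<Sum>x\<in>A \<times> B. (c (fst x) * d (snd x)) * monomial_fun n (\<lambda>i. fst x i + snd x i) Q)"
    using A B by (intro polynomial_fun_indexed) simp
  moreover have "(\<Sum>x\<in>A \<times> B. (c (fst x) * d (snd x)) * monomial_fun n (\<lambda>i. fst x i + snd x i) Q) = f Q * g Q" for Q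
    unfolding f g sum_product sum.cartesian_product by (rule sum.cong) (auto simp: m)
  ultimately show ?thesis by simp
qed

lemma polynomial_fun_sum:
  "finite I \<Longrightarrow> (\<And>i. i \<in> I \<Longrightarrow> polynomial_fun n (f i)) \<Longrightarrow> polynomial_fun n (\<lambda>Q. \<Sum>i\<in>I. f i Q)"
  by (induction I rule: finite_induct) (auto intro: polynomial_fun_const polynomial_fun_add)

lemma polynomial_fun_power: "polynomial_fun n f \<Longrightarrow> polynomial_fun n (\<lambda>Q. f Q ^ k)"
  by (induction k) (auto intro: polynomial_fun_const polynomial_fun_mult)

lemma polynomial_fun_poly:
  assumes "i \<in> {1..n + 1}" shows "polynomial_fun n (\<lambda>Q. poly p (Q i))"
  unfolding poly_altdef
  by (intro polynomial_fun_sum polynomial_fun_mult polynomial_fun_const polynomial_fun_power polynomial_fun_coord assms) simp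

text \<open>The degree bound must not depend on the line, as one set of interpolation nodes has to serve all
  lines.\<close>

lemma polynomial_fun_line:
  assumes "polynomial_fun n g"
  obtains N where "\<And>C. (\<And>i. degree (C i) \<le> 1) \<Longrightarrow> \<exists>P. degree P \<le> N \<and> (\<forall>s. g (\<lambda>i. poly (C i) s) = poly P s)"
proof -
  obtain A c where A: "finite A" and g: "\<And>Q. g Q = (\<Sum>\<mu>\<in>A. c \<mu> * monomial_fun n \<mu> Q)"
    by (rule polynomial_funE[OF assms]) blast
  define N where "N = (\<Sum>\<mu>\<in>A. \<Sum>i=1..n+1. \<mu> i)"
  have "\<exists>P. degree P \<le> N \<and> (\<forall>s. g (\<lambda>i. poly (C i) s) = poly P s)" if C: "\<And>i. degree (C i) \<le> 1" for C
  proof (intro exI conjI allI)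
    let ?P = "\<Sum>\<mu>\<in>A. Polynomial.smult (c \<mu>) (\<Prod>i=1..n+1. C i ^ \<mu> i)"
    show "g (\<lambda>i. poly (C i) s) = poly ?P s" for s
      by (simp add: g monomial_fun_def poly_sum poly_prod)
    show "degree ?P \<le> N"
    proof (rule degree_sum_le[OF A])
      fix \<mu> assume \<mu>: "\<mu> \<in> A"
      have "degree (Polynomial.smult (c \<mu>) (\<Prod>i=1..n+1. C i ^ \<mu> i)) \<le> degree (\<Prod>i=1..n+1. C i ^ \<mu> i)" by (rule degree_smult_le)
      also have "\<dots> \<le> sum (degree \<circ> (\<lambda>i. C i ^ \<mu> i)) {1..n+1}" by (rule degree_prod_sum_le) simp
      also have "\<dots> \<le> (\<Sum>i=1..n+1. \<mu> i)"
      proof (rule sum_mono)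
        fix i show "(degree \<circ> (\<lambda>i. C i ^ \<mu> i)) i \<le> \<mu> i"
          using le_trans[OF degree_power_le mult_le_mono1[OF C[of i], of "\<mu> i"]] by simp
      qed
      also have "\<dots> \<le> N" unfolding N_def by (rule member_le_sum[OF \<mu> _ A]) simp
      finally show "degree (Polynomial.smult (c \<mu>) (\<Prod>i=1..n+1. C i ^ \<mu> i)) \<le> N" .
    qed
  qed
  then show ?thesis using that by blast
qed

section \<open>Regular functions on the cover are polynomial\<close>

lemma preimage_tot_space: "preimage n (tot_space n) = cover n"
  by (auto simp: preimage_def tot_space_def)

lemma eventually_poly_nonzero:
  fixes p :: "complex poly"
  assumes "p \<noteq> 0" shows "\<forall>\<^sub>F s in at a. poly p s \<noteq> 0"
proof -
  have "\<forall>\<^sub>F s in at a. \<forall>r\<in>{r. poly p r = 0}. s \<noteq> r"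
    by (rule eventually_ball_finite) (auto simp: poly_roots_finite assms eventually_neq_at_within)
  then show ?thesis by (rule eventually_mono) auto
qed

text \<open>A curve with a polynomial in each coordinate. For degrees at most 1 it is a line or constant; it is
  left general so that the coordinates can be replaced one at a time.\<close>

definition line :: "(nat \<Rightarrow> complex poly) \<Rightarrow> complex \<Rightarrow> nat \<Rightarrow> complex" where
  "line C s = (\<lambda>i. poly (C i) s)"

lemma regular_on_line:
  assumes f: "regular_on n V f" and C: "\<And>i. degree (C i) \<le> 1" and V: "line C s0 \<in> V"
  obtains a b where "poly b s0 \<noteq> 0" "\<And>s. line C s \<in> V \<Longrightarrow> poly b s \<noteq> 0 \<Longrightarrow> f (line C s) = poly a s / poly b s"
proof -
  obtain g h where g: "polynomial_fun n g" and h: "polynomial_fun n h" "h (line C s0) \<noteq> 0"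
    and gh: "\<And>Q. Q \<in> V \<Longrightarrow> h Q \<noteq> 0 \<Longrightarrow> f Q = g Q / h Q"
    using f V unfolding regular_on_def by blast
  obtain N where "\<And>C. (\<And>i. degree (C i) \<le> 1) \<Longrightarrow> \<exists>P. degree P \<le> N \<and> (\<forall>s. g (\<lambda>i. poly (C i) s) = poly P s)"
    by (rule polynomial_fun_line[OF g]) blast
  then obtain a where a: "\<And>s. g (line C s) = poly a s" using C unfolding line_def by blast
  obtain N where "\<And>C. (\<And>i. degree (C i) \<le> 1) \<Longrightarrow> \<exists>P. degree P \<le> N \<and> (\<forall>s. h (\<lambda>i. poly (C i) s) = poly P s)"
    by (rule polynomial_fun_line[OF h(1)]) blast
  then obtain b where b: "\<And>s. h (line C s) = poly b s" using C unfolding line_def by blast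
  show ?thesis
  proof (rule that[of b a])
    show "poly b s0 \<noteq> 0" using h(2) by (simp add: b)
    show "f (line C s) = poly a s / poly b s" if "line C s \<in> V" "poly b s \<noteq> 0" for s
      using gh[OF that(1)] that(2) by (simp add: a b)
  qed
qed

lemma eventually_line_cover:
  assumes C0: "\<And>i. i \<notin> {1..n + 1} \<Longrightarrow> C i = 0" and s0: "line C s0 \<in> cover n"
  shows "\<forall>\<^sub>F s in at s0. line C s \<in> cover n"
proof -
  obtain i where i: "i \<in> {1..n}" "poly (C i) s0 \<noteq> 0" using s0 by (auto simp: cover_def line_def)
  have "C i \<noteq> 0" using i by auto
  then have "\<forall>\<^sub>F s in at s0. poly (C i) s \<noteq> 0" by (rule eventually_poly_nonzero)
  then show ?thesis
  proof (rule eventually_mono)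
    fix s assume "poly (C i) s \<noteq> 0"
    then show "line C s \<in> cover n" using C0 i by (auto simp: cover_def line_def)
  qed
qed

lemma regular_on_continuous_line:
  assumes f: "regular_on n (cover n) f" and C: "\<And>i. degree (C i) \<le> 1"
    and C0: "\<And>i. i \<notin> {1..n + 1} \<Longrightarrow> C i = 0" and s0: "line C s0 \<in> cover n"
  shows "((\<lambda>s. f (line C s)) \<longlongrightarrow> f (line C s0)) (at s0)"
proof -
  obtain a b where b: "poly b s0 \<noteq> 0" and ab: "\<And>s. line C s \<in> cover n \<Longrightarrow> poly b s \<noteq> 0 \<Longrightarrow> f (line C s) = poly a s / poly b s"
    by (rule regular_on_line[OF f C s0]) blast
  have "b \<noteq> 0" using b by auto
  have "((\<lambda>s. poly a s / poly b s) \<longlongrightarrow> poly a s0 / poly b s0) (at s0)"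
    by (intro tendsto_intros b)
  moreover have "\<forall>\<^sub>F s in at s0. poly a s / poly b s = f (line C s)"
  proof -
    have "\<forall>\<^sub>F s in at s0. line C s \<in> cover n"
      by (rule eventually_line_cover[OF _ s0]) (rule C0)
    then show ?thesis
      using eventually_poly_nonzero[OF \<open>b \<noteq> 0\<close>, of s0] by eventually_elim (simp add: ab)
  qed
  ultimately have "((\<lambda>s. f (line C s)) \<longlongrightarrow> poly a s0 / poly b s0) (at s0)"
    by (rule Lim_transform_eventually)
  then show ?thesis using ab[OF s0 b] by simp
qed

text \<open>The nodes are nonzero, so that replacing a coordinate by a node does not leave the cover.\<close>

abbreviation node :: "nat \<Rightarrow> complex" where "node j \<equiv> of_nat (Suc j)"

lemma inj_node: "inj node"
  by (rule injI) simp

lemma node_nonzero: "node j \<noteq> 0"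
  by (rule of_nat_neq_0)

lemma cover_update:
  assumes Q: "Q \<in> cover n" and i: "i \<in> {1..n + 1}"
  shows "Q(i := node j) \<in> cover n"
proof (cases "i = n + 1")
  case True then show ?thesis using Q by (auto simp: cover_def)
next
  case False then show ?thesis using Q i node_nonzero[of j] by (auto simp: cover_def intro!: bexI[of _ i])
qed

text \<open>Here \<open>g / h\<close> represents \<open>f\<close> on a dense open set. If the line through \<open>Q\<close> in direction \<open>i\<close> lies
  in the cover and \<open>h Q \<noteq> 0\<close>, then the restriction of \<open>f\<close> to this line is a quotient of
  polynomials without poles, hence a polynomial, of degree at most that of the numerator.\<close>

lemma regular_interpolation_generic:
  assumes f: "regular_on n (cover n) f" and h: "polynomial_fun n h"
    and gh: "\<And>Q. Q \<in> cover n \<Longrightarrow> h Q \<noteq> 0 \<Longrightarrow> f Q = g Q / h Q"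
    and N: "\<And>C. (\<And>i. degree (C i) \<le> 1) \<Longrightarrow> \<exists>P. degree P \<le> N \<and> (\<forall>s. g (\<lambda>i. poly (C i) s) = poly P s)"
    and L: "\<And>q z. degree q \<le> N \<Longrightarrow> poly q z = (\<Sum>j\<le>N. poly (L j) z * poly q (node j))"
    and Q: "h Q \<noteq> 0" "\<And>z. Q(i := z) \<in> cover n"
  shows "f Q = (\<Sum>j\<le>N. poly (L j) (Q i) * f (Q(i := node j)))"
proof -
  define C where "C = (\<lambda>j. if j = i then [:0, 1:] else [:Q j:])"
  have line: "line C z = Q(i := z)" for z by (auto simp: line_def C_def)
  have deg: "degree (C j) \<le> 1" for j by (simp add: C_def)
  obtain G where G: "degree G \<le> N" "\<And>z. g (line C z) = poly G z"
    using N[of C, OF deg] unfolding line_def by blast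
  obtain N' where "\<And>C. (\<And>i. degree (C i) \<le> 1) \<Longrightarrow> \<exists>P. degree P \<le> N' \<and> (\<forall>s. h (\<lambda>i. poly (C i) s) = poly P s)"
    by (rule polynomial_fun_line[OF h]) blast
  then obtain H where H: "\<And>z. h (line C z) = poly H z"
    using deg unfolding line_def by blast
  have "poly H (Q i) \<noteq> 0" using Q(1) H[of "Q i"] by (simp add: line)
  then have "H \<noteq> 0" by auto
  have loc: "\<exists>a b. poly b z0 \<noteq> 0 \<and> (\<forall>z. poly b z \<noteq> 0 \<longrightarrow> f (Q(i := z)) = poly a z / poly b z)" for z0
  proof -
    have "line C z0 \<in> cover n" unfolding line by (rule Q(2))
    then obtain a b where "poly b z0 \<noteq> 0"
      "\<And>s. line C s \<in> cover n \<Longrightarrow> poly b s \<noteq> 0 \<Longrightarrow> f (line C s) = poly a s / poly b s"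
      by (rule regular_on_line[OF f deg]) blast
    then show ?thesis using Q(2) unfolding line by blast
  qed
  have "{z. f (Q(i := z)) * poly H z \<noteq> poly G z} \<subseteq> {z. poly H z = 0}"
  proof
    fix z assume z: "z \<in> {z. f (Q(i := z)) * poly H z \<noteq> poly G z}"
    have "f (Q(i := z)) * poly H z = poly G z" if "poly H z \<noteq> 0"
      using gh[OF Q(2), of z] that H[of z] G(2)[of z] by (simp add: line)
    then show "z \<in> {z. poly H z = 0}" using z by blast
  qed
  then have "finite {z. f (Q(i := z)) * poly H z \<noteq> poly G z}"
    using poly_roots_finite[OF \<open>H \<noteq> 0\<close>] by (rule finite_subset)
  then obtain q where q: "degree q \<le> degree G" "\<And>z. f (Q(i := z)) = poly q z"
    using locally_rational_polynomial[OF loc \<open>H \<noteq> 0\<close>] by blast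
  have "f Q = poly q (Q i)" using q(2)[of "Q i"] by simp
  also have "\<dots> = (\<Sum>j\<le>N. poly (L j) (Q i) * poly q (node j))" by (rule L) (use q G in simp)
  finally show ?thesis by (simp only: q(2))
qed

text \<open>The formula of the generic case extends to all of the cover by continuity along a line: one joins
  \<open>Q\<close> to a base point at which the denominator is nonzero. For all but finitely many points of
  this line the generic case applies.\<close>

lemma regular_interpolation:
  assumes n: "n \<ge> 2" and f: "regular_on n (cover n) f"
  obtains N L where "\<And>i Q. i \<in> {1..n + 1} \<Longrightarrow> Q \<in> cover n \<Longrightarrow>
      f Q = (\<Sum>j\<le>N. poly (L j) (Q i) * f (Q(i := node j)))"
proof -
  define p where "p = (\<lambda>i. if i \<in> {1..n + 1} then 1 else 0 :: complex)"
  have "p \<in> cover n" using n by (auto simp: cover_def p_def intro!: bexI[of _ 1])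
  then obtain g h where g: "polynomial_fun n g" and h: "polynomial_fun n h" "h p \<noteq> 0"
    and gh: "\<And>Q. Q \<in> cover n \<Longrightarrow> h Q \<noteq> 0 \<Longrightarrow> f Q = g Q / h Q"
    using f unfolding regular_on_def by blast
  obtain N where N: "\<And>C. (\<And>i. degree (C i) \<le> 1) \<Longrightarrow> \<exists>P. degree P \<le> N \<and> (\<forall>s. g (\<lambda>i. poly (C i) s) = poly P s)"
    by (rule polynomial_fun_line[OF g]) blast
  obtain N' where N': "\<And>C. (\<And>i. degree (C i) \<le> 1) \<Longrightarrow> \<exists>P. degree P \<le> N' \<and> (\<forall>s. h (\<lambda>i. poly (C i) s) = poly P s)"
    by (rule polynomial_fun_line[OF h(1)]) blast
  obtain L where L: "\<And>q z. degree q \<le> N \<Longrightarrow> poly q z = (\<Sum>j\<le>N. poly (L j) z * poly q (node j))"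
    by (rule lagrange_basis[OF inj_node, of N]) blast
  have "f Q = (\<Sum>j\<le>N. poly (L j) (Q i) * f (Q(i := node j)))" if i: "i \<in> {1..n + 1}" and Q: "Q \<in> cover n" for i Q
  proof -
    \<comment> \<open>The line from \<open>Q\<close> at parameter 0 to the base point \<open>p\<close> at parameter 1.\<close>
    define C where "C = (\<lambda>k. [:Q k, p k - Q k:])"
    have deg: "degree (C k) \<le> 1" for k by (simp add: C_def)
    have C0: "C k = 0" if "k \<notin> {1..n + 1}" for k using that Q by (simp add: C_def p_def cover_def)
    have l0: "line C 0 = Q" and l1: "line C 1 = p" by (auto simp: line_def C_def)
    define D where "D j = C(i := [:node j:])" for j
    have degD: "degree (D j k) \<le> 1" for j k using deg by (simp add: D_def)
    have D0: "D j k = 0" if "k \<notin> {1..n + 1}" for j k using that i C0 by (auto simp: D_def)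
    have lD: "line (D j) s = (line C s)(i := node j)" for j s by (auto simp: line_def D_def)
    \<comment> \<open>A coordinate among the first \<open>n\<close> other than \<open>i\<close>, available as \<open>n \<ge> 2\<close>: while it is nonzero,
      the \<open>i\<close>-th coordinate may vary freely within the cover.\<close>
    define k :: nat where "k = (if i = 1 then 2 else 1)"
    have k: "k \<in> {1..n}" "k \<noteq> i" using n by (auto simp: k_def)
    obtain H where H: "\<And>s. h (line C s) = poly H s" using N'[of C, OF deg] unfolding line_def by blast
    have "poly H 1 \<noteq> 0" using H[of 1] l1 h(2) by simp
    then have "H \<noteq> 0" by auto
    have "poly (C k) 1 \<noteq> 0" using k by (simp add: C_def p_def)
    then have "C k \<noteq> 0" by auto
    have ev: "\<forall>\<^sub>F s in at 0. f (line C s) = (\<Sum>j\<le>N. poly (L j) (line C s i) * f (line (D j) s))"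
      using eventually_poly_nonzero[OF \<open>H \<noteq> 0\<close>, of 0] eventually_poly_nonzero[OF \<open>C k \<noteq> 0\<close>, of 0]
    proof eventually_elim
      case (elim s)
      have "(line C s)(i := z) \<in> cover n" for z
        using k elim(2) i C0 by (auto simp: cover_def line_def intro!: bexI[of _ k])
      then show ?case unfolding lD
        using elim(1) H by (intro regular_interpolation_generic[OF f h(1) gh N L]) simp_all
    qed
    have cov: "line C 0 \<in> cover n" "\<And>j. line (D j) 0 \<in> cover n"
      using Q i l0 by (simp_all add: lD cover_update del: of_nat_Suc)
    have lim1: "((\<lambda>s. f (line C s)) \<longlongrightarrow> f (line C 0)) (at 0)"
      by (rule regular_on_continuous_line[OF f deg C0 cov(1)])
    have lim2: "((\<lambda>s. \<Sum>j\<le>N. poly (L j) (line C s i) * f (line (D j) s)) \<longlongrightarrow>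
        (\<Sum>j\<le>N. poly (L j) (line C 0 i) * f (line (D j) 0))) (at 0)"
    proof (intro tendsto_sum tendsto_mult)
      fix j
      show "((\<lambda>s. f (line (D j) s)) \<longlongrightarrow> f (line (D j) 0)) (at 0)"
        by (rule regular_on_continuous_line[OF f degD D0 cov(2)])
      show "((\<lambda>s. poly (L j) (line C s i)) \<longlongrightarrow> poly (L j) (line C 0 i)) (at 0)"
        unfolding line_def by (intro tendsto_intros)
    qed
    have "((\<lambda>s. f (line C s)) \<longlongrightarrow> (\<Sum>j\<le>N. poly (L j) (line C 0 i) * f (line (D j) 0))) (at 0)"
      using lim2 by (rule Lim_transform_eventually) (use ev in \<open>auto elim: eventually_mono\<close>)
    then have "f (line C 0) = (\<Sum>j\<le>N. poly (L j) (line C 0 i) * f (line (D j) 0))"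
      by (rule tendsto_unique[OF _ lim1, rotated]) simp
    then show ?thesis by (simp only: lD l0)
  qed
  then show ?thesis using that by blast
qed

text \<open>Interpolating in one variable after the other reduces to constants, the values on the grid of
  nodes.\<close>

lemma interpolation_polynomial:
  assumes "finite S" "S \<subseteq> {1..n + 1}"
    and "\<And>i Q. i \<in> S \<Longrightarrow> F Q = (\<Sum>j\<le>N. poly (L j) (Q i) * F (Q(i := node j)))"
    and "\<And>Q Q'. (\<And>i. i \<in> S \<Longrightarrow> Q i = Q' i) \<Longrightarrow> F Q = F Q'"
  shows "polynomial_fun n F"
  using assms
proof (induction S arbitrary: F rule: finite_induct)
  case empty
  have "F Q = F (\<lambda>_. 0)" for Q by (rule empty(3)) simp
  then have "F = (\<lambda>Q. F (\<lambda>_. 0))" by blast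
  then show ?case using polynomial_fun_const[of n "F (\<lambda>_. 0)"] by simp
next
  case (insert i S)
  have sub: "polynomial_fun n (\<lambda>Q. F (Q(i := node j)))" for j
  proof (rule insert.IH)
    show "S \<subseteq> {1..n + 1}" using insert.prems(1) by simp
    show "F (Q(i := node j)) = (\<Sum>j'\<le>N. poly (L j') (Q k) * F (Q(k := node j', i := node j)))" if k: "k \<in> S" for k Q
    proof -
      have ki: "k \<noteq> i" using k insert.hyps by auto
      have "F (Q(i := node j)) = (\<Sum>j'\<le>N. poly (L j') ((Q(i := node j)) k) * F (Q(i := node j, k := node j')))"
        by (rule insert.prems(2)) (use k in simp)
      moreover have "Q(i := a, k := b) = Q(k := b, i := a)" for a b by (rule fun_upd_twist[OF ki[symmetric]])
      ultimately show ?thesis using ki by simp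
    qed
    show "F (Q(i := node j)) = F (Q'(i := node j))" if "\<And>k. k \<in> S \<Longrightarrow> Q k = Q' k" for Q Q'
      by (rule insert.prems(3)) (use that in auto)
  qed
  have "F = (\<lambda>Q. \<Sum>j\<le>N. poly (L j) (Q i) * F (Q(i := node j)))"
    by (rule ext) (rule insert.prems(2), simp)
  moreover have "polynomial_fun n (\<lambda>Q. \<Sum>j\<le>N. poly (L j) (Q i) * F (Q(i := node j)))"
    using insert.prems(1) by (intro polynomial_fun_sum polynomial_fun_mult polynomial_fun_poly sub) auto
  ultimately show ?case by simp
qed

theorem regular_polynomial:
  assumes n: "n \<ge> 2" and f: "regular_on n (cover n) f"
  obtains g where "polynomial_fun n g" "\<And>Q. Q \<in> cover n \<Longrightarrow> f Q = g Q"
proof -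
  obtain N L where NL: "\<And>i Q. i \<in> {1..n + 1} \<Longrightarrow> Q \<in> cover n \<Longrightarrow>
      f Q = (\<Sum>j\<le>N. poly (L j) (Q i) * f (Q(i := node j)))"
    by (rule regular_interpolation[OF n f]) blast
  \<comment> \<open>After the first coordinate has been set to a node, all points are in the cover, so the
    interpolation in the other coordinates holds without restrictions.\<close>
  let ?r = "\<lambda>j Q i. if i = 1 then node j else if i \<in> {2..n + 1} then Q i else 0"
  have cov: "?r j Q \<in> cover n" for j Q
    using n node_nonzero[of j] by (auto simp: cover_def intro!: bexI[of _ 1] simp del: of_nat_Suc)
  have sub: "polynomial_fun n (\<lambda>Q. f (?r j Q))" for j
  proof (rule interpolation_polynomial[of "{2..n + 1}"])
    fix i Q assume i: "i \<in> {2..n + 1}"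
    have upd: "(?r j Q)(i := node k) = ?r j (Q(i := node k))" for k using i by auto
    have "f (?r j Q) = (\<Sum>k\<le>N. poly (L k) (?r j Q i) * f ((?r j Q)(i := node k)))"
      by (rule NL[OF _ cov]) (use i in auto)
    then show "f (?r j Q) = (\<Sum>k\<le>N. poly (L k) (Q i) * f (?r j (Q(i := node k))))"
      unfolding upd using i by simp
  next
    fix Q Q' :: "nat \<Rightarrow> complex" assume "\<And>i. i \<in> {2..n + 1} \<Longrightarrow> Q i = Q' i"
    then have "?r j Q = ?r j Q'" by (intro ext) auto
    then show "f (?r j Q) = f (?r j Q')" by simp
  qed auto
  let ?g = "\<lambda>Q. \<Sum>j\<le>N. poly (L j) (Q 1) * f (?r j Q)"
  have "polynomial_fun n ?g"
    by (intro polynomial_fun_sum polynomial_fun_mult polynomial_fun_poly sub) auto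
  moreover have "f Q = ?g Q" if Q: "Q \<in> cover n" for Q
  proof -
    have "Q(1 := node j) = ?r j Q" for j using Q by (auto simp: cover_def)
    then show ?thesis using NL[of 1 Q] Q by simp
  qed
  ultimately show ?thesis using that by blast
qed

section \<open>The oscillator representation on coefficients\<close>

text \<open>A polynomial in \<open>n\<close> variables is encoded by its coefficient function. The exponents admitted
  for \<open>k\<close> are those whose total degree has the parity of \<open>k\<close>.\<close>

definition exponents :: "nat \<Rightarrow> nat \<Rightarrow> (nat \<Rightarrow> nat) set" where
  "exponents n k = {\<alpha>. (\<forall>i. i \<notin> {1..n} \<longrightarrow> \<alpha> i = 0) \<and> even ((\<Sum>i = 1..n. \<alpha> i) + k)}"

definition coeffs :: "nat \<Rightarrow> nat \<Rightarrow> ((nat \<Rightarrow> nat) \<Rightarrow> complex) set" where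
  "coeffs n k = {c. finite {\<alpha>. c \<alpha> \<noteq> 0} \<and> {\<alpha>. c \<alpha> \<noteq> 0} \<subseteq> exponents n k}"

definition single :: "(nat \<Rightarrow> nat) \<Rightarrow> (nat \<Rightarrow> nat) \<Rightarrow> complex" where
  "single \<alpha> = (\<lambda>\<beta>. if \<beta> = \<alpha> then 1 else 0)"

lemma coeffs_zero: "(\<lambda>\<beta>. 0) \<in> coeffs n k"
  by (simp add: coeffs_def)

lemma coeffs_add:
  assumes "c \<in> coeffs n k" "d \<in> coeffs n k" shows "(\<lambda>\<beta>. c \<beta> + d \<beta>) \<in> coeffs n k"
proof -
  have sub: "{\<beta>. c \<beta> + d \<beta> \<noteq> 0} \<subseteq> {\<beta>. c \<beta> \<noteq> 0} \<union> {\<beta>. d \<beta> \<noteq> 0}" by auto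
  have "finite ({\<beta>. c \<beta> \<noteq> 0} \<union> {\<beta>. d \<beta> \<noteq> 0})" using assms by (simp add: coeffs_def)
  with sub have "finite {\<beta>. c \<beta> + d \<beta> \<noteq> 0}" by (rule finite_subset)
  moreover have "{\<beta>. c \<beta> \<noteq> 0} \<union> {\<beta>. d \<beta> \<noteq> 0} \<subseteq> exponents n k" using assms by (simp add: coeffs_def)
  ultimately show ?thesis using sub unfolding coeffs_def by blast
qed

lemma coeffs_smult:
  assumes "c \<in> coeffs n k" shows "(\<lambda>\<beta>. a * c \<beta>) \<in> coeffs n k"
proof (cases "a = 0")
  case True then show ?thesis using coeffs_zero by simp
next
  case False then show ?thesis using assms by (simp add: coeffs_def)
qed

lemma coeffs_sum:
  "finite I \<Longrightarrow> (\<And>x. x \<in> I \<Longrightarrow> c x \<in> coeffs n k) \<Longrightarrow> (\<lambda>\<beta>. \<Sum>x\<in>I. a x * c x \<beta>) \<in> coeffs n k"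
  by (induction I rule: finite_induct) (simp_all add: coeffs_zero coeffs_add coeffs_smult)

lemma single_coeffs: "\<alpha> \<in> exponents n k \<Longrightarrow> single \<alpha> \<in> coeffs n k"
  by (auto simp: coeffs_def single_def)

lemma coeffs_Suc_Suc: "coeffs n (Suc (Suc k)) = coeffs n k"
  by (simp add: coeffs_def exponents_def)

lemma coeffs_expand:
  assumes "c \<in> coeffs n k"
  shows "c = (\<lambda>\<beta>. \<Sum>\<alpha>\<in>{\<alpha>. c \<alpha> \<noteq> 0}. c \<alpha> * single \<alpha> \<beta>)"
proof
  fix \<beta>
  have "finite {\<alpha>. c \<alpha> \<noteq> 0}" using assms by (simp add: coeffs_def)
  moreover have "(\<Sum>\<alpha>\<in>{\<alpha>. c \<alpha> \<noteq> 0}. c \<alpha> * single \<alpha> \<beta>) = (\<Sum>\<alpha>\<in>{\<alpha>. c \<alpha> \<noteq> 0}. if \<alpha> = \<beta> then c \<beta> else 0)"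
    by (rule sum.cong) (auto simp: single_def)
  ultimately show "c \<beta> = (\<Sum>\<alpha>\<in>{\<alpha>. c \<alpha> \<noteq> 0}. c \<alpha> * single \<alpha> \<beta>)" by simp
qed

lemma coeffs_induct [consumes 1, case_names zero add single]:
  assumes c: "c \<in> coeffs n k" and zero: "P (\<lambda>\<beta>. 0)"
    and add: "\<And>c d. c \<in> coeffs n k \<Longrightarrow> d \<in> coeffs n k \<Longrightarrow> P c \<Longrightarrow> P d \<Longrightarrow> P (\<lambda>\<beta>. c \<beta> + d \<beta>)"
    and single: "\<And>a \<alpha>. \<alpha> \<in> exponents n k \<Longrightarrow> P (\<lambda>\<beta>. a * single \<alpha> \<beta>)"
  shows "P c"
proof -
  have "(\<lambda>\<beta>. \<Sum>\<alpha>\<in>A. c \<alpha> * single \<alpha> \<beta>) \<in> coeffs n k \<and> P (\<lambda>\<beta>. \<Sum>\<alpha>\<in>A. c \<alpha> * single \<alpha> \<beta>)"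
    if "finite A" "A \<subseteq> exponents n k" for A
    using that
  proof (induction A rule: finite_induct)
    case empty then show ?case using zero coeffs_zero by simp
  next
    case (insert \<alpha> A)
    then have "(\<lambda>\<beta>. c \<alpha> * single \<alpha> \<beta>) \<in> coeffs n k" "P (\<lambda>\<beta>. c \<alpha> * single \<alpha> \<beta>)"
      using single by (auto intro: coeffs_smult single_coeffs)
    then show ?case using insert add coeffs_add by simp
  qed
  moreover have "finite {\<alpha>. c \<alpha> \<noteq> 0}" "{\<alpha>. c \<alpha> \<noteq> 0} \<subseteq> exponents n k" using c by (simp_all add: coeffs_def)
  ultimately have "P (\<lambda>\<beta>. \<Sum>\<alpha>\<in>{\<alpha>. c \<alpha> \<noteq> 0}. c \<alpha> * single \<alpha> \<beta>)" by blast
  then show ?thesis by (simp only: coeffs_expand[OF c, symmetric])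
qed

subsection \<open>Multiplication by coordinates and partial derivatives\<close>

definition mul_op :: "nat \<Rightarrow> ((nat \<Rightarrow> nat) \<Rightarrow> complex) \<Rightarrow> (nat \<Rightarrow> nat) \<Rightarrow> complex" where
  "mul_op i c \<alpha> = (if \<alpha> i = 0 then 0 else c (\<alpha>(i := \<alpha> i - 1)))"

definition der_op :: "nat \<Rightarrow> ((nat \<Rightarrow> nat) \<Rightarrow> complex) \<Rightarrow> (nat \<Rightarrow> nat) \<Rightarrow> complex" where
  "der_op i c \<alpha> = of_nat (\<alpha> i + 1) * c (\<alpha>(i := \<alpha> i + 1))"

lemma der_mul_commute: "der_op i (mul_op j c) \<alpha> = mul_op j (der_op i c) \<alpha> + (if i = j then c \<alpha> else 0)"
proof (cases "i = j")
  case True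
  then show ?thesis by (cases "\<alpha> j") (auto simp: mul_op_def der_op_def algebra_simps fun_upd_idem)
next
  case False
  then show ?thesis by (simp add: mul_op_def der_op_def fun_upd_twist[OF False])
qed

lemma der_der_commute: "der_op i (der_op j c) \<alpha> = der_op j (der_op i c) \<alpha>"
proof (cases "i = j")
  case False then show ?thesis by (simp add: der_op_def fun_upd_twist[OF False])
qed simp

lemma mul_mul_commute: "mul_op i (mul_op j c) \<alpha> = mul_op j (mul_op i c) \<alpha>"
proof (cases "i = j")
  case False then show ?thesis by (simp add: mul_op_def fun_upd_twist[OF False])
qed simp

lemma exponents_update:
  assumes \<alpha>: "\<alpha> \<in> exponents n k" and i: "i \<in> {1..n}" and m: "even (m + \<alpha> i + j)"
  shows "\<alpha>(i := m) \<in> exponents n (k + j)"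
proof -
  let ?r = "\<Sum>x\<in>{1..n} - {i}. \<alpha> x"
  have 1: "(\<Sum>x = 1..n. (\<alpha>(i := m)) x) = m + ?r"
  proof -
    have "(\<Sum>x = 1..n. (\<alpha>(i := m)) x) = (\<alpha>(i := m)) i + (\<Sum>x\<in>{1..n} - {i}. (\<alpha>(i := m)) x)"
      by (rule sum.remove[OF _ i]) simp
    also have "(\<Sum>x\<in>{1..n} - {i}. (\<alpha>(i := m)) x) = ?r" by (rule sum.cong) auto
    finally show ?thesis by simp
  qed
  have "(\<Sum>x = 1..n. \<alpha> x) = \<alpha> i + ?r" by (rule sum.remove[OF _ i]) simp
  then have "even (\<alpha> i + ?r + k)" using \<alpha> by (simp add: exponents_def)
  with m have "even (m + ?r + (k + j))" by presburger
  moreover have "(\<alpha>(i := m)) x = 0" if "x \<notin> {1..n}" for x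
    using that \<alpha> i by (auto simp: exponents_def)
  ultimately show ?thesis unfolding exponents_def mem_Collect_eq 1 by blast
qed

lemma mul_op_coeffs:
  assumes c: "c \<in> coeffs n k" and i: "i \<in> {1..n}" shows "mul_op i c \<in> coeffs n (Suc k)"
proof -
  have *: "\<alpha> i \<noteq> 0 \<and> c (\<alpha>(i := \<alpha> i - 1)) \<noteq> 0" if "mul_op i c \<alpha> \<noteq> 0" for \<alpha>
    using that by (simp add: mul_op_def split: if_splits)
  have img: "\<alpha> = (\<lambda>\<beta>. \<beta>(i := \<beta> i + 1)) (\<alpha>(i := \<alpha> i - 1))" if "\<alpha> i \<noteq> 0" for \<alpha> :: "nat \<Rightarrow> nat"
    using that by auto
  have "{\<alpha>. mul_op i c \<alpha> \<noteq> 0} \<subseteq> (\<lambda>\<beta>. \<beta>(i := \<beta> i + 1)) ` {\<alpha>. c \<alpha> \<noteq> 0}"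
  proof
    fix \<alpha> assume "\<alpha> \<in> {\<alpha>. mul_op i c \<alpha> \<noteq> 0}"
    then show "\<alpha> \<in> (\<lambda>\<beta>. \<beta>(i := \<beta> i + 1)) ` {\<alpha>. c \<alpha> \<noteq> 0}"
      using *[of \<alpha>] by (intro image_eqI[of _ _ "\<alpha>(i := \<alpha> i - 1)"] img) simp_all
  qed
  moreover have "finite {\<alpha>. c \<alpha> \<noteq> 0}" using c by (simp add: coeffs_def)
  ultimately have "finite {\<alpha>. mul_op i c \<alpha> \<noteq> 0}" using finite_subset[OF _ finite_imageI] by blast
  moreover have "\<alpha> \<in> exponents n (Suc k)" if "mul_op i c \<alpha> \<noteq> 0" for \<alpha>
  proof -
    have "\<alpha>(i := \<alpha> i - 1) \<in> exponents n k" using *[OF that] c by (auto simp: coeffs_def)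
    from exponents_update[OF this i, of "\<alpha> i" 1] show ?thesis using *[OF that] by simp
  qed
  ultimately show ?thesis by (auto simp: coeffs_def)
qed

lemma der_op_coeffs:
  assumes c: "c \<in> coeffs n k" and i: "i \<in> {1..n}" shows "der_op i c \<in> coeffs n (Suc k)"
proof -
  have *: "c (\<alpha>(i := \<alpha> i + 1)) \<noteq> 0" if "der_op i c \<alpha> \<noteq> 0" for \<alpha>
    using that by (simp add: der_op_def)
  have img: "\<alpha> = (\<lambda>\<beta>. \<beta>(i := \<beta> i - 1)) (\<alpha>(i := \<alpha> i + 1))" for \<alpha> :: "nat \<Rightarrow> nat"
    by auto
  have "{\<alpha>. der_op i c \<alpha> \<noteq> 0} \<subseteq> (\<lambda>\<beta>. \<beta>(i := \<beta> i - 1)) ` {\<alpha>. c \<alpha> \<noteq> 0}"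
  proof
    fix \<alpha> assume "\<alpha> \<in> {\<alpha>. der_op i c \<alpha> \<noteq> 0}"
    then show "\<alpha> \<in> (\<lambda>\<beta>. \<beta>(i := \<beta> i - 1)) ` {\<alpha>. c \<alpha> \<noteq> 0}"
      using *[of \<alpha>] by (intro image_eqI[of _ _ "\<alpha>(i := \<alpha> i + 1)"] img) simp
  qed
  moreover have "finite {\<alpha>. c \<alpha> \<noteq> 0}" using c by (simp add: coeffs_def)
  ultimately have "finite {\<alpha>. der_op i c \<alpha> \<noteq> 0}" using finite_subset[OF _ finite_imageI] by blast
  moreover have "\<alpha> \<in> exponents n (Suc k)" if "der_op i c \<alpha> \<noteq> 0" for \<alpha>
  proof -
    have "\<alpha>(i := \<alpha> i + 1) \<in> exponents n k" using *[OF that] c by (auto simp: coeffs_def)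
    from exponents_update[OF this i, of "\<alpha> i" 1] show ?thesis by simp
  qed
  ultimately show ?thesis by (auto simp: coeffs_def)
qed

subsection \<open>Quadratic operators\<close>

text \<open>Linearity is stated pointwise, the form in which it rewrites values of composed operators.\<close>

definition linop :: "(((nat \<Rightarrow> nat) \<Rightarrow> complex) \<Rightarrow> (nat \<Rightarrow> nat) \<Rightarrow> complex) \<Rightarrow> bool" where
  "linop T \<longleftrightarrow> (\<forall>c d \<beta>. T (\<lambda>\<gamma>. c \<gamma> + d \<gamma>) \<beta> = T c \<beta> + T d \<beta>) \<and> (\<forall>k c \<beta>. T (\<lambda>\<gamma>. k * c \<gamma>) \<beta> = k * T c \<beta>)"

lemma linop_add: "linop T \<Longrightarrow> T (\<lambda>\<gamma>. c \<gamma> + d \<gamma>) \<beta> = T c \<beta> + T d \<beta>"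
  and linop_smult: "linop T \<Longrightarrow> T (\<lambda>\<gamma>. k * c \<gamma>) \<beta> = k * T c \<beta>"
  by (simp_all add: linop_def)

lemma linop_sum:
  assumes "linop T" "finite I"
  shows "T (\<lambda>\<gamma>. \<Sum>x\<in>I. k x * c x \<gamma>) \<beta> = (\<Sum>x\<in>I. k x * T (c x) \<beta>)"
  using assms(2)
proof (induction I rule: finite_induct)
  case empty
  then show ?case using linop_smult[OF assms(1), of 0 "\<lambda>_. 0" \<beta>] by simp
next
  case (insert x I)
  then show ?case by (simp add: linop_add[OF assms(1)] linop_smult[OF assms(1)])
qed

lemma linop_diff: "linop T \<Longrightarrow> T (\<lambda>\<gamma>. c \<gamma> - d \<gamma>) \<beta> = T c \<beta> - T d \<beta>"
  using linop_add[of T c "\<lambda>\<gamma>. (-1) * d \<gamma>" \<beta>] linop_smult[of T "-1" d \<beta>] by simp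

lemma linop_mul: "linop (mul_op i)" and linop_der: "linop (der_op i)"
  by (simp_all add: linop_def mul_op_def der_op_def algebra_simps)

text \<open>The operators \<open>z\<^sub>b\<close>, for \<open>b < 2n\<close>, are \<open>Q\<^sub>1, \<dots>, Q\<^sub>n, -\<partial>\<^sub>1, \<dots>, -\<partial>\<^sub>n\<close>, and the \<open>y\<^sub>a\<close>
  below are \<open>-\<partial>\<^sub>1, \<dots>, -\<partial>\<^sub>n, -Q\<^sub>1, \<dots>, -Q\<^sub>n\<close>. The two families span the same space and are
  dual to each other for the commutator: \<open>[z\<^sub>b, y\<^sub>a]\<close> is 1 if \<open>a = b\<close> and 0 otherwise.\<close>

definition z_op :: "nat \<Rightarrow> nat \<Rightarrow> ((nat \<Rightarrow> nat) \<Rightarrow> complex) \<Rightarrow> (nat \<Rightarrow> nat) \<Rightarrow> complex" where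
  "z_op n b c = (if b < n then mul_op (b + 1) c else (\<lambda>\<beta>. - der_op (b - n + 1) c \<beta>))"

definition y_op :: "nat \<Rightarrow> nat \<Rightarrow> ((nat \<Rightarrow> nat) \<Rightarrow> complex) \<Rightarrow> (nat \<Rightarrow> nat) \<Rightarrow> complex" where
  "y_op n a c = (if a < n then (\<lambda>\<beta>. - der_op (a + 1) c \<beta>) else (\<lambda>\<beta>. - mul_op (a - n + 1) c \<beta>))"

lemma linop_z: "linop (z_op n b)" and linop_y: "linop (y_op n a)"
  using linop_mul linop_der by (simp_all add: linop_def z_op_def y_op_def)

lemma mul_neg: "mul_op i (\<lambda>\<beta>. - c \<beta>) \<alpha> = - mul_op i c \<alpha>" and der_neg: "der_op i (\<lambda>\<beta>. - c \<beta>) \<alpha> = - der_op i c \<alpha>"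
  by (simp_all add: mul_op_def der_op_def)

lemma z_y_commute:
  assumes "a < 2 * n" "b < 2 * n"
  shows "z_op n b (y_op n a c) \<beta> = y_op n a (z_op n b c) \<beta> + (if a = b then c \<beta> else 0)"
proof -
  consider "a < n" "b < n" | "a < n" "\<not> b < n" | "\<not> a < n" "b < n" | "\<not> a < n" "\<not> b < n" by blast
  then show ?thesis
  proof cases
    case 1
    then show ?thesis by (simp add: z_op_def y_op_def mul_neg der_mul_commute)
  next
    case 2
    then have "a \<noteq> b" by auto
    then show ?thesis using 2 der_der_commute[of "Suc (b - n)" "Suc a" c \<beta>]
      by (simp add: z_op_def y_op_def der_neg)
  next
    case 3
    then have "a \<noteq> b" by auto
    then show ?thesis using 3 mul_mul_commute[of "Suc b" "Suc (a - n)" c \<beta>]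
      by (simp add: z_op_def y_op_def mul_neg)
  next
    case 4
    then have "b - n = a - n \<longleftrightarrow> a = b" by auto
    then show ?thesis using 4 by (simp add: z_op_def y_op_def mul_neg der_neg der_mul_commute)
  qed
qed

lemma y_eq_z: "a < n \<Longrightarrow> y_op n a c = z_op n (n + a) c" "a < n \<Longrightarrow> y_op n (n + a) c = (\<lambda>\<beta>. - z_op n a c \<beta>)"
  by (simp_all add: z_op_def y_op_def)

text \<open>The commutator of \<open>z\<^sub>b\<close> and \<open>z\<^sub>c\<close>, which is the entry of the symplectic form.\<close>

definition z_form :: "nat \<Rightarrow> nat \<Rightarrow> nat \<Rightarrow> complex" where
  "z_form n b c = (if c = b + n then 1 else if b = c + n then -1 else 0)"

lemma z_z_commute:
  assumes "b < 2 * n" "c < 2 * n"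
  shows "z_op n b (z_op n c f) \<beta> = z_op n c (z_op n b f) \<beta> + z_form n b c * f \<beta>"
proof -
  consider "b < n" "c < n" | "b < n" "\<not> c < n" | "\<not> b < n" "c < n" | "\<not> b < n" "\<not> c < n" by blast
  then show ?thesis
  proof cases
    case 1
    then show ?thesis using mul_mul_commute[of "Suc b" "Suc c" f \<beta>] by (simp add: z_op_def z_form_def)
  next
    case 2
    then have "c = b + n \<longleftrightarrow> b = c - n" "\<not> b = c + n" by auto
    then show ?thesis using 2 by (auto simp: z_op_def z_form_def mul_neg der_mul_commute)
  next
    case 3
    then have "b = c + n \<longleftrightarrow> b - n = c" "\<not> c = b + n" by auto
    then show ?thesis using 3 by (auto simp: z_op_def z_form_def mul_neg der_mul_commute)
  next
    case 4
    then have "\<not> c = b + n" "\<not> b = c + n" using assms by auto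
    then show ?thesis using 4 der_der_commute[of "Suc (b - n)" "Suc (c - n)" f \<beta>]
      by (simp add: z_op_def z_form_def der_neg)
  qed
qed

lemma sum_lessThan_double: "(\<Sum>k<2*(n::nat). f k) = (\<Sum>k<n. f k) + (\<Sum>k<n. f (n + k) :: complex)"
proof -
  have "(\<Sum>k<2*n. f k) = (\<Sum>k<n. f k) + (\<Sum>k=n..<2*n. f k)"
    by (simp add: lessThan_atLeast0 sum.atLeastLessThan_concat)
  also have "(\<Sum>k=n..<2*n. f k) = (\<Sum>k<n. f (n + k))"
    using sum.shift_bounds_nat_ivl[of f 0 n n] by (simp add: mult_2 lessThan_atLeast0 add.commute)
  finally show ?thesis .
qed

text \<open>The factor one half compensates for the two ways of writing each quadratic expression, as
  \<open>y\<^sub>a z\<^sub>b\<close> and, with the families exchanged, as \<open>z\<^sub>b y\<^sub>a\<close>.\<close>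

definition osc :: "nat \<Rightarrow> complex mat \<Rightarrow> ((nat \<Rightarrow> nat) \<Rightarrow> complex) \<Rightarrow> (nat \<Rightarrow> nat) \<Rightarrow> complex" where
  "osc n X c \<beta> = (\<Sum>t\<in>{..<2*n} \<times> {..<2*n}. (X $$ t / 2) * y_op n (fst t) (z_op n (snd t) c) \<beta>)"

lemma linop_osc: "linop (osc n X)"
proof -
  have "y_op n a (z_op n b (\<lambda>\<gamma>. c \<gamma> + d \<gamma>)) \<beta> = y_op n a (z_op n b c) \<beta> + y_op n a (z_op n b d) \<beta>" for a b c d \<beta>
  proof -
    have "z_op n b (\<lambda>\<gamma>. c \<gamma> + d \<gamma>) = (\<lambda>\<gamma>. z_op n b c \<gamma> + z_op n b d \<gamma>)" using linop_add[OF linop_z] by blast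
    then show ?thesis by (simp add: linop_add[OF linop_y])
  qed
  moreover have "y_op n a (z_op n b (\<lambda>\<gamma>. k * c \<gamma>)) \<beta> = k * y_op n a (z_op n b c) \<beta>" for a b c k \<beta>
  proof -
    have "z_op n b (\<lambda>\<gamma>. k * c \<gamma>) = (\<lambda>\<gamma>. k * z_op n b c \<gamma>)" using linop_smult[OF linop_z] by blast
    then show ?thesis by (simp add: linop_smult[OF linop_y])
  qed
  ultimately show ?thesis
    by (simp add: linop_def osc_def sum.distrib distrib_left sum_distrib_left mult.left_commute)
qed

text \<open>Each \<open>z\<^sub>c\<close> fails to commute with \<open>y\<^sub>a\<close> for \<open>a = c\<close> and with \<open>z\<^sub>b\<close> for the partner \<open>b\<close> of \<open>c\<close>.
  Both terms contribute half of the right-hand side; for the second one this is where \<open>X\<close> has to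
  be symplectic.\<close>

lemma osc_commute_z:
  assumes X: "X \<in> sp n" and c: "c < 2 * n"
  shows "osc n X (z_op n c f) \<beta> = z_op n c (osc n X f) \<beta> - (\<Sum>b<2*n. X $$ (c, b) * z_op n b f \<beta>)"
proof -
  let ?I = "{..<2*n} \<times> {..<2*n}"
  have 1: "z_op n c (osc n X f) \<beta> = (\<Sum>t\<in>?I. (X $$ t / 2) * z_op n c (y_op n (fst t) (z_op n (snd t) f)) \<beta>)"
    unfolding osc_def by (rule linop_sum[OF linop_z]) simp
  have 2: "y_op n a (z_op n b (z_op n c f)) \<beta> - z_op n c (y_op n a (z_op n b f)) \<beta>
      = z_form n b c * y_op n a f \<beta> - (if a = c then z_op n b f \<beta> else 0)" if "a < 2 * n" "b < 2 * n" for a b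
  proof -
    have "z_op n b (z_op n c f) = (\<lambda>\<beta>. z_op n c (z_op n b f) \<beta> + z_form n b c * f \<beta>)"
      using z_z_commute[OF that(2) c] by blast
    then have "y_op n a (z_op n b (z_op n c f)) \<beta> = y_op n a (z_op n c (z_op n b f)) \<beta> + z_form n b c * y_op n a f \<beta>"
      by (simp add: linop_add[OF linop_y] linop_smult[OF linop_y])
    then show ?thesis using z_y_commute[OF that(1) c, of "z_op n b f" \<beta>] by simp
  qed
  have "osc n X (z_op n c f) \<beta> - z_op n c (osc n X f) \<beta> = (\<Sum>t\<in>?I. (X $$ t / 2) *
      (y_op n (fst t) (z_op n (snd t) (z_op n c f)) \<beta> - z_op n c (y_op n (fst t) (z_op n (snd t) f)) \<beta>))"
    unfolding 1 unfolding osc_def by (simp add: sum_subtractf right_diff_distrib)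
  also have "\<dots> = (\<Sum>t\<in>?I. (X $$ t / 2) * (z_form n (snd t) c * y_op n (fst t) f \<beta>
      - (if fst t = c then z_op n (snd t) f \<beta> else 0)))"
    by (rule sum.cong[OF refl]) (use 2 in auto)
  also have "\<dots> = (\<Sum>t\<in>?I. (X $$ t / 2) * (z_form n (snd t) c * y_op n (fst t) f \<beta>))
      - (\<Sum>t\<in>?I. (X $$ t / 2) * (if fst t = c then z_op n (snd t) f \<beta> else 0))"
    by (simp add: sum_subtractf right_diff_distrib)
  also have "(\<Sum>t\<in>?I. (X $$ t / 2) * (if fst t = c then z_op n (snd t) f \<beta> else 0))
      = (\<Sum>a<2*n. \<Sum>b<2*n. if a = c then X $$ (c, b) / 2 * z_op n b f \<beta> else 0)"
    unfolding sum.cartesian_product by (rule sum.cong) auto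
  also have "\<dots> = (\<Sum>b<2*n. X $$ (c, b) / 2 * z_op n b f \<beta>)"
    by (subst sum.swap) (use c in simp)
  also have "(\<Sum>t\<in>?I. (X $$ t / 2) * (z_form n (snd t) c * y_op n (fst t) f \<beta>))
      = (\<Sum>a<2*n. (\<Sum>b<2*n. X $$ (a, b) * z_form n b c) / 2 * y_op n a f \<beta>)"
    by (simp add: sum.cartesian_product' sum_distrib_left sum_distrib_right sum_divide_distrib algebra_simps)
  also have "\<dots> = - (\<Sum>b<2*n. X $$ (c, b) / 2 * z_op n b f \<beta>)"
  proof -
    have r: "X $$ (n + i, n + j) = - X $$ (j, i)" "X $$ (i, n + j) = X $$ (j, n + i)"
      "X $$ (n + i, j) = X $$ (n + j, i)" if "i < n" "j < n" for i j
      using X that unfolding sp_iff by auto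
    show ?thesis
    proof (cases "c < n")
      case True
      have "(\<Sum>b<2*n. X $$ (a, b) * z_form n b c) = - X $$ (a, n + c)" for a
      proof -
        have "(\<Sum>b<2*n. X $$ (a, b) * z_form n b c) = (\<Sum>b<2*n. if b = n + c then - X $$ (a, n + c) else 0)"
          using True by (intro sum.cong) (auto simp: z_form_def)
        then show ?thesis using True by simp
      qed
      then show ?thesis using True
        by (simp add: sum_lessThan_double y_eq_z r(1) r(2)[of _ c] sum_negf)
    next
      case False
      define d where "d = c - n"
      have d: "c = n + d" "d < n" using False c by (auto simp: d_def)
      have "(\<Sum>b<2*n. X $$ (a, b) * z_form n b c) = X $$ (a, d)" for a
      proof -
        have "(\<Sum>b<2*n. X $$ (a, b) * z_form n b c) = (\<Sum>b<2*n. if b = d then X $$ (a, d) else 0)"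
          using d by (intro sum.cong) (auto simp: z_form_def)
        then show ?thesis using d by simp
      qed
      then show ?thesis using d
        by (simp add: sum_lessThan_double y_eq_z r(1)[of d] r(3)[of d] sum_negf)
    qed
  qed
  finally show ?thesis by (simp add: sum_divide_distrib[symmetric] diff_eq_eq)
qed

text \<open>The \<open>y\<close> are the \<open>z\<close> up to sign and order, so this is the preceding lemma read with the partner
  index.\<close>

lemma osc_commute_y:
  assumes X: "X \<in> sp n" and c: "c < 2 * n"
  shows "osc n X (y_op n c f) \<beta> = y_op n c (osc n X f) \<beta> + (\<Sum>a<2*n. X $$ (a, c) * y_op n a f \<beta>)"
proof -
  have r: "X $$ (n + i, n + j) = - X $$ (j, i)" "X $$ (i, n + j) = X $$ (j, n + i)"
      "X $$ (n + i, j) = X $$ (n + j, i)" if "i < n" "j < n" for i j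
    using X that unfolding sp_iff by auto
  show ?thesis
  proof (cases "c < n")
    case True
    have "osc n X (y_op n c f) \<beta> = y_op n c (osc n X f) \<beta> - (\<Sum>b<2*n. X $$ (n + c, b) * z_op n b f \<beta>)"
      using osc_commute_z[OF X, of "n + c" f \<beta>] True by (simp add: y_eq_z)
    then show ?thesis using True by (simp add: sum_lessThan_double y_eq_z r(1)[of c] r(3)[of c] sum_negf)
  next
    case False
    define d where "d = c - n"
    have d: "c = n + d" "d < n" using False c by (auto simp: d_def)
    have "osc n X (y_op n c f) \<beta> = - osc n X (z_op n d f) \<beta>"
      using linop_smult[OF linop_osc, of n X "-1" "z_op n d f" \<beta>] d by (simp add: y_eq_z)
    also have "\<dots> = y_op n c (osc n X f) \<beta> + (\<Sum>b<2*n. X $$ (d, b) * z_op n b f \<beta>)"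
      using osc_commute_z[OF X, of d f \<beta>] d by (simp add: y_eq_z)
    finally show ?thesis using d by (simp add: sum_lessThan_double y_eq_z r(1) r(2)[of d] sum_negf)
  qed
qed

text \<open>The commutator with \<open>osc n X\<close> is a derivation, so on \<open>\<Sum> Y\<^sub>a\<^sub>b y\<^sub>a z\<^sub>b\<close> it replaces \<open>Y\<close> by
  \<open>X Y - Y X\<close>, one term coming from each factor.\<close>

lemma osc_bracket:
  assumes X: "X \<in> sp n" and Y: "Y \<in> sp n"
  shows "osc n (bracket X Y) f \<beta> = osc n X (osc n Y f) \<beta> - osc n Y (osc n X f) \<beta>"
proof -
  let ?I = "{..<2*n} \<times> {..<2*n}" and ?w = "\<lambda>a b. y_op n a (z_op n b f) \<beta>"
  have 1: "osc n X (y_op n a (z_op n b f)) \<beta> = y_op n a (z_op n b (osc n X f)) \<beta>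
      + (\<Sum>d<2*n. X $$ (d, a) * ?w d b) - (\<Sum>d<2*n. X $$ (b, d) * ?w a d)" if "a < 2 * n" "b < 2 * n" for a b
  proof -
    have "osc n X (z_op n b f) = (\<lambda>\<gamma>. z_op n b (osc n X f) \<gamma> - (\<Sum>d<2*n. X $$ (b, d) * z_op n d f \<gamma>))"
      using osc_commute_z[OF X that(2)] by blast
    then have "y_op n a (osc n X (z_op n b f)) \<beta> = y_op n a (z_op n b (osc n X f)) \<beta> - (\<Sum>d<2*n. X $$ (b, d) * ?w a d)"
      by (simp add: linop_diff[OF linop_y] linop_sum[OF linop_y])
    then show ?thesis using osc_commute_y[OF X that(1), of "z_op n b f" \<beta>] by simp
  qed
  have "osc n X (osc n Y f) \<beta> = (\<Sum>t\<in>?I. Y $$ t / 2 * osc n X (y_op n (fst t) (z_op n (snd t) f)) \<beta>)"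
    unfolding osc_def[of n Y] by (rule linop_sum[OF linop_osc]) simp
  also have "\<dots> = (\<Sum>t\<in>?I. Y $$ t / 2 * y_op n (fst t) (z_op n (snd t) (osc n X f)) \<beta>
      + (Y $$ t / 2 * (\<Sum>d<2*n. X $$ (d, fst t) * ?w d (snd t)) - Y $$ t / 2 * (\<Sum>d<2*n. X $$ (snd t, d) * ?w (fst t) d)))"
  proof (rule sum.cong[OF refl])
    fix t assume "t \<in> ?I"
    then have "fst t < 2 * n" "snd t < 2 * n" by auto
    note e = 1[OF this]
    show "Y $$ t / 2 * osc n X (y_op n (fst t) (z_op n (snd t) f)) \<beta> =
        Y $$ t / 2 * y_op n (fst t) (z_op n (snd t) (osc n X f)) \<beta>
        + (Y $$ t / 2 * (\<Sum>d<2*n. X $$ (d, fst t) * ?w d (snd t)) - Y $$ t / 2 * (\<Sum>d<2*n. X $$ (snd t, d) * ?w (fst t) d))"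
      unfolding e by (simp only: distrib_left right_diff_distrib add_diff_eq)
  qed
  also have "\<dots> = osc n Y (osc n X f) \<beta> +
      ((\<Sum>t\<in>?I. Y $$ t / 2 * (\<Sum>d<2*n. X $$ (d, fst t) * ?w d (snd t)))
      - (\<Sum>t\<in>?I. Y $$ t / 2 * (\<Sum>d<2*n. X $$ (snd t, d) * ?w (fst t) d)))"
    by (simp add: sum.distrib sum_subtractf osc_def)
  also have "(\<Sum>t\<in>?I. Y $$ t / 2 * (\<Sum>d<2*n. X $$ (d, fst t) * ?w d (snd t)))
      = (\<Sum>d<2*n. \<Sum>b<2*n. (\<Sum>a<2*n. X $$ (d, a) * Y $$ (a, b)) / 2 * ?w d b)"
  proof -
    have "(\<Sum>t\<in>?I. Y $$ t / 2 * (\<Sum>d<2*n. X $$ (d, fst t) * ?w d (snd t)))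
        = (\<Sum>a<2*n. \<Sum>b<2*n. \<Sum>d<2*n. X $$ (d, a) * Y $$ (a, b) / 2 * ?w d b)"
      by (simp add: sum.cartesian_product' sum_distrib_left mult_ac)
    also have "\<dots> = (\<Sum>a<2*n. \<Sum>d<2*n. \<Sum>b<2*n. X $$ (d, a) * Y $$ (a, b) / 2 * ?w d b)"
      by (rule sum.cong[OF refl]) (rule sum.swap)
    also have "\<dots> = (\<Sum>d<2*n. \<Sum>a<2*n. \<Sum>b<2*n. X $$ (d, a) * Y $$ (a, b) / 2 * ?w d b)"
      by (rule sum.swap)
    also have "\<dots> = (\<Sum>d<2*n. \<Sum>b<2*n. \<Sum>a<2*n. X $$ (d, a) * Y $$ (a, b) / 2 * ?w d b)"
      by (rule sum.cong[OF refl]) (rule sum.swap)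
    finally show ?thesis by (simp add: sum_distrib_right sum_divide_distrib)
  qed
  also have "(\<Sum>t\<in>?I. Y $$ t / 2 * (\<Sum>d<2*n. X $$ (snd t, d) * ?w (fst t) d))
      = (\<Sum>a<2*n. \<Sum>d<2*n. (\<Sum>b<2*n. Y $$ (a, b) * X $$ (b, d)) / 2 * ?w a d)"
  proof -
    have "(\<Sum>t\<in>?I. Y $$ t / 2 * (\<Sum>d<2*n. X $$ (snd t, d) * ?w (fst t) d))
        = (\<Sum>a<2*n. \<Sum>b<2*n. \<Sum>d<2*n. Y $$ (a, b) * X $$ (b, d) / 2 * ?w a d)"
      by (simp add: sum.cartesian_product' sum_distrib_left mult_ac)
    also have "\<dots> = (\<Sum>a<2*n. \<Sum>d<2*n. \<Sum>b<2*n. Y $$ (a, b) * X $$ (b, d) / 2 * ?w a d)"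
      by (rule sum.cong[OF refl]) (rule sum.swap)
    finally show ?thesis by (simp add: sum_distrib_right sum_divide_distrib)
  qed
  finally have "osc n X (osc n Y f) \<beta> - osc n Y (osc n X f) \<beta> =
      (\<Sum>a<2*n. \<Sum>b<2*n. ((\<Sum>k<2*n. X $$ (a, k) * Y $$ (k, b)) - (\<Sum>k<2*n. Y $$ (a, k) * X $$ (k, b))) / 2 * ?w a b)"
    by (simp add: sum_subtractf diff_divide_distrib left_diff_distrib)
  also have "\<dots> = (\<Sum>a<2*n. \<Sum>b<2*n. bracket X Y $$ (a, b) / 2 * ?w a b)"
    by (intro sum.cong refl) (simp add: bracket_index[OF sp_carrier[OF X] sp_carrier[OF Y]])
  also have "\<dots> = osc n (bracket X Y) f \<beta>"
    unfolding osc_def sum.cartesian_product by (rule sum.cong) auto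
  finally show ?thesis by simp
qed

lemma osc_add_mat:
  assumes "X \<in> carrier_mat (2 * n) (2 * n)" "Y \<in> carrier_mat (2 * n) (2 * n)"
  shows "osc n (X + Y) f \<beta> = osc n X f \<beta> + osc n Y f \<beta>"
    "osc n (X - Y) f \<beta> = osc n X f \<beta> - osc n Y f \<beta>"
    "osc n (a \<cdot>\<^sub>m X) f \<beta> = a * osc n X f \<beta>"
proof -
  have "osc n (X + Y) f \<beta> = (\<Sum>t\<in>{..<2*n} \<times> {..<2*n}. X $$ t / 2 * y_op n (fst t) (z_op n (snd t) f) \<beta>
      + Y $$ t / 2 * y_op n (fst t) (z_op n (snd t) f) \<beta>)"
    unfolding osc_def by (rule sum.cong) (use assms in \<open>auto simp: algebra_simps add_divide_distrib\<close>)
  then show "osc n (X + Y) f \<beta> = osc n X f \<beta> + osc n Y f \<beta>" by (simp add: osc_def sum.distrib)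
  have "osc n (X - Y) f \<beta> = (\<Sum>t\<in>{..<2*n} \<times> {..<2*n}. X $$ t / 2 * y_op n (fst t) (z_op n (snd t) f) \<beta>
      - Y $$ t / 2 * y_op n (fst t) (z_op n (snd t) f) \<beta>)"
    unfolding osc_def by (rule sum.cong) (use assms in \<open>auto simp: algebra_simps diff_divide_distrib\<close>)
  then show "osc n (X - Y) f \<beta> = osc n X f \<beta> - osc n Y f \<beta>" by (simp add: osc_def sum_subtractf)
  show "osc n (a \<cdot>\<^sub>m X) f \<beta> = a * osc n X f \<beta>"
    unfolding osc_def sum_distrib_left by (rule sum.cong) (use assms in auto)
qed

lemma osc_mat_unit:
  assumes "r < 2 * n" "s < 2 * n"
  shows "osc n (mat_unit n (Suc r) (Suc s)) f \<beta> = y_op n r (z_op n s f) \<beta> / 2"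
proof -
  have "osc n (mat_unit n (Suc r) (Suc s)) f \<beta> = (\<Sum>t\<in>{..<2*n} \<times> {..<2*n}.
      if t = (r, s) then y_op n r (z_op n s f) \<beta> / 2 else 0)"
    unfolding osc_def by (rule sum.cong) (auto split: if_splits)
  then show ?thesis using assms by simp
qed

text \<open>The symmetrized product of \<open>Q\<^sub>j\<close> and \<open>\<partial>\<^sub>i\<close> differs from the ordered one by a half if \<open>i = j\<close>.
  This is the source of the half-integral weights.\<close>

lemma osc_mat_abc:
  assumes "1 \<le> i" "i \<le> n" "1 \<le> j" "j \<le> n"
  shows "osc n (mat_a n i j) f \<beta> = - mul_op j (der_op i f) \<beta> - (if i = j then f \<beta> / 2 else 0)"
    "osc n (mat_b n i j) f \<beta> = der_op i (der_op j f) \<beta>"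
    "osc n (mat_c n i j) f \<beta> = - mul_op i (mul_op j f) \<beta>"
proof -
  define r s where "r = i - 1" and "s = j - 1"
  have rs: "i = Suc r" "j = Suc s" "r < n" "s < n" using assms by (simp_all add: r_def s_def)
  have u: "osc n (mat_unit n (Suc r) (Suc s)) f \<beta> = y_op n r (z_op n s f) \<beta> / 2"
    "osc n (mat_unit n (Suc (n + s)) (Suc (n + r))) f \<beta> = y_op n (n + s) (z_op n (n + r) f) \<beta> / 2"
    "osc n (mat_unit n (Suc r) (Suc (n + s))) f \<beta> = y_op n r (z_op n (n + s) f) \<beta> / 2"
    "osc n (mat_unit n (Suc s) (Suc (n + r))) f \<beta> = y_op n s (z_op n (n + r) f) \<beta> / 2"
    "osc n (mat_unit n (Suc (n + r)) (Suc s)) f \<beta> = y_op n (n + r) (z_op n s f) \<beta> / 2"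
    "osc n (mat_unit n (Suc (n + s)) (Suc r)) f \<beta> = y_op n (n + s) (z_op n r f) \<beta> / 2"
    using rs by (simp_all add: osc_mat_unit)
  have y: "y_op n r c = (\<lambda>\<beta>. - der_op (Suc r) c \<beta>)" "y_op n s c = (\<lambda>\<beta>. - der_op (Suc s) c \<beta>)"
    "y_op n (n + r) c = (\<lambda>\<beta>. - mul_op (Suc r) c \<beta>)" "y_op n (n + s) c = (\<lambda>\<beta>. - mul_op (Suc s) c \<beta>)"
    "z_op n r c = mul_op (Suc r) c" "z_op n s c = mul_op (Suc s) c"
    "z_op n (n + r) c = (\<lambda>\<beta>. - der_op (Suc r) c \<beta>)" "z_op n (n + s) c = (\<lambda>\<beta>. - der_op (Suc s) c \<beta>)" for c
    using rs by (simp_all add: y_op_def z_op_def)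
  have "osc n (mat_a n i j) f \<beta> = - (der_op i (mul_op j f) \<beta> + mul_op j (der_op i f) \<beta>) / 2"
    unfolding mat_a_def rs by (simp add: osc_add_mat u y mul_neg add_divide_distrib diff_divide_distrib)
  then show "osc n (mat_a n i j) f \<beta> = - mul_op j (der_op i f) \<beta> - (if i = j then f \<beta> / 2 else 0)"
    unfolding der_mul_commute by (cases "i = j") (simp_all add: add_divide_distrib diff_divide_distrib)
  have "osc n (mat_b n i j) f \<beta> = (der_op i (der_op j f) \<beta> + der_op j (der_op i f) \<beta>) / 2"
    unfolding mat_b_def rs by (simp add: osc_add_mat u y der_neg add_divide_distrib)
  then show "osc n (mat_b n i j) f \<beta> = der_op i (der_op j f) \<beta>"
    using der_der_commute[of j i f \<beta>] by simp
  have "osc n (mat_c n i j) f \<beta> = - (mul_op i (mul_op j f) \<beta> + mul_op j (mul_op i f) \<beta>) / 2"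
    unfolding mat_c_def rs by (simp add: osc_add_mat u y add_divide_distrib diff_divide_distrib)
  then show "osc n (mat_c n i j) f \<beta> = - mul_op i (mul_op j f) \<beta>"
    using mul_mul_commute[of j i f \<beta>] by simp
qed

lemma osc_chev:
  assumes "1 \<le> i" "i < n"
  shows "osc n (chev_e n i) f \<beta> = - mul_op (i + 1) (der_op i f) \<beta>"
    "osc n (chev_h n i) f \<beta> = - mul_op i (der_op i f) \<beta> + mul_op (i + 1) (der_op (i + 1) f) \<beta>"
    "osc n (chev_f n i) f \<beta> = - mul_op i (der_op (i + 1) f) \<beta>"
  using assms by (simp_all add: chev_e_eq chev_f_eq chev_h_eq osc_add_mat osc_mat_abc)

lemma osc_chev_n:
  assumes "1 \<le> n"
  shows "osc n (chev_e n n) f \<beta> = 1 / 2 * der_op n (der_op n f) \<beta>"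
    "osc n (chev_h n n) f \<beta> = - mul_op n (der_op n f) \<beta> - 1 / 2 * f \<beta>"
    "osc n (chev_f n n) f \<beta> = - 1 / 2 * mul_op n (mul_op n f) \<beta>"
  using assms by (simp_all add: chev_e_eq chev_f_eq chev_h_eq osc_add_mat[where Y = "mat_b n n n"] osc_add_mat osc_mat_abc)

lemma neg_coeffs: "c \<in> coeffs n k \<Longrightarrow> (\<lambda>\<beta>. - c \<beta>) \<in> coeffs n k"
  using coeffs_smult[of c n k "-1"] by simp

lemma osc_coeffs:
  assumes c: "c \<in> coeffs n k" shows "osc n X c \<in> coeffs n k"
proof -
  have z: "z_op n b c \<in> coeffs n (Suc k)" if "b < 2 * n" for b
    using that c by (auto simp: z_op_def intro!: mul_op_coeffs der_op_coeffs neg_coeffs)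
  have y: "y_op n a d \<in> coeffs n (Suc (Suc k))" if "a < 2 * n" "d \<in> coeffs n (Suc k)" for a d
    using that by (auto simp: y_op_def intro!: mul_op_coeffs der_op_coeffs neg_coeffs)
  have "(\<lambda>\<beta>. \<Sum>t\<in>{..<2*n} \<times> {..<2*n}. (X $$ t / 2) * y_op n (fst t) (z_op n (snd t) c) \<beta>) \<in> coeffs n k"
    by (rule coeffs_sum) (use y z in \<open>auto simp: coeffs_Suc_Suc\<close>)
  then show ?thesis by (simp add: osc_def[abs_def])
qed

section \<open>Global sections and their coefficients\<close>

text \<open>The exponent of the last variable is forced by homogeneity: \<open>|\<alpha>| - 2 m = -k\<close>.\<close>

definition sec_mono :: "nat \<Rightarrow> nat \<Rightarrow> (nat \<Rightarrow> nat) \<Rightarrow> (nat \<Rightarrow> complex) \<Rightarrow> complex" where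
  "sec_mono n k \<alpha> Q = (if Q \<in> cover n
     then monomial_fun n (\<alpha>(n + 1 := ((\<Sum>i = 1..n. \<alpha> i) + k) div 2)) Q else 0)"

definition to_sec :: "nat \<Rightarrow> nat \<Rightarrow> ((nat \<Rightarrow> nat) \<Rightarrow> complex) \<Rightarrow> (nat \<Rightarrow> complex) \<Rightarrow> complex" where
  "to_sec n k c Q = (\<Sum>\<alpha>\<in>{\<alpha>. c \<alpha> \<noteq> 0}. c \<alpha> * sec_mono n k \<alpha> Q)"

lemma to_sec_superset:
  "finite A \<Longrightarrow> {\<alpha>. c \<alpha> \<noteq> 0} \<subseteq> A \<Longrightarrow> to_sec n k c Q = (\<Sum>\<alpha>\<in>A. c \<alpha> * sec_mono n k \<alpha> Q)"
  unfolding to_sec_def by (rule sum.mono_neutral_left) auto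

lemma to_sec_outside: "Q \<notin> cover n \<Longrightarrow> to_sec n k c Q = 0"
  by (simp add: to_sec_def sec_mono_def)

lemma to_sec_single_sum:
  assumes "finite I"
  shows "to_sec n k (\<lambda>\<beta>. \<Sum>x\<in>I. a x * single (e x) \<beta>) Q = (\<Sum>x\<in>I. a x * sec_mono n k (e x) Q)"
proof -
  have supp: "{\<beta>. (\<Sum>x\<in>I. a x * single (e x) \<beta>) \<noteq> 0} \<subseteq> e ` I"
  proof
    fix \<beta> assume b: "\<beta> \<in> {\<beta>. (\<Sum>x\<in>I. a x * single (e x) \<beta>) \<noteq> 0}"
    show "\<beta> \<in> e ` I"
    proof (rule ccontr)
      assume "\<beta> \<notin> e ` I"
      then have "(\<Sum>x\<in>I. a x * single (e x) \<beta>) = 0" by (intro sum.neutral) (auto simp: single_def)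
      then show False using b by simp
    qed
  qed
  have "to_sec n k (\<lambda>\<beta>. \<Sum>x\<in>I. a x * single (e x) \<beta>) Q =
      (\<Sum>\<beta>\<in>e ` I. \<Sum>x\<in>I. a x * single (e x) \<beta> * sec_mono n k \<beta> Q)"
    using assms by (subst to_sec_superset[OF _ supp]) (simp_all add: sum_distrib_right)
  also have "\<dots> = (\<Sum>x\<in>I. \<Sum>\<beta>\<in>e ` I. a x * single (e x) \<beta> * sec_mono n k \<beta> Q)"
    by (rule sum.swap)
  also have "\<dots> = (\<Sum>x\<in>I. a x * sec_mono n k (e x) Q)"
  proof (rule sum.cong[OF refl])
    fix x assume x: "x \<in> I"
    have "(\<Sum>\<beta>\<in>e ` I. a x * single (e x) \<beta> * sec_mono n k \<beta> Q) =
        (\<Sum>\<beta>\<in>e ` I. if \<beta> = e x then a x * sec_mono n k (e x) Q else 0)"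
      by (rule sum.cong) (auto simp: single_def)
    then show "(\<Sum>\<beta>\<in>e ` I. a x * single (e x) \<beta> * sec_mono n k \<beta> Q) = a x * sec_mono n k (e x) Q"
      using assms x by simp
  qed
  finally show ?thesis .
qed

lemma to_sec_add:
  assumes "c \<in> coeffs n k" "d \<in> coeffs n k"
  shows "to_sec n k (\<lambda>\<beta>. c \<beta> + d \<beta>) Q = to_sec n k c Q + to_sec n k d Q"
proof -
  let ?A = "{\<beta>. c \<beta> \<noteq> 0} \<union> {\<beta>. d \<beta> \<noteq> 0}"
  have A: "finite ?A" using assms by (simp add: coeffs_def)
  have "to_sec n k (\<lambda>\<beta>. c \<beta> + d \<beta>) Q = (\<Sum>\<alpha>\<in>?A. (c \<alpha> + d \<alpha>) * sec_mono n k \<alpha> Q)"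
    by (rule to_sec_superset[OF A]) auto
  also have "\<dots> = (\<Sum>\<alpha>\<in>?A. c \<alpha> * sec_mono n k \<alpha> Q) + (\<Sum>\<alpha>\<in>?A. d \<alpha> * sec_mono n k \<alpha> Q)"
    by (simp add: distrib_right sum.distrib)
  also have "(\<Sum>\<alpha>\<in>?A. c \<alpha> * sec_mono n k \<alpha> Q) = to_sec n k c Q"
    by (rule to_sec_superset[OF A, symmetric]) auto
  also have "(\<Sum>\<alpha>\<in>?A. d \<alpha> * sec_mono n k \<alpha> Q) = to_sec n k d Q"
    by (rule to_sec_superset[OF A, symmetric]) auto
  finally show ?thesis .
qed

lemma to_sec_smult:
  assumes "c \<in> coeffs n k" shows "to_sec n k (\<lambda>\<beta>. a * c \<beta>) Q = a * to_sec n k c Q"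
proof -
  have "to_sec n k (\<lambda>\<beta>. a * c \<beta>) Q = (\<Sum>\<alpha>\<in>{\<beta>. c \<beta> \<noteq> 0}. a * c \<alpha> * sec_mono n k \<alpha> Q)"
    by (rule to_sec_superset) (use assms in \<open>auto simp: coeffs_def\<close>)
  then show ?thesis by (simp add: to_sec_def sum_distrib_left mult.assoc)
qed

lemma to_sec_zero: "to_sec n k (\<lambda>\<beta>. 0) Q = 0"
  by (simp add: to_sec_def)

text \<open>The operators of interest send monomials to multiples of monomials, so their effect on a section
  can be computed one monomial at a time.\<close>

lemma to_sec_expand_op:
  assumes c: "c \<in> coeffs n k" and T: "linop T"
    and T1: "\<And>\<alpha> \<beta>. T (single \<alpha>) \<beta> = a \<alpha> * single (e \<alpha>) \<beta>"
  shows "to_sec n k (T c) Q = (\<Sum>\<alpha>\<in>{\<alpha>. c \<alpha> \<noteq> 0}. c \<alpha> * (a \<alpha> * sec_mono n k (e \<alpha>) Q))"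
proof -
  have fin: "finite {\<alpha>. c \<alpha> \<noteq> 0}" using c by (simp add: coeffs_def)
  have "T c \<beta> = (\<Sum>\<alpha>\<in>{\<alpha>. c \<alpha> \<noteq> 0}. (c \<alpha> * a \<alpha>) * single (e \<alpha>) \<beta>)" for \<beta>
  proof -
    have "T c \<beta> = T (\<lambda>\<beta>. \<Sum>\<alpha>\<in>{\<alpha>. c \<alpha> \<noteq> 0}. c \<alpha> * single \<alpha> \<beta>) \<beta>"
      by (simp only: coeffs_expand[OF c, symmetric])
    also have "\<dots> = (\<Sum>\<alpha>\<in>{\<alpha>. c \<alpha> \<noteq> 0}. c \<alpha> * T (single \<alpha>) \<beta>)" by (rule linop_sum[OF T fin])
    finally show ?thesis by (simp add: T1 mult.assoc)
  qed
  then have "T c = (\<lambda>\<beta>. \<Sum>\<alpha>\<in>{\<alpha>. c \<alpha> \<noteq> 0}. (c \<alpha> * a \<alpha>) * single (e \<alpha>) \<beta>)" by blast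
  then show ?thesis using to_sec_single_sum[OF fin, of n k "\<lambda>\<alpha>. c \<alpha> * a \<alpha>" e Q] by (simp add: mult.assoc)
qed

subsection \<open>Homogeneity\<close>

lemma monomial_fun_split: "monomial_fun n \<mu> Q = (\<Prod>i = 1..n. Q i ^ \<mu> i) * Q (n + 1) ^ \<mu> (n + 1)"
  by (simp add: monomial_fun_def)

text \<open>The weight of a monomial for the action of the multiplicative group.\<close>

definition wt :: "nat \<Rightarrow> (nat \<Rightarrow> nat) \<Rightarrow> int" where
  "wt n \<mu> = int (\<Sum>i = 1..n. \<mu> i) - 2 * int (\<mu> (n + 1))"

lemma monomial_fun_gm_act:
  assumes u: "u \<noteq> 0"
  shows "monomial_fun n \<mu> (gm_act n u Q) = u powi wt n \<mu> * monomial_fun n \<mu> Q"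
proof -
  have "(\<Prod>i = 1..n. gm_act n u Q i ^ \<mu> i) = (\<Prod>i = 1..n. u ^ \<mu> i * Q i ^ \<mu> i)"
    by (rule prod.cong) (auto simp: gm_act_def power_mult_distrib)
  also have "\<dots> = u ^ (\<Sum>i = 1..n. \<mu> i) * (\<Prod>i = 1..n. Q i ^ \<mu> i)"
    by (simp add: prod.distrib power_sum)
  finally have 1: "(\<Prod>i = 1..n. gm_act n u Q i ^ \<mu> i) = u powi int (\<Sum>i = 1..n. \<mu> i) * (\<Prod>i = 1..n. Q i ^ \<mu> i)"
    by (simp only: power_int_of_nat)
  have "gm_act n u Q (n + 1) ^ \<mu> (n + 1) = (u powi (-2)) ^ \<mu> (n + 1) * Q (n + 1) ^ \<mu> (n + 1)"
    by (simp add: gm_act_def power_mult_distrib)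
  also have "(u powi (-2)) ^ \<mu> (n + 1) = u powi (- 2 * int (\<mu> (n + 1)))"
    by (simp only: power_int_mult power_int_of_nat)
  finally have 2: "gm_act n u Q (n + 1) ^ \<mu> (n + 1) = u powi (- 2 * int (\<mu> (n + 1))) * Q (n + 1) ^ \<mu> (n + 1)" .
  have "u powi wt n \<mu> = u powi int (\<Sum>i = 1..n. \<mu> i) * u powi (- 2 * int (\<mu> (n + 1)))"
    unfolding wt_def using power_int_add[of u "int (\<Sum>i = 1..n. \<mu> i)" "- 2 * int (\<mu> (n + 1))"] u by simp
  then show ?thesis unfolding monomial_fun_split 1 2 by (simp only: mult_ac)
qed

lemma gm_act_cover: "u \<noteq> 0 \<Longrightarrow> gm_act n u Q \<in> cover n \<longleftrightarrow> Q \<in> cover n"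
  by (auto simp: cover_def gm_act_def)

lemma wt_exponents:
  assumes "\<alpha> \<in> exponents n k"
  shows "wt n (\<alpha>(n + 1 := ((\<Sum>i = 1..n. \<alpha> i) + k) div 2)) = - int k"
proof -
  have "(\<Sum>i = 1..n. (\<alpha>(n + 1 := m)) i) = (\<Sum>i = 1..n. \<alpha> i)" for m by (rule sum.cong) auto
  moreover have "even ((\<Sum>i = 1..n. \<alpha> i) + k)" using assms unfolding exponents_def by blast
  then obtain m where m: "(\<Sum>i = 1..n. \<alpha> i) + k = 2 * m" by (rule evenE)
  moreover have "int (\<Sum>i = 1..n. \<alpha> i) + int k = 2 * int m" using m by (metis of_nat_add of_nat_mult of_nat_numeral)
  ultimately show ?thesis unfolding wt_def by (simp del: of_nat_sum)
qed

lemma sec_mono_gm_act: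
  assumes "\<alpha> \<in> exponents n k" "u \<noteq> 0"
  shows "sec_mono n k \<alpha> (gm_act n u Q) = u powi (- int k) * sec_mono n k \<alpha> Q"
  using gm_act_cover[OF assms(2), of n Q]
  by (cases "Q \<in> cover n") (simp_all only: sec_mono_def if_True if_False monomial_fun_gm_act[OF assms(2)] wt_exponents[OF assms(1)] mult_zero_right)

lemma to_sec_H0:
  assumes c: "c \<in> coeffs n k" shows "to_sec n k c \<in> H0 n (- int k)"
  unfolding H0_def line_bundle_sections_def preimage_tot_space mem_Collect_eq
proof (intro conjI ballI allI impI)
  let ?S = "{\<alpha>. c \<alpha> \<noteq> 0}"
  have fin: "finite ?S" using c by (simp add: coeffs_def)
  define g where "g = (\<lambda>Q. \<Sum>\<alpha>\<in>?S. c \<alpha> * monomial_fun n (\<alpha>(n + 1 := ((\<Sum>i = 1..n. \<alpha> i) + k) div 2)) Q)"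
  have "polynomial_fun n g" unfolding g_def by (rule polynomial_fun_indexed[OF fin])
  moreover have "to_sec n k c Q = g Q" if "Q \<in> cover n" for Q
    using that by (simp add: to_sec_def sec_mono_def g_def)
  ultimately show "regular_on n (cover n) (to_sec n k c)"
    unfolding regular_on_def using polynomial_fun_const[of n 1] by (intro ballI exI[of _ g] exI[of _ "\<lambda>Q. 1"]) simp
  show "to_sec n k c (gm_act n u Q) = u powi - int k * to_sec n k c Q" if "u \<noteq> 0" for Q u
    unfolding to_sec_def sum_distrib_left
  proof (rule sum.cong[OF refl])
    fix \<alpha> assume "\<alpha> \<in> ?S"
    then have "\<alpha> \<in> exponents n k" using c by (auto simp: coeffs_def)
    then show "c \<alpha> * sec_mono n k \<alpha> (gm_act n u Q) = u powi - int k * (c \<alpha> * sec_mono n k \<alpha> Q)"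
      using sec_mono_gm_act[OF _ that] by simp
  qed
  show "to_sec n k c Q = 0" if "Q \<notin> cover n" for Q using that by (rule to_sec_outside)
qed

text \<open>Scaling by the powers \<open>2\<^sup>t\<close> turns the components of different weights into power sums with
  different nodes, so the components of weight other than \<open>l\<close> vanish at \<open>Q\<close>.\<close>

lemma homogeneous_part:
  assumes A: "finite A" and f: "\<And>Q. Q \<in> cover n \<Longrightarrow> f Q = (\<Sum>\<mu>\<in>A. c \<mu> * monomial_fun n \<mu> Q)"
    and hom: "\<And>Q u. Q \<in> cover n \<Longrightarrow> u \<noteq> 0 \<Longrightarrow> f (gm_act n u Q) = u powi l * f Q"
    and Q: "Q \<in> cover n"
  shows "f Q = (\<Sum>\<mu>\<in>{\<mu>\<in>A. wt n \<mu> = l}. c \<mu> * monomial_fun n \<mu> Q)"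
proof -
  define S where "S = insert l (wt n ` A)"
  define x where "x w = (2 powi w :: complex)" for w :: int
  define a where "a w = (\<Sum>\<mu>\<in>{\<mu>\<in>A. wt n \<mu> = w}. c \<mu> * monomial_fun n \<mu> Q) - (if w = l then f Q else 0)" for w
  have S: "finite S" "l \<in> S" using A by (simp_all add: S_def)
  have inj: "inj_on x S"
  proof (rule inj_onI)
    fix v w assume "x v = x w"
    then have "complex_of_real (2 powi v) = complex_of_real (2 powi w)" by (simp add: x_def)
    then have "(2 :: real) powi v = 2 powi w" using of_real_eq_iff by blast
    then show "v = w" using power_int_strict_increasing[of v w "2 :: real"] power_int_strict_increasing[of w v "2 :: real"]
      by (cases v w rule: linorder_cases) simp_all
  qed
  have "(\<Sum>w\<in>S. a w * x w ^ t) = 0" for t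
  proof -
    let ?u = "2 ^ t :: complex"
    have pw: "?u powi w = x w ^ t" for w
      by (simp add: x_def power_int_power power_int_power' mult.commute)
    have "x l ^ t * f Q = f (gm_act n ?u Q)" using hom[OF Q, of ?u] pw by simp
    also have "\<dots> = (\<Sum>\<mu>\<in>A. c \<mu> * monomial_fun n \<mu> (gm_act n ?u Q))"
      by (rule f) (use Q gm_act_cover[of ?u n Q] in simp)
    also have "\<dots> = (\<Sum>\<mu>\<in>A. c \<mu> * monomial_fun n \<mu> Q * x (wt n \<mu>) ^ t)"
      by (rule sum.cong[OF refl]) (simp add: monomial_fun_gm_act pw[symmetric])
    also have "\<dots> = (\<Sum>w\<in>wt n ` A. \<Sum>\<mu>\<in>{\<mu>\<in>A. wt n \<mu> = w}. c \<mu> * monomial_fun n \<mu> Q * x (wt n \<mu>) ^ t)"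
      by (rule sum.image_gen[OF A])
    also have "\<dots> = (\<Sum>w\<in>S. \<Sum>\<mu>\<in>{\<mu>\<in>A. wt n \<mu> = w}. c \<mu> * monomial_fun n \<mu> Q * x (wt n \<mu>) ^ t)"
    proof (rule sum.mono_neutral_left[OF S(1)])
      show "wt n ` A \<subseteq> S" by (auto simp: S_def)
      show "\<forall>w\<in>S - wt n ` A. (\<Sum>\<mu>\<in>{\<mu>\<in>A. wt n \<mu> = w}. c \<mu> * monomial_fun n \<mu> Q * x (wt n \<mu>) ^ t) = 0"
        by (intro ballI sum.neutral) auto
    qed
    also have "\<dots> = (\<Sum>w\<in>S. (\<Sum>\<mu>\<in>{\<mu>\<in>A. wt n \<mu> = w}. c \<mu> * monomial_fun n \<mu> Q) * x w ^ t)"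
      by (simp add: sum_distrib_right)
    finally have "(\<Sum>w\<in>S. (\<Sum>\<mu>\<in>{\<mu>\<in>A. wt n \<mu> = w}. c \<mu> * monomial_fun n \<mu> Q) * x w ^ t) = x l ^ t * f Q" by simp
    moreover have "(\<Sum>w\<in>S. (if w = l then f Q else 0) * x w ^ t) = x l ^ t * f Q"
    proof -
      have "(\<Sum>w\<in>S. (if w = l then f Q else 0) * x w ^ t) = (\<Sum>w\<in>S. if w = l then x l ^ t * f Q else 0)"
        by (rule sum.cong) auto
      then show ?thesis using S by simp
    qed
    ultimately show ?thesis by (simp add: a_def left_diff_distrib sum_subtractf)
  qed
  from power_sums_independent[OF S(1) inj this S(2)] show ?thesis by (simp add: a_def)
qed

lemma H0_to_sec:
  assumes n: "n \<ge> 2" and f: "f \<in> H0 n (- int k)"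
  obtains c where "c \<in> coeffs n k" "f = to_sec n k c"
proof -
  have reg: "regular_on n (cover n) f" and hom: "\<And>Q u. Q \<in> cover n \<Longrightarrow> u \<noteq> 0 \<Longrightarrow> f (gm_act n u Q) = u powi (- int k) * f Q"
    and out: "\<And>Q. Q \<notin> cover n \<Longrightarrow> f Q = 0"
    using f unfolding H0_def line_bundle_sections_def preimage_tot_space by auto
  obtain g where g: "polynomial_fun n g" "\<And>Q. Q \<in> cover n \<Longrightarrow> f Q = g Q"
    by (rule regular_polynomial[OF n reg]) blast
  obtain A c where A: "finite A" "\<And>Q. g Q = (\<Sum>\<mu>\<in>A. c \<mu> * monomial_fun n \<mu> Q)"
    by (rule polynomial_funE[OF g(1)]) blast
  let ?B = "{\<mu>\<in>A. wt n \<mu> = - int k}"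
  define r where "r \<mu> = (\<lambda>i. if i \<in> {1..n} then \<mu> i else 0 :: nat)" for \<mu>
  have sum_r: "(\<Sum>i = 1..n. r \<mu> i) = (\<Sum>i = 1..n. \<mu> i)" for \<mu> by (rule sum.cong) (auto simp: r_def)
  have r: "r \<mu> \<in> exponents n k" "((\<Sum>i = 1..n. \<mu> i) + k) div 2 = \<mu> (n + 1)" if "wt n \<mu> = - int k" for \<mu>
  proof -
    have "int ((\<Sum>i = 1..n. \<mu> i) + k) = 2 * int (\<mu> (n + 1))" using that by (simp add: wt_def del: of_nat_sum)
    then have e: "(\<Sum>i = 1..n. \<mu> i) + k = 2 * \<mu> (n + 1)" by linarith
    then show "((\<Sum>i = 1..n. \<mu> i) + k) div 2 = \<mu> (n + 1)" by simp
    show "r \<mu> \<in> exponents n k" unfolding exponents_def mem_Collect_eq sum_r e by (auto simp: r_def)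
  qed
  have mono: "monomial_fun n \<mu> Q = sec_mono n k (r \<mu>) Q" if "wt n \<mu> = - int k" "Q \<in> cover n" for \<mu> Q
  proof -
    have "(\<Prod>i = 1..n. Q i ^ \<mu> i) = (\<Prod>i = 1..n. Q i ^ ((r \<mu>)(n + 1 := \<mu> (n + 1))) i)"
      by (rule prod.cong) (auto simp: r_def)
    then show ?thesis using that(2) unfolding sec_mono_def sum_r r(2)[OF that(1)] monomial_fun_split by simp
  qed
  let ?c = "\<lambda>\<beta>. \<Sum>\<mu>\<in>?B. c \<mu> * single (r \<mu>) \<beta>"
  have "?c \<in> coeffs n k" by (rule coeffs_sum) (use A r in \<open>auto intro: single_coeffs\<close>)
  moreover have "f Q = to_sec n k ?c Q" for Q
  proof (cases "Q \<in> cover n")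
    case True
    have "f Q = (\<Sum>\<mu>\<in>?B. c \<mu> * monomial_fun n \<mu> Q)"
      by (rule homogeneous_part[OF A(1) _ hom True]) (use g A in auto)
    also have "\<dots> = (\<Sum>\<mu>\<in>?B. c \<mu> * sec_mono n k (r \<mu>) Q)"
      by (rule sum.cong) (use mono True in auto)
    also have "\<dots> = to_sec n k ?c Q" by (rule to_sec_single_sum[symmetric]) (use A in simp)
    finally show ?thesis .
  qed (simp add: out to_sec_outside)
  ultimately show ?thesis using that by blast
qed

subsection \<open>Uniqueness of coefficients\<close>

text \<open>By unique factorization the exponents can be read off from the value of a monomial at distinct
  primes.\<close>

lemma prime_powers_inj:
  "inj_on (\<lambda>\<alpha>. \<Prod>i = 1..n. enumerate {p :: nat. prime p} i ^ \<alpha> i) (exponents n k)"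
proof (rule inj_onI)
  let ?pr = "enumerate {p :: nat. prime p}"
  fix \<alpha> \<beta> assume ab: "\<alpha> \<in> exponents n k" "\<beta> \<in> exponents n k"
    and eq: "(\<Prod>i = 1..n. ?pr i ^ \<alpha> i) = (\<Prod>i = 1..n. ?pr i ^ \<beta> i)"
  have inj: "inj ?pr" using strict_mono_enumerate[OF primes_infinite] strict_mono_imp_inj_on by blast
  have pr: "prime (?pr i)" for i using enumerate_in_set[OF primes_infinite] by blast
  have mult: "multiplicity (?pr j) (\<Prod>i = 1..n. ?pr i ^ \<gamma> i) = \<gamma> j" if j: "j \<in> {1..n}" for \<gamma> j
  proof -
    have "(\<Prod>i = 1..n. ?pr i ^ \<gamma> i) = (\<Prod>i\<in>{1..n}. ?pr i ^ \<gamma> (the_inv ?pr (?pr i)))" using the_inv_f_f[OF inj] by simp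
    also have "\<dots> = (\<Prod>p\<in>?pr ` {1..n}. p ^ \<gamma> (the_inv ?pr p))"
      by (rule prod.reindex[OF inj_on_subset[OF inj], simplified, unfolded o_def, symmetric]) 
    also have "multiplicity (?pr j) \<dots> = \<gamma> j"
      using j the_inv_f_f[OF inj] by (subst multiplicity_prod_prime_powers) (auto simp: pr)
    finally show ?thesis .
  qed
  show "\<alpha> = \<beta>"
  proof
    fix j show "\<alpha> j = \<beta> j"
    proof (cases "j \<in> {1..n}")
      case True then show ?thesis using mult[OF True, of \<alpha>] mult[OF True, of \<beta>] eq by simp
    next
      case False then show ?thesis using ab by (simp add: exponents_def)
    qed
  qed
qed

text \<open>Evaluation at the \<open>t\<close>-th powers of distinct primes and at 1 in the last coordinate turns the
  difference of the two sections into a power sum whose nodes are different for different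
  monomials. These points avoid the zero locus of the last coordinate, where the formula for
  \<open>e\<^sub>n\<close> says nothing.\<close>

lemma to_sec_eqI:
  assumes n: "1 \<le> n" and c: "c \<in> coeffs n k" and d: "d \<in> coeffs n k"
    and eq: "\<And>Q. Q \<in> cover n \<Longrightarrow> Q (n + 1) \<noteq> 0 \<Longrightarrow> to_sec n k c Q = to_sec n k d Q"
  shows "c = d"
proof -
  let ?pr = "enumerate {p :: nat. prime p}" and ?A = "{\<beta>. c \<beta> \<noteq> 0} \<union> {\<beta>. d \<beta> \<noteq> 0}"
  define N where "N \<alpha> = (\<Prod>i = 1..n. ?pr i ^ \<alpha> i)" for \<alpha>
  have pr: "?pr i \<noteq> 0" for i using enumerate_in_set[OF primes_infinite, of i] by (metis mem_Collect_eq not_prime_0)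
  have A: "finite ?A" "?A \<subseteq> exponents n k" using c d by (auto simp: coeffs_def)
  have inj: "inj_on (\<lambda>\<alpha>. of_nat (N \<alpha>) :: complex) ?A"
  proof (rule inj_onI)
    fix \<alpha> \<beta> assume *: "\<alpha> \<in> ?A" "\<beta> \<in> ?A" "of_nat (N \<alpha>) = (of_nat (N \<beta>) :: complex)"
    then have "N \<alpha> = N \<beta>" using of_nat_eq_iff by blast
    then show "\<alpha> = \<beta>" using prime_powers_inj[of n k] * A(2) unfolding N_def by (meson inj_onD subsetD)
  qed
  have "(\<Sum>\<alpha>\<in>?A. (c \<alpha> - d \<alpha>) * of_nat (N \<alpha>) ^ t) = 0" for t :: nat
  proof -
    define Q where "Q = (\<lambda>i. if i \<in> {1..n} then of_nat (?pr i) ^ t else if i = n + 1 then 1 else 0 :: complex)"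
    have Q: "Q \<in> cover n" "Q (n + 1) = 1" using n pr by (auto simp: cover_def Q_def intro!: bexI[of _ 1])
    have mono: "sec_mono n k \<alpha> Q = of_nat (N \<alpha>) ^ t" for \<alpha>
    proof -
      have "(\<Prod>i = 1..n. Q i ^ (\<alpha>(n + 1 := m)) i) = (\<Prod>i = 1..n. (of_nat (?pr i) ^ \<alpha> i) ^ t)" for m
        by (rule prod.cong) (auto simp: Q_def power_mult[symmetric] mult.commute)
      also have "\<dots> = of_nat (N \<alpha>) ^ t" by (simp add: N_def prod_power_distrib)
      finally show ?thesis using Q by (simp add: sec_mono_def monomial_fun_split)
    qed
    have "(\<Sum>\<alpha>\<in>?A. c \<alpha> * of_nat (N \<alpha>) ^ t) = to_sec n k c Q"
      unfolding mono[symmetric] by (rule to_sec_superset[OF A(1), symmetric]) auto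
    also have "\<dots> = to_sec n k d Q" using eq[OF Q(1)] Q(2) by simp
    also have "\<dots> = (\<Sum>\<alpha>\<in>?A. d \<alpha> * of_nat (N \<alpha>) ^ t)"
      unfolding mono[symmetric] by (rule to_sec_superset[OF A(1)]) auto
    finally show ?thesis by (simp add: left_diff_distrib sum_subtractf)
  qed
  then have "c \<alpha> - d \<alpha> = 0" if "\<alpha> \<in> ?A" for \<alpha>
    using power_sums_independent[OF A(1) inj _ that, of "\<lambda>\<alpha>. c \<alpha> - d \<alpha>"] by blast
  then show ?thesis by (intro ext) (metis (mono_tags, lifting) UnI1 UnI2 mem_Collect_eq right_minus_eq)
qed

section \<open>The Chevalley generators as differential operators on sections\<close>

lemma monomial_fun_update:
  assumes i: "i \<in> {1..n + 1}"
  shows "monomial_fun n \<mu> (Q(i := z)) = z ^ \<mu> i * monomial_fun n (\<mu>(i := 0)) Q"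
proof -
  have "monomial_fun n \<mu> (Q(i := z)) = (Q(i := z)) i ^ \<mu> i * (\<Prod>j\<in>{1..n + 1} - {i}. (Q(i := z)) j ^ \<mu> j)"
    unfolding monomial_fun_def by (rule prod.remove[OF _ i]) simp
  also have "(\<Prod>j\<in>{1..n + 1} - {i}. (Q(i := z)) j ^ \<mu> j) = (\<Prod>j\<in>{1..n + 1} - {i}. Q j ^ (\<mu>(i := 0)) j)"
    by (rule prod.cong) auto
  also have "\<dots> = Q i ^ (\<mu>(i := 0)) i * (\<Prod>j\<in>{1..n + 1} - {i}. Q j ^ (\<mu>(i := 0)) j)" by simp
  also have "\<dots> = monomial_fun n (\<mu>(i := 0)) Q"
    unfolding monomial_fun_def by (rule prod.remove[OF _ i, symmetric]) simp
  finally show ?thesis by (simp add: fun_upd_def)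
qed

lemma monomial_fun_raise:
  assumes i: "i \<in> {1..n + 1}"
  shows "Q i * monomial_fun n \<mu> Q = monomial_fun n (\<mu>(i := \<mu> i + 1)) Q"
  using monomial_fun_update[OF i, of \<mu> Q "Q i"] monomial_fun_update[OF i, of "\<mu>(i := \<mu> i + 1)" Q "Q i"]
  by simp

text \<open>A factor \<open>w\<close> that depends on the last coordinate only is constant for the derivatives considered;
  it will be 1 or the inverse of the last coordinate.\<close>

lemma pd_section:
  assumes f: "\<And>R. R \<in> cover n \<Longrightarrow> f R = w (R (n + 1)) * (\<Sum>x\<in>I. a x * monomial_fun n (e x) R)"
    and Q: "Q \<in> cover n" and i: "i \<in> {1..n}"
  shows "pd i f Q = w (Q (n + 1)) * (\<Sum>x\<in>I. a x * of_nat (e x i) * monomial_fun n ((e x)(i := e x i - 1)) Q)"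
proof -
  have i': "i \<in> {1..n + 1}" using i by simp
  let ?g = "\<lambda>z. w (Q (n + 1)) * (\<Sum>x\<in>I. a x * (z ^ e x i * monomial_fun n ((e x)(i := 0)) Q))"
  obtain j where j: "j \<in> {1..n}" "Q j \<noteq> 0" using Q by (auto simp: cover_def)
  have "\<forall>\<^sub>F z in nhds (Q i). Q(i := z) \<in> cover n"
  proof (cases "j = i")
    case True
    have "\<forall>\<^sub>F z in nhds (Q i). z \<noteq> 0" using j True by (intro t1_space_nhds) simp
    then show ?thesis
      by (rule eventually_mono) (use Q i in \<open>auto simp: cover_def\<close>)
  next
    case False
    then have "Q(i := z) \<in> cover n" for z using j Q i by (auto simp: cover_def)
    then show ?thesis by simp
  qed
  then have "\<forall>\<^sub>F z in nhds (Q i). f (Q(i := z)) = ?g z"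
  proof (rule eventually_mono)
    fix z assume "Q(i := z) \<in> cover n"
    then show "f (Q(i := z)) = ?g z" using f i by (simp add: monomial_fun_update[OF i'])
  qed
  then have "pd i f Q = deriv ?g (Q i)" unfolding pd_def by (rule deriv_cong_ev) simp
  also have "\<dots> = w (Q (n + 1)) * (\<Sum>x\<in>I. a x * (of_nat (e x i) * Q i ^ (e x i - 1) * monomial_fun n ((e x)(i := 0)) Q))"
    by (rule DERIV_imp_deriv) (auto intro!: derivative_eq_intros sum.cong)
  also have "(\<Sum>x\<in>I. a x * (of_nat (e x i) * Q i ^ (e x i - 1) * monomial_fun n ((e x)(i := 0)) Q)) =
      (\<Sum>x\<in>I. a x * of_nat (e x i) * monomial_fun n ((e x)(i := e x i - 1)) Q)"
  proof (rule sum.cong[OF refl])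
    fix x
    show "a x * (of_nat (e x i) * Q i ^ (e x i - 1) * monomial_fun n ((e x)(i := 0)) Q) =
       a x * of_nat (e x i) * monomial_fun n ((e x)(i := e x i - 1)) Q"
      using monomial_fun_update[OF i', of "(e x)(i := e x i - 1)" Q "Q i"] by simp
  qed
  finally show ?thesis .
qed

abbreviation degree_sum :: "nat \<Rightarrow> (nat \<Rightarrow> nat) \<Rightarrow> nat" where
  "degree_sum n \<alpha> \<equiv> (\<Sum>i = 1..n. \<alpha> i)"

lemma degree_sum_update:
  assumes "i \<in> {1..n}" shows "degree_sum n (\<alpha>(i := m)) + \<alpha> i = degree_sum n \<alpha> + m"
proof -
  have "degree_sum n (\<alpha>(i := m)) = (\<alpha>(i := m)) i + (\<Sum>x\<in>{1..n} - {i}. (\<alpha>(i := m)) x)"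
    by (rule sum.remove[OF _ assms]) simp
  moreover have "(\<Sum>x\<in>{1..n} - {i}. (\<alpha>(i := m)) x) = (\<Sum>x\<in>{1..n} - {i}. \<alpha> x)" by (rule sum.cong) auto
  moreover have "degree_sum n \<alpha> = \<alpha> i + (\<Sum>x\<in>{1..n} - {i}. \<alpha> x)" by (rule sum.remove[OF _ assms]) simp
  ultimately show ?thesis by simp
qed

lemma mul_op_single: "mul_op i (single \<alpha>) \<beta> = single (\<alpha>(i := \<alpha> i + 1)) \<beta>"
proof -
  have "\<beta> i \<noteq> 0 \<and> \<beta>(i := \<beta> i - 1) = \<alpha> \<longleftrightarrow> \<beta> = \<alpha>(i := \<alpha> i + 1)"
    by (auto simp: fun_eq_iff)
  then show ?thesis by (auto simp: mul_op_def single_def)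
qed

text \<open>For \<open>\<alpha> i = 0\<close> the truncated exponent is harmless, as the coefficient vanishes.\<close>

lemma der_op_single: "der_op i (single \<alpha>) \<beta> = of_nat (\<alpha> i) * single (\<alpha>(i := \<alpha> i - 1)) \<beta>"
proof (cases "\<alpha> i = 0")
  case True
  then have "\<beta>(i := \<beta> i + 1) \<noteq> \<alpha>" by (auto simp: fun_eq_iff)
  then show ?thesis using True by (simp add: der_op_def single_def)
next
  case False
  then have "\<beta>(i := \<beta> i + 1) = \<alpha> \<longleftrightarrow> \<beta> = \<alpha>(i := \<alpha> i - 1)"
    by (auto simp: fun_eq_iff)
  then show ?thesis using False by (auto simp: der_op_def single_def)
qed

lemma linop_comp: "linop S \<Longrightarrow> linop T \<Longrightarrow> linop (\<lambda>c. S (T c))"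
  unfolding linop_def
proof (intro conjI allI; elim conjE)
  fix c d \<beta> k
  assume S: "\<forall>c d \<beta>. S (\<lambda>\<gamma>. c \<gamma> + d \<gamma>) \<beta> = S c \<beta> + S d \<beta>" "\<forall>k c \<beta>. S (\<lambda>\<gamma>. k * c \<gamma>) \<beta> = k * S c \<beta>"
    and T: "\<forall>c d \<beta>. T (\<lambda>\<gamma>. c \<gamma> + d \<gamma>) \<beta> = T c \<beta> + T d \<beta>" "\<forall>k c \<beta>. T (\<lambda>\<gamma>. k * c \<gamma>) \<beta> = k * T c \<beta>"
  have "T (\<lambda>\<gamma>. c \<gamma> + d \<gamma>) = (\<lambda>\<beta>. T c \<beta> + T d \<beta>)" using T by blast
  then show "S (T (\<lambda>\<gamma>. c \<gamma> + d \<gamma>)) \<beta> = S (T c) \<beta> + S (T d) \<beta>" using S by simp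
  have "T (\<lambda>\<gamma>. k * c \<gamma>) = (\<lambda>\<beta>. k * T c \<beta>)" using T by blast
  then show "S (T (\<lambda>\<gamma>. k * c \<gamma>)) \<beta> = k * S (T c) \<beta>" using S by simp
qed

context
  fixes n k :: nat
begin

text \<open>The exponent of the section that belongs to \<open>\<alpha>\<close>, including the last coordinate.\<close>

abbreviation full_exponent :: "(nat \<Rightarrow> nat) \<Rightarrow> nat \<Rightarrow> nat" where
  "full_exponent \<alpha> \<equiv> \<alpha>(n + 1 := (degree_sum n \<alpha> + k) div 2)"

lemma to_sec_cover: "Q \<in> cover n \<Longrightarrow>
    to_sec n k c Q = (\<Sum>\<alpha>\<in>{\<alpha>. c \<alpha> \<noteq> 0}. c \<alpha> * monomial_fun n (full_exponent \<alpha>) Q)"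
  by (simp add: to_sec_def sec_mono_def)

lemma pd_to_sec:
  assumes Q: "Q \<in> cover n" and i: "i \<in> {1..n}"
  shows "pd i (to_sec n k c) Q =
    (\<Sum>\<alpha>\<in>{\<alpha>. c \<alpha> \<noteq> 0}. c \<alpha> * of_nat (\<alpha> i) * monomial_fun n ((full_exponent \<alpha>)(i := \<alpha> i - 1)) Q)"
proof -
  have "pd i (to_sec n k c) Q = (\<lambda>_. 1) (Q (n + 1)) *
    (\<Sum>\<alpha>\<in>{\<alpha>. c \<alpha> \<noteq> 0}. c \<alpha> * of_nat ((full_exponent \<alpha>) i) * monomial_fun n ((full_exponent \<alpha>)(i := (full_exponent \<alpha>) i - 1)) Q)"
    by (rule pd_section[OF _ Q i]) (simp add: to_sec_cover fun_upd_def)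
  then show ?thesis using i by simp
qed

text \<open>The total degree does not change, so neither does the exponent of the last coordinate.\<close>

lemma mul_pd_to_sec:
  assumes c: "c \<in> coeffs n k" and Q: "Q \<in> cover n" and ij: "i \<in> {1..n}" "j \<in> {1..n}"
  shows "Q j * pd i (to_sec n k c) Q = to_sec n k (mul_op j (der_op i c)) Q"
proof -
  let ?e = "\<lambda>\<alpha>. (\<alpha>(i := \<alpha> i - 1))(j := (\<alpha>(i := \<alpha> i - 1)) j + 1)"
  have "to_sec n k (mul_op j (der_op i c)) Q =
      (\<Sum>\<alpha>\<in>{\<alpha>. c \<alpha> \<noteq> 0}. c \<alpha> * (of_nat (\<alpha> i) * sec_mono n k (?e \<alpha>) Q))"
  proof (rule to_sec_expand_op[OF c linop_comp[OF linop_mul linop_der]])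
    fix \<alpha> \<beta>
    have "der_op i (single \<alpha>) = (\<lambda>\<beta>. of_nat (\<alpha> i) * single (\<alpha>(i := \<alpha> i - 1)) \<beta>)"
      using der_op_single by blast
    then show "mul_op j (der_op i (single \<alpha>)) \<beta> = of_nat (\<alpha> i) * single (?e \<alpha>) \<beta>"
      by (simp only: linop_smult[OF linop_mul] mul_op_single)
  qed
  also have "\<dots> = (\<Sum>\<alpha>\<in>{\<alpha>. c \<alpha> \<noteq> 0}. Q j * (c \<alpha> * of_nat (\<alpha> i) * monomial_fun n ((full_exponent \<alpha>)(i := \<alpha> i - 1)) Q))"
  proof (rule sum.cong[OF refl])
    fix \<alpha>
    have "sec_mono n k (?e \<alpha>) Q = Q j * monomial_fun n ((full_exponent \<alpha>)(i := \<alpha> i - 1)) Q" if "\<alpha> i \<noteq> 0"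
    proof -
      have "degree_sum n (?e \<alpha>) + (\<alpha>(i := \<alpha> i - 1)) j = degree_sum n (\<alpha>(i := \<alpha> i - 1)) + ((\<alpha>(i := \<alpha> i - 1)) j + 1)"
        by (rule degree_sum_update[OF ij(2)])
      moreover have "degree_sum n (\<alpha>(i := \<alpha> i - 1)) + \<alpha> i = degree_sum n \<alpha> + (\<alpha> i - 1)"
        by (rule degree_sum_update[OF ij(1)])
      ultimately have d: "degree_sum n (?e \<alpha>) = degree_sum n \<alpha>" using that by linarith
      have j': "j \<in> {1..n + 1}" using ij by simp
      have "((full_exponent \<alpha>)(i := \<alpha> i - 1))(j := ((full_exponent \<alpha>)(i := \<alpha> i - 1)) j + 1) = full_exponent (?e \<alpha>)"
        unfolding d using ij by (auto simp: fun_eq_iff)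
      then show ?thesis using Q monomial_fun_raise[OF j', of Q "(full_exponent \<alpha>)(i := \<alpha> i - 1)"] by (simp add: sec_mono_def)
    qed
    then show "c \<alpha> * (of_nat (\<alpha> i) * sec_mono n k (?e \<alpha>) Q) =
        Q j * (c \<alpha> * of_nat (\<alpha> i) * monomial_fun n ((full_exponent \<alpha>)(i := \<alpha> i - 1)) Q)"
      by (cases "\<alpha> i = 0") simp_all
  qed
  also have "\<dots> = Q j * pd i (to_sec n k c) Q" by (simp only: pd_to_sec[OF Q ij(1)] sum_distrib_left)
  finally show ?thesis by simp
qed

text \<open>The total degree drops by two, hence the exponent of the last coordinate by one, which is the
  effect of the inverse.\<close>

lemma pd_pd_to_sec:
  assumes c: "c \<in> coeffs n k" and Q: "Q \<in> cover n" "Q (n + 1) \<noteq> 0" and i: "i \<in> {1..n}"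
  shows "pd i (pd i (\<lambda>R. inverse (R (n + 1)) * to_sec n k c R)) Q = to_sec n k (der_op i (der_op i c)) Q"
proof -
  let ?S = "{\<alpha>. c \<alpha> \<noteq> 0}" and ?e = "\<lambda>\<alpha>. \<alpha>(i := \<alpha> i - 1 - 1)"
  have 1: "pd i (\<lambda>R. inverse (R (n + 1)) * to_sec n k c R) R = inverse (R (n + 1)) *
      (\<Sum>\<alpha>\<in>?S. c \<alpha> * of_nat (\<alpha> i) * monomial_fun n ((full_exponent \<alpha>)(i := \<alpha> i - 1)) R)" if R: "R \<in> cover n" for R
  proof -
    have "pd i (\<lambda>R. inverse (R (n + 1)) * to_sec n k c R) R = inverse (R (n + 1)) *
      (\<Sum>\<alpha>\<in>?S. c \<alpha> * of_nat ((full_exponent \<alpha>) i) * monomial_fun n ((full_exponent \<alpha>)(i := (full_exponent \<alpha>) i - 1)) R)"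
      by (rule pd_section[OF _ R i, where w = inverse]) (simp add: to_sec_cover fun_upd_def)
    then show ?thesis using i by simp
  qed
  have "pd i (pd i (\<lambda>R. inverse (R (n + 1)) * to_sec n k c R)) Q = inverse (Q (n + 1)) *
      (\<Sum>\<alpha>\<in>?S. c \<alpha> * of_nat (\<alpha> i) * of_nat (((full_exponent \<alpha>)(i := \<alpha> i - 1)) i) *
        monomial_fun n (((full_exponent \<alpha>)(i := \<alpha> i - 1))(i := ((full_exponent \<alpha>)(i := \<alpha> i - 1)) i - 1)) Q)"
    by (rule pd_section[OF 1 Q(1) i])
  also have "\<dots> = (\<Sum>\<alpha>\<in>?S. c \<alpha> * (of_nat (\<alpha> i) * of_nat (\<alpha> i - 1) * sec_mono n k (?e \<alpha>) Q))"
    unfolding sum_distrib_left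
  proof (rule sum.cong[OF refl])
    fix \<alpha>
    show "inverse (Q (n + 1)) * (c \<alpha> * of_nat (\<alpha> i) * of_nat (((full_exponent \<alpha>)(i := \<alpha> i - 1)) i) *
        monomial_fun n (((full_exponent \<alpha>)(i := \<alpha> i - 1))(i := ((full_exponent \<alpha>)(i := \<alpha> i - 1)) i - 1)) Q) =
      c \<alpha> * (of_nat (\<alpha> i) * of_nat (\<alpha> i - 1) * sec_mono n k (?e \<alpha>) Q)"
    proof (cases "\<alpha> i \<le> 1")
      case False
      have "degree_sum n (?e \<alpha>) + \<alpha> i = degree_sum n \<alpha> + (\<alpha> i - 1 - 1)" by (rule degree_sum_update[OF i])
      then have d: "degree_sum n \<alpha> = degree_sum n (?e \<alpha>) + 2" using False by linarith
      have "(full_exponent \<alpha>)(i := \<alpha> i - 1 - 1) =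
          (full_exponent (?e \<alpha>))(n + 1 := (full_exponent (?e \<alpha>)) (n + 1) + 1)"
        unfolding d using i by (auto simp: fun_eq_iff)
      then have "monomial_fun n ((full_exponent \<alpha>)(i := \<alpha> i - 1 - 1)) Q = Q (n + 1) * sec_mono n k (?e \<alpha>) Q"
        using monomial_fun_raise[of "n + 1" n Q "full_exponent (?e \<alpha>)"] Q by (simp add: sec_mono_def)
      then show ?thesis using Q by simp
    qed auto
  qed
  also have "\<dots> = to_sec n k (der_op i (der_op i c)) Q"
  proof (rule to_sec_expand_op[OF c linop_comp[OF linop_der linop_der], symmetric])
    fix \<alpha> \<beta>
    have "der_op i (single \<alpha>) = (\<lambda>\<beta>. of_nat (\<alpha> i) * single (\<alpha>(i := \<alpha> i - 1)) \<beta>)"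
      using der_op_single by blast
    then show "der_op i (der_op i (single \<alpha>)) \<beta> = of_nat (\<alpha> i) * of_nat (\<alpha> i - 1) * single (?e \<alpha>) \<beta>"
      by (simp only: linop_smult[OF linop_der] der_op_single) simp
  qed
  finally show ?thesis .
qed

text \<open>The total degree grows by two, hence the exponent of the last coordinate by one, which is the
  effect of the factor \<open>Q\<^bsub>n+1\<^esub>\<close>.\<close>

lemma mul_mul_to_sec:
  assumes c: "c \<in> coeffs n k" and Q: "Q \<in> cover n" and i: "i \<in> {1..n}"
  shows "(Q i)\<^sup>2 * Q (n + 1) * to_sec n k c Q = to_sec n k (mul_op i (mul_op i c)) Q"
proof -
  let ?e = "\<lambda>\<alpha>. \<alpha>(i := \<alpha> i + 1 + 1)"
  have "to_sec n k (mul_op i (mul_op i c)) Q = (\<Sum>\<alpha>\<in>{\<alpha>. c \<alpha> \<noteq> 0}. c \<alpha> * (1 * sec_mono n k (?e \<alpha>) Q))"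
  proof (rule to_sec_expand_op[OF c linop_comp[OF linop_mul linop_mul]])
    fix \<alpha> \<beta>
    have "mul_op i (single \<alpha>) = single (\<alpha>(i := \<alpha> i + 1))" using mul_op_single by blast
    then show "mul_op i (mul_op i (single \<alpha>)) \<beta> = 1 * single (?e \<alpha>) \<beta>"
      by (simp add: mul_op_single)
  qed
  also have "\<dots> = (\<Sum>\<alpha>\<in>{\<alpha>. c \<alpha> \<noteq> 0}. (Q i)\<^sup>2 * Q (n + 1) * (c \<alpha> * sec_mono n k \<alpha> Q))"
  proof (rule sum.cong[OF refl])
    fix \<alpha>
    have i': "i \<in> {1..n + 1}" using i by simp
    have "degree_sum n (?e \<alpha>) + \<alpha> i = degree_sum n \<alpha> + (\<alpha> i + 1 + 1)" by (rule degree_sum_update[OF i])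
    then have d: "degree_sum n (?e \<alpha>) = degree_sum n \<alpha> + 2" by simp
    let ?m = "full_exponent \<alpha>"
    let ?m1 = "?m(n + 1 := ?m (n + 1) + 1)"
    let ?m2 = "?m1(i := ?m1 i + 1)"
    have "full_exponent (?e \<alpha>) = ?m2(i := ?m2 i + 1)"
      unfolding d using i by (auto simp: fun_eq_iff)
    then have "sec_mono n k (?e \<alpha>) Q = Q i * (Q i * (Q (n + 1) * monomial_fun n ?m Q))"
      using monomial_fun_raise[OF i', of Q ?m2] monomial_fun_raise[OF i', of Q ?m1]
        monomial_fun_raise[of "n + 1" n Q ?m] Q by (simp add: sec_mono_def)
    then show "c \<alpha> * (1 * sec_mono n k (?e \<alpha>) Q) = (Q i)\<^sup>2 * Q (n + 1) * (c \<alpha> * sec_mono n k \<alpha> Q)"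
      using Q by (simp add: sec_mono_def power2_eq_square)
  qed
  also have "\<dots> = (Q i)\<^sup>2 * Q (n + 1) * to_sec n k c Q" by (simp only: to_sec_def sum_distrib_left)
  finally show ?thesis by simp
qed

end

section \<open>Irreducibility of the oscillator representation\<close>

definition top_exponent :: "nat \<Rightarrow> nat \<Rightarrow> nat \<Rightarrow> nat" where
  "top_exponent n m = (\<lambda>i. if i = n then m else 0)"

lemma degree_sum_top: "1 \<le> n \<Longrightarrow> degree_sum n (top_exponent n m) = m"
  by (simp add: top_exponent_def)

lemma top_exponent_exponents: "1 \<le> n \<Longrightarrow> even (m + k) \<Longrightarrow> top_exponent n m \<in> exponents n k"
  unfolding exponents_def mem_Collect_eq degree_sum_top by (auto simp: top_exponent_def)

lemma euler_op: "mul_op i (der_op i c) \<beta> = of_nat (\<beta> i) * c \<beta>"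
  by (cases "\<beta> i") (auto simp: mul_op_def der_op_def fun_upd_idem)

lemma weighted_sum_update:
  fixes v :: "nat \<Rightarrow> nat"
  assumes "i \<in> {1..n}"
  shows "(\<Sum>x = 1..n. (\<alpha>(i := m)) x * v x) + \<alpha> i * v i = (\<Sum>x = 1..n. \<alpha> x * v x) + m * v i"
proof -
  have "(\<Sum>x = 1..n. (\<alpha>(i := m)) x * v x) = (\<alpha>(i := m)) i * v i + (\<Sum>x\<in>{1..n} - {i}. (\<alpha>(i := m)) x * v x)"
    by (rule sum.remove[OF _ assms]) simp
  moreover have "(\<Sum>x\<in>{1..n} - {i}. (\<alpha>(i := m)) x * v x) = (\<Sum>x\<in>{1..n} - {i}. \<alpha> x * v x)" by (rule sum.cong) auto
  moreover have "(\<Sum>x = 1..n. \<alpha> x * v x) = \<alpha> i * v i + (\<Sum>x\<in>{1..n} - {i}. \<alpha> x * v x)"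
    by (rule sum.remove[OF _ assms]) simp
  ultimately show ?thesis by simp
qed

text \<open>Invariance is expressed through the Chevalley generators, because only their action on sections
  is prescribed.\<close>

locale osc_invariant =
  fixes n k :: nat and N :: "((nat \<Rightarrow> nat) \<Rightarrow> complex) set"
  assumes rank: "1 \<le> n" and sub: "N \<subseteq> coeffs n k"
    and add: "\<And>c d. c \<in> N \<Longrightarrow> d \<in> N \<Longrightarrow> (\<lambda>\<beta>. c \<beta> + d \<beta>) \<in> N"
    and smult: "\<And>a c. c \<in> N \<Longrightarrow> (\<lambda>\<beta>. a * c \<beta>) \<in> N"
    and e: "\<And>i c. 1 \<le> i \<Longrightarrow> i \<le> n \<Longrightarrow> c \<in> N \<Longrightarrow> osc n (chev_e n i) c \<in> N"
    and f: "\<And>i c. 1 \<le> i \<Longrightarrow> i \<le> n \<Longrightarrow> c \<in> N \<Longrightarrow> osc n (chev_f n i) c \<in> N"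
    and h: "\<And>i c. 1 \<le> i \<Longrightarrow> i \<le> n \<Longrightarrow> c \<in> N \<Longrightarrow> osc n (chev_h n i) c \<in> N"
begin

lemma scale: "(\<lambda>\<beta>. a * c \<beta>) \<in> N \<Longrightarrow> a \<noteq> 0 \<Longrightarrow> c \<in> N"
  using smult[of "\<lambda>\<beta>. a * c \<beta>" "1 / a"] by simp

text \<open>The operator \<open>Q\<^sub>i \<partial>\<^sub>i\<close> is a combination of \<open>h\<^sub>i, \<dots>, h\<^sub>n\<close> and the identity.\<close>

lemma euler_closed:
  assumes c: "c \<in> N" and i: "1 \<le> i" "i \<le> n"
  shows "(\<lambda>\<beta>. of_nat (\<beta> i) * c \<beta>) \<in> N"
  using i(2,1)
proof (induction i rule: inc_induct)
  case base
  have "(\<lambda>\<beta>. (-1) * osc n (chev_h n n) c \<beta> + (- (1 / 2)) * c \<beta>) \<in> N"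
    using c h[of n c] rank by (intro add smult) auto
  then show ?case using rank by (simp add: osc_chev_n euler_op)
next
  case (step i)
  have "(\<lambda>\<beta>. of_nat (\<beta> (Suc i)) * c \<beta> + (-1) * osc n (chev_h n i) c \<beta>) \<in> N"
    using step c h[of i c] by (intro add smult) auto
  then show ?case using step by (simp add: osc_chev euler_op)
qed

text \<open>If two monomials occur in \<open>c\<close>, they differ in some exponent \<open>j\<close>, and \<open>Q\<^sub>j \<partial>\<^sub>j\<close> minus its eigenvalue
  on one of them kills this one but not the other. This shortens \<open>c\<close> until it is a monomial.\<close>

lemma single_in:
  assumes "c \<in> N" "c \<beta>0 \<noteq> 0"
  shows "\<exists>\<alpha>\<in>exponents n k. single \<alpha> \<in> N"
  using assms
proof (induction "card {\<alpha>. c \<alpha> \<noteq> 0}" arbitrary: c \<beta>0 rule: less_induct)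
  case less
  have fin: "finite {\<alpha>. c \<alpha> \<noteq> 0}" and ex: "{\<alpha>. c \<alpha> \<noteq> 0} \<subseteq> exponents n k"
    using less(2) sub by (auto simp: coeffs_def)
  show ?case
  proof (cases "\<exists>\<alpha>. \<alpha> \<noteq> \<beta>0 \<and> c \<alpha> \<noteq> 0")
    case False
    have "c \<beta> = c \<beta>0 * single \<beta>0 \<beta>" for \<beta>
      using False by (cases "\<beta> = \<beta>0") (auto simp: single_def)
    then have "c = (\<lambda>\<beta>. c \<beta>0 * single \<beta>0 \<beta>)" by (rule ext)
    then have "(\<lambda>\<beta>. c \<beta>0 * single \<beta>0 \<beta>) \<in> N" by (rule subst) (rule less(2))
    then have "single \<beta>0 \<in> N" using less(3) by (rule scale)
    moreover have "\<beta>0 \<in> exponents n k" using less(3) ex by blast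
    ultimately show ?thesis by blast
  next
    case True
    then obtain \<alpha> where \<alpha>: "\<alpha> \<noteq> \<beta>0" "c \<alpha> \<noteq> 0" by blast
    then obtain j where j: "\<alpha> j \<noteq> \<beta>0 j" by (auto simp: fun_eq_iff)
    have exps: "\<alpha> \<in> exponents n k" "\<beta>0 \<in> exponents n k" using \<alpha> less(3) ex by auto
    have "j \<in> {1..n}"
    proof (rule ccontr)
      assume "j \<notin> {1..n}"
      then have "\<alpha> j = 0" "\<beta>0 j = 0" using exps by (simp_all add: exponents_def)
      then show False using j by simp
    qed
    let ?d = "\<lambda>\<beta>. of_nat (\<beta> j) * c \<beta> + (- of_nat (\<beta>0 j)) * c \<beta>"
    have d: "?d \<beta> = (of_nat (\<beta> j) - of_nat (\<beta>0 j)) * c \<beta>" for \<beta> by (simp add: algebra_simps)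
    have dN: "?d \<in> N" using \<open>j \<in> {1..n}\<close> less(2) by (intro add[OF euler_closed smult]) auto
    have d\<alpha>: "?d \<alpha> \<noteq> 0" using j \<alpha>(2) unfolding d by simp
    have "card {\<beta>. ?d \<beta> \<noteq> 0} < card {\<beta>. c \<beta> \<noteq> 0}"
    proof (rule psubset_card_mono[OF fin])
      have "\<beta>0 \<notin> {\<beta>. ?d \<beta> \<noteq> 0}" unfolding d by simp
      moreover have "{\<beta>. ?d \<beta> \<noteq> 0} \<subseteq> {\<beta>. c \<beta> \<noteq> 0}" unfolding d by auto
      ultimately show "{\<beta>. ?d \<beta> \<noteq> 0} \<subset> {\<beta>. c \<beta> \<noteq> 0}" using less(3) by blast
    qed
    then show ?thesis by (rule less(1)[of ?d \<alpha>, OF _ dN d\<alpha>])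
  qed
qed

text \<open>The generator \<open>e\<^sub>i\<close> moves one unit of exponent from variable \<open>i\<close> to the next, and \<open>f\<^sub>i\<close> moves
  it back, both with a nonzero factor.\<close>

lemma shift_iff:
  assumes i: "1 \<le> i" "i < n" and \<gamma>: "\<gamma> i \<noteq> 0"
  defines "\<gamma>' \<equiv> (\<gamma>(i := \<gamma> i - 1))(i + 1 := \<gamma> (i + 1) + 1)"
  shows "single \<gamma> \<in> N \<longleftrightarrow> single \<gamma>' \<in> N"
proof
  have der: "der_op i (single \<alpha>) = (\<lambda>\<beta>. of_nat (\<alpha> i) * single (\<alpha>(i := \<alpha> i - 1)) \<beta>)" for i \<alpha>
    by (rule ext) (rule der_op_single)
  have "osc n (chev_e n i) (single \<gamma>) \<beta> = - of_nat (\<gamma> i) * single \<gamma>' \<beta>" for \<beta>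
    using i by (simp add: osc_chev der linop_smult[OF linop_mul] mul_op_single \<gamma>'_def)
  then have e': "osc n (chev_e n i) (single \<gamma>) = (\<lambda>\<beta>. - of_nat (\<gamma> i) * single \<gamma>' \<beta>)" by (rule ext)
  show "single \<gamma>' \<in> N" if "single \<gamma> \<in> N"
    using e[of i "single \<gamma>"] i that \<gamma> unfolding e' by - (rule scale[of "- of_nat (\<gamma> i)"], auto)
  have "\<gamma>'(i + 1 := \<gamma>' (i + 1) - 1, i := (\<gamma>'(i + 1 := \<gamma>' (i + 1) - 1)) i + 1) = \<gamma>"
    using \<gamma> by (auto simp: \<gamma>'_def fun_eq_iff)
  then have "osc n (chev_f n i) (single \<gamma>') \<beta> = - of_nat (\<gamma>' (i + 1)) * single \<gamma> \<beta>" for \<beta>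
    using i by (simp add: osc_chev der linop_smult[OF linop_mul] mul_op_single)
  then have f': "osc n (chev_f n i) (single \<gamma>') = (\<lambda>\<beta>. - of_nat (\<gamma>' (i + 1)) * single \<gamma> \<beta>)" by (rule ext)
  show "single \<gamma> \<in> N" if "single \<gamma>' \<in> N"
    using f[of i "single \<gamma>'"] i that unfolding f'
    by - (rule scale[of "- of_nat (\<gamma>' (i + 1))"], auto simp: \<gamma>'_def simp del: of_nat_add of_nat_Suc)
qed

text \<open>On powers of \<open>Q\<^sub>n\<close> the generator \<open>e\<^sub>n\<close> lowers the exponent by two and \<open>f\<^sub>n\<close> raises it by two, with
  nonzero factors.\<close>

lemma top_step_iff: "single (top_exponent n (m + 2)) \<in> N \<longleftrightarrow> single (top_exponent n m) \<in> N"
proof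
  have der: "der_op n (single (top_exponent n m)) = (\<lambda>\<beta>. of_nat m * single (top_exponent n (m - 1)) \<beta>)" for m
  proof
    fix \<beta>
    have "(top_exponent n m)(n := top_exponent n m n - 1) = top_exponent n (m - 1)"
      by (auto simp: top_exponent_def)
    then show "der_op n (single (top_exponent n m)) \<beta> = of_nat m * single (top_exponent n (m - 1)) \<beta>"
      using der_op_single[of n "top_exponent n m" \<beta>] by (simp add: top_exponent_def)
  qed
  have mul: "mul_op n (single (top_exponent n m)) = single (top_exponent n (m + 1))" for m
  proof
    fix \<beta>
    have "(top_exponent n m)(n := top_exponent n m n + 1) = top_exponent n (m + 1)"
      by (auto simp: top_exponent_def)
    then show "mul_op n (single (top_exponent n m)) \<beta> = single (top_exponent n (m + 1)) \<beta>"
      using mul_op_single[of n "top_exponent n m" \<beta>] by simp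
  qed
  have e': "osc n (chev_e n n) (single (top_exponent n (m + 2))) =
      (\<lambda>\<beta>. (1 / 2 * of_nat (m + 2) * of_nat (m + 1)) * single (top_exponent n m) \<beta>)"
    using rank by (intro ext) (simp add: osc_chev_n der linop_smult[OF linop_der])
  show "single (top_exponent n m) \<in> N" if "single (top_exponent n (m + 2)) \<in> N"
    using e[of n "single (top_exponent n (m + 2))"] rank that unfolding e'
    by - (rule scale[of "1 / 2 * of_nat (m + 2) * of_nat (m + 1)"], auto simp del: of_nat_add of_nat_Suc)
  have f': "osc n (chev_f n n) (single (top_exponent n m)) = (\<lambda>\<beta>. - (1 / 2) * single (top_exponent n (m + 2)) \<beta>)"
    using rank by (intro ext) (simp add: osc_chev_n mul)
  show "single (top_exponent n (m + 2)) \<in> N" if "single (top_exponent n m) \<in> N"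
    using f[of n "single (top_exponent n m)"] rank that unfolding f' by - (rule scale[of "- (1 / 2)"], auto)
qed

text \<open>Repeated shifts move the whole exponent into the last variable; the distance of the exponents
  from there, counted with multiplicity, decreases.\<close>

lemma single_iff_top_degree:
  assumes "\<forall>i. i \<notin> {1..n} \<longrightarrow> \<gamma> i = 0"
  shows "single \<gamma> \<in> N \<longleftrightarrow> single (top_exponent n (degree_sum n \<gamma>)) \<in> N"
  using assms
proof (induction "\<Sum>i = 1..n. \<gamma> i * (n - i)" arbitrary: \<gamma> rule: less_induct)
  case less
  show ?case
  proof (cases "\<exists>i. 1 \<le> i \<and> i < n \<and> \<gamma> i \<noteq> 0")
    case False
    then have "\<gamma> = top_exponent n (\<gamma> n)"
      using less(2) by (intro ext) (metis atLeastAtMost_iff le_neq_implies_less top_exponent_def)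
    then show ?thesis using degree_sum_top[OF rank, of "\<gamma> n"] by metis
  next
    case True
    then obtain i where i: "1 \<le> i" "i < n" "\<gamma> i \<noteq> 0" by blast
    let ?\<delta> = "\<gamma>(i := \<gamma> i - 1)"
    let ?\<gamma>' = "?\<delta>(i + 1 := \<gamma> (i + 1) + 1)"
    have mem: "i \<in> {1..n}" "i + 1 \<in> {1..n}" using i by auto
    have "degree_sum n ?\<gamma>' + ?\<delta> (i + 1) = degree_sum n ?\<delta> + (\<gamma> (i + 1) + 1)" by (rule degree_sum_update[OF mem(2)])
    moreover have "degree_sum n ?\<delta> + \<gamma> i = degree_sum n \<gamma> + (\<gamma> i - 1)" by (rule degree_sum_update[OF mem(1)])
    moreover have "?\<delta> (i + 1) = \<gamma> (i + 1)" by simp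
    ultimately have deg: "degree_sum n ?\<gamma>' = degree_sum n \<gamma>" using i(3) by linarith
    let ?w = "\<lambda>\<alpha>. \<Sum>j = 1..n. \<alpha> j * (n - j)"
    have "?w ?\<gamma>' + ?\<delta> (i + 1) * (n - (i + 1)) = ?w ?\<delta> + (\<gamma> (i + 1) + 1) * (n - (i + 1))"
      by (rule weighted_sum_update[OF mem(2)])
    then have 1: "?w ?\<gamma>' = ?w ?\<delta> + (n - (i + 1))" by simp
    have "?w ?\<delta> + \<gamma> i * (n - i) = ?w \<gamma> + (\<gamma> i - 1) * (n - i)" by (rule weighted_sum_update[OF mem(1)])
    moreover have "\<gamma> i * (n - i) = (\<gamma> i - 1) * (n - i) + (n - i)" using i(3) by (cases "\<gamma> i") simp_all
    ultimately have 2: "?w ?\<delta> + (n - i) = ?w \<gamma>" by linarith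
    have "?w ?\<gamma>' < ?w \<gamma>" using 1 2 i by linarith
    moreover have "\<forall>j. j \<notin> {1..n} \<longrightarrow> ?\<gamma>' j = 0" using less(2) i by auto
    ultimately have "single ?\<gamma>' \<in> N \<longleftrightarrow> single (top_exponent n (degree_sum n ?\<gamma>')) \<in> N" by (rule less(1))
    then show ?thesis unfolding deg using shift_iff[of i \<gamma>] i by simp
  qed
qed

lemma top_iff: "single (top_exponent n m) \<in> N \<longleftrightarrow> single (top_exponent n (m mod 2)) \<in> N"
proof (induction m rule: less_induct)
  case (less m)
  show ?case
  proof (cases "m < 2")
    case False
    then have "single (top_exponent n m) \<in> N \<longleftrightarrow> single (top_exponent n (m - 2)) \<in> N"
      using top_step_iff[of "m - 2"] by (metis le_add_diff_inverse2 not_less)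
    also have "\<dots> \<longleftrightarrow> single (top_exponent n ((m - 2) mod 2)) \<in> N" using less[of "m - 2"] False by simp
    also have "(m - 2) mod 2 = m mod 2" using False by (metis le_mod_geq not_less)
    finally show ?thesis .
  qed simp
qed

lemma full:
  assumes c: "c \<in> N" "c \<beta> \<noteq> 0" shows "N = coeffs n k"
proof -
  have key: "single \<alpha> \<in> N \<longleftrightarrow> single (top_exponent n (k mod 2)) \<in> N" if "\<alpha> \<in> exponents n k" for \<alpha>
  proof -
    have "even (degree_sum n \<alpha> + k)" "\<forall>i. i \<notin> {1..n} \<longrightarrow> \<alpha> i = 0" using that by (simp_all add: exponents_def)
    moreover have "a mod 2 = b mod 2" if "even (a + b)" for a b :: nat using that by presburger
    ultimately show ?thesis using single_iff_top_degree[of \<alpha>] top_iff[of "degree_sum n \<alpha>"] by metis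
  qed
  obtain \<alpha>0 where "\<alpha>0 \<in> exponents n k" "single \<alpha>0 \<in> N" using single_in[OF c] by blast
  then have all: "single \<alpha> \<in> N" if "\<alpha> \<in> exponents n k" for \<alpha> using key that by blast
  have zero: "(\<lambda>\<beta>. 0) \<in> N" using smult[OF c(1), of 0] by simp
  have "d \<in> N" if "d \<in> coeffs n k" for d
    using that by (induction d rule: coeffs_induct) (auto intro: zero add smult all)
  then show ?thesis using sub by blast
qed

end

section \<open>The module structure on global sections\<close>

definition osc_mod :: "nat \<Rightarrow> nat \<Rightarrow> ((nat \<Rightarrow> nat) \<Rightarrow> complex) sp_mod" where
  "osc_mod n k = \<lparr>carrier = coeffs n k, mult = undefined, one = undefined,
     zero = (\<lambda>\<beta>. 0), add = (\<lambda>c d \<beta>. c \<beta> + d \<beta>), smult = (\<lambda>a c \<beta>. a * c \<beta>), act = osc n\<rparr>"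

lemma osc_mod_simps [simp]:
  "carrier (osc_mod n k) = coeffs n k" "\<zero>\<^bsub>osc_mod n k\<^esub> = (\<lambda>\<beta>. 0)"
  "c \<oplus>\<^bsub>osc_mod n k\<^esub> d = (\<lambda>\<beta>. c \<beta> + d \<beta>)" "a \<odot>\<^bsub>osc_mod n k\<^esub> c = (\<lambda>\<beta>. a * c \<beta>)" "act (osc_mod n k) = osc n"
  by (simp_all add: osc_mod_def)

lemma sp_module_osc: "sp_module n (osc_mod n k)"
proof -
  have ag: "abelian_group (osc_mod n k)"
  proof (rule abelian_groupI)
    show "\<exists>d\<in>carrier (osc_mod n k). d \<oplus>\<^bsub>osc_mod n k\<^esub> c = \<zero>\<^bsub>osc_mod n k\<^esub>" if "c \<in> carrier (osc_mod n k)" for c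
      using that by (intro bexI[of _ "\<lambda>\<beta>. - c \<beta>"]) (simp_all add: neg_coeffs)
  qed (simp_all add: coeffs_zero coeffs_add add_ac)
  have mod: "module complex_ring (osc_mod n k)"
    by (rule moduleI[OF complex_ring_cring ag]) (simp_all add: coeffs_smult algebra_simps)
  interpret M: module complex_ring "osc_mod n k" by (rule mod)
  have inv: "\<ominus>\<^bsub>osc_mod n k\<^esub> c = (\<lambda>\<beta>. - c \<beta>)" if "c \<in> coeffs n k" for c
    by (rule M.minus_equality) (use that in \<open>simp_all add: neg_coeffs\<close>)
  show ?thesis unfolding sp_module_def
    using mod by (auto simp: osc_coeffs a_minus_def inv linop_add[OF linop_osc] linop_smult[OF linop_osc]
        osc_add_mat[OF sp_carrier sp_carrier] osc_add_mat(3)[OF sp_carrier sp_carrier] osc_bracket)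
qed

lemma to_sec_inj: "1 \<le> n \<Longrightarrow> c \<in> coeffs n k \<Longrightarrow> d \<in> coeffs n k \<Longrightarrow> to_sec n k c = to_sec n k d \<Longrightarrow> c = d"
  using to_sec_eqI[of n c k d] by simp

lemma H0_eq: "n \<ge> 2 \<Longrightarrow> H0 n (- int k) = to_sec n k ` coeffs n k"
  using to_sec_H0 H0_to_sec by blast

lemma to_sec_chev:
  assumes c: "c \<in> coeffs n k" and Q: "Q \<in> cover n" and i: "i \<in> {1..<n}"
  shows "to_sec n k (osc n (chev_e n i) c) Q = - Q (i + 1) * pd i (to_sec n k c) Q"
    "to_sec n k (osc n (chev_h n i) c) Q = - Q i * pd i (to_sec n k c) Q + Q (i + 1) * pd (i + 1) (to_sec n k c) Q"
    "to_sec n k (osc n (chev_f n i) c) Q = - Q i * pd (i + 1) (to_sec n k c) Q"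
proof -
  have i': "1 \<le> i" "i < n" "i \<in> {1..n}" "i + 1 \<in> {1..n}" using i by auto
  have M: "mul_op a (der_op b c) \<in> coeffs n k" if "a \<in> {1..n}" "b \<in> {1..n}" for a b
    using mul_op_coeffs[OF der_op_coeffs[OF c that(2)] that(1)] by (simp add: coeffs_Suc_Suc)
  have neg: "to_sec n k (\<lambda>\<beta>. - d \<beta>) Q = - to_sec n k d Q" if "d \<in> coeffs n k" for d
    using to_sec_smult[OF that, of "-1" Q] by simp
  show "to_sec n k (osc n (chev_e n i) c) Q = - Q (i + 1) * pd i (to_sec n k c) Q"
    unfolding osc_chev(1)[OF i'(1,2), abs_def] using neg[OF M[OF i'(4,3)]] mul_pd_to_sec[OF c Q i'(3,4)] by simp
  show "to_sec n k (osc n (chev_f n i) c) Q = - Q i * pd (i + 1) (to_sec n k c) Q"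
    unfolding osc_chev(3)[OF i'(1,2), abs_def] using neg[OF M[OF i'(3,4)]] mul_pd_to_sec[OF c Q i'(4,3)] by simp
  show "to_sec n k (osc n (chev_h n i) c) Q = - Q i * pd i (to_sec n k c) Q + Q (i + 1) * pd (i + 1) (to_sec n k c) Q"
    unfolding osc_chev(2)[OF i'(1,2), abs_def]
    using to_sec_add[OF neg_coeffs[OF M[OF i'(3,3)]] M[OF i'(4,4)], of Q] neg[OF M[OF i'(3,3)]]
      mul_pd_to_sec[OF c Q i'(3,3)] mul_pd_to_sec[OF c Q i'(4,4)] by simp
qed

lemma to_sec_chev_n:
  assumes c: "c \<in> coeffs n k" and Q: "Q \<in> cover n" and n: "1 \<le> n"
  shows "Q (n + 1) \<noteq> 0 \<Longrightarrow> to_sec n k (osc n (chev_e n n) c) Q =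
      1 / 2 * pd n (pd n (\<lambda>R. inverse (R (n + 1)) * to_sec n k c R)) Q"
    "to_sec n k (osc n (chev_h n n) c) Q = - Q n * pd n (to_sec n k c) Q - 1 / 2 * to_sec n k c Q"
    "to_sec n k (osc n (chev_f n n) c) Q = - 1 / 2 * (Q n)\<^sup>2 * Q (n + 1) * to_sec n k c Q"
proof -
  have n': "n \<in> {1..n}" using n by simp
  have M: "mul_op n (der_op n c) \<in> coeffs n k" "der_op n (der_op n c) \<in> coeffs n k" "mul_op n (mul_op n c) \<in> coeffs n k"
    using mul_op_coeffs[OF der_op_coeffs[OF c n'] n'] der_op_coeffs[OF der_op_coeffs[OF c n'] n']
      mul_op_coeffs[OF mul_op_coeffs[OF c n'] n'] by (simp_all add: coeffs_Suc_Suc)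
  show "to_sec n k (osc n (chev_e n n) c) Q =
      1 / 2 * pd n (pd n (\<lambda>R. inverse (R (n + 1)) * to_sec n k c R)) Q" if "Q (n + 1) \<noteq> 0"
    unfolding osc_chev_n(1)[OF n, abs_def] to_sec_smult[OF M(2)] using pd_pd_to_sec[OF c Q that n'] by simp
  show "to_sec n k (osc n (chev_f n n) c) Q = - 1 / 2 * (Q n)\<^sup>2 * Q (n + 1) * to_sec n k c Q"
    unfolding osc_chev_n(3)[OF n, abs_def] to_sec_smult[OF M(3)] using mul_mul_to_sec[OF c Q n'] by simp
  have "osc n (chev_h n n) c = (\<lambda>\<beta>. (-1) * mul_op n (der_op n c) \<beta> + (- 1 / 2) * c \<beta>)"
    using osc_chev_n(2)[OF n] by (intro ext) simp
  then have "to_sec n k (osc n (chev_h n n) c) Q = to_sec n k (\<lambda>\<beta>. (-1) * mul_op n (der_op n c) \<beta> + (- 1 / 2) * c \<beta>) Q"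
    by simp
  also have "\<dots> = - to_sec n k (mul_op n (der_op n c)) Q - 1 / 2 * to_sec n k c Q"
    using to_sec_add[OF coeffs_smult[OF M(1), of "-1"] coeffs_smult[OF c, of "- 1 / 2"], of Q]
      to_sec_smult[OF M(1), of "-1" Q] to_sec_smult[OF c, of "- 1 / 2" Q] by simp
  finally show "to_sec n k (osc n (chev_h n n) c) Q = - Q n * pd n (to_sec n k c) Q - 1 / 2 * to_sec n k c Q"
    using mul_pd_to_sec[OF c Q n' n'] by simp
qed

lemma H0_mod_simps [simp]:
  "carrier (H0_mod n l \<rho>) = H0 n l" "\<zero>\<^bsub>H0_mod n l \<rho>\<^esub> = (\<lambda>Q. 0)"
  "f \<oplus>\<^bsub>H0_mod n l \<rho>\<^esub> g = (\<lambda>Q. f Q + g Q)" "a \<odot>\<^bsub>H0_mod n l \<rho>\<^esub> f = (\<lambda>Q. a * f Q)" "act (H0_mod n l \<rho>) = \<rho>"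
  by (simp_all add: H0_mod_def)

text \<open>The oscillator representation is transported along the bijection between coefficients and
  sections.\<close>

lemma sp_structure_exists:
  assumes n: "n \<ge> 2" shows "\<exists>\<rho>. sp_structure n (- int k) \<rho>"
proof -
  have n1: "1 \<le> n" using n by simp
  define \<rho> where "\<rho> X f = to_sec n k (osc n X (THE c. c \<in> coeffs n k \<and> to_sec n k c = f))" for X f
  have \<rho>: "\<rho> X (to_sec n k c) = to_sec n k (osc n X c)" if c: "c \<in> coeffs n k" for X c
  proof -
    have "(THE d. d \<in> coeffs n k \<and> to_sec n k d = to_sec n k c) = c"
      by (rule the_equality) (use c to_sec_inj[OF n1] in auto)
    then show ?thesis by (simp add: \<rho>_def)
  qed
  have "sp_module n (H0_mod n (- int k) \<rho>)"
    by (rule sp_module_image[OF sp_module_osc, where \<pi> = "to_sec n k" and k1 = k])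
      (auto simp: H0_eq[OF n] \<rho> to_sec_add to_sec_smult to_sec_zero fun_eq_iff)
  moreover have "(\<forall>i \<in> {1..<n}.
           \<rho> (chev_e n i) f Q = - Q (i + 1) * pd i f Q \<and>
           \<rho> (chev_h n i) f Q = - Q i * pd i f Q + Q (i + 1) * pd (i + 1) f Q \<and>
           \<rho> (chev_f n i) f Q = - Q i * pd (i + 1) f Q) \<and>
        (Q (n + 1) \<noteq> 0 \<longrightarrow>
           \<rho> (chev_e n n) f Q = 1 / 2 * pd n (pd n (\<lambda>R. inverse (R (n + 1)) * f R)) Q) \<and>
        \<rho> (chev_h n n) f Q = - Q n * pd n f Q - 1 / 2 * f Q \<and>
        \<rho> (chev_f n n) f Q = - 1 / 2 * (Q n)\<^sup>2 * Q (n + 1) * f Q"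
    if f: "f \<in> H0 n (- int k)" and Q: "Q \<in> cover n" for f Q
  proof -
    obtain c where c: "c \<in> coeffs n k" "f = to_sec n k c" using f unfolding H0_eq[OF n] by blast
    show ?thesis unfolding c(2) \<rho>[OF c(1)]
      using to_sec_chev[OF c(1) Q] to_sec_chev_n[OF c(1) Q n1] by blast
  qed
  ultimately show ?thesis unfolding sp_structure_def by blast
qed

text \<open>The prescribed operators determine the action of the Chevalley generators on sections. For
  \<open>e\<^sub>n\<close> the values are given only where the last coordinate does not vanish.\<close>

lemma sp_structure_chev:
  assumes n: "n \<ge> 2" and \<rho>: "sp_structure n (- int k) \<rho>" and c: "c \<in> coeffs n k" and i: "1 \<le> i" "i \<le> n"
  shows "\<rho> (chev_e n i) (to_sec n k c) = to_sec n k (osc n (chev_e n i) c)"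
    "\<rho> (chev_h n i) (to_sec n k c) = to_sec n k (osc n (chev_h n i) c)"
    "\<rho> (chev_f n i) (to_sec n k c) = to_sec n k (osc n (chev_f n i) c)"
proof -
  have n1: "1 \<le> n" using n by simp
  let ?f = "to_sec n k c"
  have f: "?f \<in> H0 n (- int k)" by (rule to_sec_H0[OF c])
  interpret M: sp_rep n "H0_mod n (- int k) \<rho>" by (rule sp_rep.intro) (use \<rho> in \<open>simp add: sp_structure_def\<close>)
  have F: "\<rho> (chev_e n i) f Q = - Q (i + 1) * pd i f Q"
      "\<rho> (chev_h n i) f Q = - Q i * pd i f Q + Q (i + 1) * pd (i + 1) f Q"
      "\<rho> (chev_f n i) f Q = - Q i * pd (i + 1) f Q" if "f \<in> H0 n (- int k)" "Q \<in> cover n" "i \<in> {1..<n}" for f Q i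
    using \<rho> that unfolding sp_structure_def by blast+
  have Fn: "Q (n + 1) \<noteq> 0 \<Longrightarrow> \<rho> (chev_e n n) f Q = 1 / 2 * pd n (pd n (\<lambda>R. inverse (R (n + 1)) * f R)) Q"
      "\<rho> (chev_h n n) f Q = - Q n * pd n f Q - 1 / 2 * f Q"
      "\<rho> (chev_f n n) f Q = - 1 / 2 * (Q n)\<^sup>2 * Q (n + 1) * f Q" if "f \<in> H0 n (- int k)" "Q \<in> cover n" for f Q
    using \<rho> that unfolding sp_structure_def by blast+
  have ext: "\<rho> X ?f = to_sec n k (osc n X c)"
    if X: "X \<in> sp n" and eq: "\<And>Q. Q \<in> cover n \<Longrightarrow> Q (n + 1) \<noteq> 0 \<Longrightarrow> \<rho> X ?f Q = to_sec n k (osc n X c) Q" for X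
  proof -
    have "\<rho> X ?f \<in> H0 n (- int k)" using M.act_closed[OF X, of ?f] f by simp
    then obtain d where d: "d \<in> coeffs n k" "\<rho> X ?f = to_sec n k d" unfolding H0_eq[OF n] by blast
    have "d = osc n X c" by (rule to_sec_eqI[OF n1 d(1) osc_coeffs[OF c]]) (use eq d(2) in simp)
    then show ?thesis using d(2) by simp
  qed
  show "\<rho> (chev_e n i) (to_sec n k c) = to_sec n k (osc n (chev_e n i) c)"
  proof (rule ext[OF chev_sp(1)[OF i]])
    show "\<rho> (chev_e n i) ?f Q = to_sec n k (osc n (chev_e n i) c) Q" if "Q \<in> cover n" "Q (n + 1) \<noteq> 0" for Q
      using that i by (cases "i = n") (simp_all add: F(1)[OF f] Fn(1)[OF f] to_sec_chev(1)[OF c] to_sec_chev_n(1)[OF c _ n1])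
  qed
  show "\<rho> (chev_h n i) (to_sec n k c) = to_sec n k (osc n (chev_h n i) c)"
  proof (rule ext[OF chev_sp(3)[OF i]])
    show "\<rho> (chev_h n i) ?f Q = to_sec n k (osc n (chev_h n i) c) Q" if "Q \<in> cover n" "Q (n + 1) \<noteq> 0" for Q
      using that i by (cases "i = n") (simp_all add: F(2)[OF f] Fn(2)[OF f] to_sec_chev(2)[OF c] to_sec_chev_n(2)[OF c _ n1])
  qed
  show "\<rho> (chev_f n i) (to_sec n k c) = to_sec n k (osc n (chev_f n i) c)"
  proof (rule ext[OF chev_sp(2)[OF i]])
    show "\<rho> (chev_f n i) ?f Q = to_sec n k (osc n (chev_f n i) c) Q" if "Q \<in> cover n" "Q (n + 1) \<noteq> 0" for Q
      using that i by (cases "i = n") (simp_all add: F(3)[OF f] Fn(3)[OF f] to_sec_chev(3)[OF c] to_sec_chev_n(3)[OF c _ n1])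
  qed
qed

text \<open>The preimage of a submodule under \<open>to_sec\<close> is stable under the Chevalley generators of the
  oscillator representation.\<close>

lemma H0_irreducible:
  assumes n: "n \<ge> 2" and \<rho>: "sp_structure n (- int k) \<rho>"
  shows "sp_irreducible n (H0_mod n (- int k) \<rho>)"
proof -
  let ?M = "H0_mod n (- int k) \<rho>" and ?T = "to_sec n k"
  have n1: "1 \<le> n" using n by simp
  have M: "sp_module n ?M" using \<rho> by (simp add: sp_structure_def)
  interpret M: sp_rep n ?M by (rule sp_rep.intro[OF M])
  note chev = sp_structure_chev[OF n \<rho>]
  have nonzero: "?T c \<noteq> (\<lambda>Q. 0)" if "c \<in> coeffs n k" "c \<beta> \<noteq> 0" for c \<beta>
  proof
    assume "?T c = (\<lambda>Q. 0)"
    then have "c = (\<lambda>\<beta>. 0)" using to_sec_inj[OF n1 that(1) coeffs_zero] by (simp add: to_sec_zero fun_eq_iff)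
    then show False using that(2) by simp
  qed
  have "carrier ?M \<noteq> {\<zero>\<^bsub>?M\<^esub>}"
  proof -
    have "single (top_exponent n (k mod 2)) \<in> coeffs n k"
      by (intro single_coeffs top_exponent_exponents n1) presburger
    then have "?T (single (top_exponent n (k mod 2))) \<in> carrier ?M - {\<zero>\<^bsub>?M\<^esub>}"
      using nonzero[of _ "top_exponent n (k mod 2)"] to_sec_H0 by (simp add: single_def)
    then show ?thesis by blast
  qed
  moreover have "S = {\<zero>\<^bsub>?M\<^esub>} \<or> S = carrier ?M" if S: "sp_submodule n ?M S" for S
  proof -
    note S' = M.sp_submodule_facts[OF S]
    let ?N = "{c \<in> coeffs n k. ?T c \<in> S}"
    interpret osc_invariant n k ?N
    proof
      show "1 \<le> n" by (rule n1)
      show "?N \<subseteq> coeffs n k" by blast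
      show "(\<lambda>\<beta>. c \<beta> + d \<beta>) \<in> ?N" if "c \<in> ?N" "d \<in> ?N" for c d
      proof -
        have "?T (\<lambda>\<beta>. c \<beta> + d \<beta>) = (\<lambda>Q. ?T c Q + ?T d Q)" using that by (intro ext) (simp add: to_sec_add)
        then show ?thesis using that S'(3)[of "?T c" "?T d"] by (simp add: coeffs_add)
      qed
      show "(\<lambda>\<beta>. a * c \<beta>) \<in> ?N" if "c \<in> ?N" for a c
      proof -
        have "?T (\<lambda>\<beta>. a * c \<beta>) = (\<lambda>Q. a * ?T c Q)" using that by (intro ext) (simp add: to_sec_smult)
        then show ?thesis using that S'(4)[of "?T c" a] by (simp add: coeffs_smult)
      qed
      show "osc n (chev_e n i) c \<in> ?N" "osc n (chev_f n i) c \<in> ?N" "osc n (chev_h n i) c \<in> ?N"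
        if "1 \<le> i" "i \<le> n" "c \<in> ?N" for i c
        using that chev[of c i] S'(5)[of "chev_e n i" "?T c"] S'(5)[of "chev_f n i" "?T c"] S'(5)[of "chev_h n i" "?T c"]
        by (simp_all add: osc_coeffs chev_sp)
    qed
    show ?thesis
    proof (cases "\<exists>c\<in>?N. \<exists>\<beta>. c \<beta> \<noteq> 0")
      case True
      then obtain c \<beta> where "c \<in> ?N" "c \<beta> \<noteq> 0" by (elim bexE exE)
      then have N: "?N = coeffs n k" by (rule full)
      have "?T c \<in> S" if "c \<in> coeffs n k" for c using subsetD[OF equalityD2[OF N] that] by simp
      then have "H0 n (- int k) \<subseteq> S" unfolding H0_eq[OF n] by (intro image_subsetI)
      then show ?thesis using S'(1) by simp
    next
      case False
      have "s \<in> {\<lambda>Q. 0}" if s: "s \<in> S" for s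
      proof -
        have "s \<in> ?T ` coeffs n k" using s S'(1) unfolding H0_mod_simps H0_eq[OF n] by (rule set_mp[rotated])
        then obtain c where c: "c \<in> coeffs n k" "s = ?T c" by (rule imageE)
        then have "c \<in> ?N" using s by simp
        then have c0: "c = (\<lambda>\<beta>. 0)" using False by (intro ext) simp
        show ?thesis unfolding c(2) c0 by (simp add: to_sec_zero fun_eq_iff)
      qed
      then have "S \<subseteq> {\<lambda>Q. 0}" by (rule subsetI)
      moreover have "(\<lambda>Q. 0) \<in> S" using S'(2) by simp
      ultimately show ?thesis unfolding subset_singleton_iff by force
    qed
  qed
  ultimately show ?thesis using M by (simp add: sp_irreducible_def)
qed

lemma fund_weight_linear:
  assumes "X \<in> carrier_mat (2 * n) (2 * n)" "Y \<in> carrier_mat (2 * n) (2 * n)" "i \<le> n"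
  shows "fund_weight i (X + Y) = fund_weight i X + fund_weight i Y" "fund_weight i (c \<cdot>\<^sub>m X) = c * fund_weight i X"
  using assms by (auto simp: fund_weight_def sum.distrib sum_distrib_left intro!: sum.cong)

text \<open>The monomial whose part in the first \<open>n\<close> variables is \<open>1\<close> or \<open>Q\<^sub>n\<close>, according to the parity
  of \<open>k\<close>, is a highest weight vector. The values of \<open>\<mu>\<close> on the \<open>h\<^sub>i\<close> are its eigenvalues; \<open>h\<^bsub>n-1\<^esub>\<close> sees the exponent of \<open>Q\<^sub>n\<close> with a
  positive sign.\<close>

theorem H0_iso_simple_hw_module:
  assumes n: "n \<ge> 2" and \<rho>: "sp_structure n (- int k) \<rho>"
    and \<mu>_add: "\<And>X Y. X \<in> sp n \<Longrightarrow> Y \<in> sp n \<Longrightarrow> \<mu> (X + Y) = \<mu> X + \<mu> Y"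
    and \<mu>_smult: "\<And>c X. X \<in> sp n \<Longrightarrow> \<mu> (c \<cdot>\<^sub>m X) = c * \<mu> X"
    and \<mu>: "\<And>i. 1 \<le> i \<Longrightarrow> i \<le> n \<Longrightarrow> \<mu> (chev_h n i) =
      (if i = n then - of_nat (k mod 2) - 1 / 2 else if i + 1 = n then of_nat (k mod 2) else 0)"
  shows "sp_iso n (H0_mod n (- int k) \<rho>) (simple_hw_module n \<mu>)"
proof -
  let ?M = "H0_mod n (- int k) \<rho>" and ?T = "to_sec n k"
  have n1: "1 \<le> n" using n by simp
  have irr: "sp_irreducible n ?M" by (rule H0_irreducible[OF n \<rho>])
  interpret M: sp_rep n ?M by (rule sp_rep.intro[OF sp_irreducibleD(1)[OF irr]])
  note chev = sp_structure_chev[OF n \<rho>]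
  define t where "t = top_exponent n (k mod 2)"
  have t: "single t \<in> coeffs n k"
    unfolding t_def by (intro single_coeffs top_exponent_exponents n1) presburger
  have t_val: "t i = (if i = n then k mod 2 else 0)" for i by (simp add: t_def top_exponent_def)
  have euler: "mul_op i (der_op i (single t)) \<beta> = of_nat (t i) * single t \<beta>" for i \<beta>
    by (simp add: euler_op single_def)
  have v: "?T (single t) \<in> carrier ?M" using to_sec_H0[OF t] by simp
  have nz: "?T (single t) \<noteq> \<zero>\<^bsub>?M\<^esub>"
  proof
    assume "?T (single t) = \<zero>\<^bsub>?M\<^esub>"
    then have "single t = (\<lambda>\<beta>. 0)" using to_sec_inj[OF n1 t coeffs_zero] by (simp add: to_sec_zero fun_eq_iff)
    then show False by (metis single_def zero_neq_one)
  qed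
  have e: "act ?M (chev_e n i) (?T (single t)) = \<zero>\<^bsub>?M\<^esub>" if i: "1 \<le> i" "i \<le> n" for i
  proof -
    have "osc n (chev_e n i) (single t) = (\<lambda>\<beta>. 0)"
    proof (cases "i = n")
      case True
      have der: "der_op n (single t) = (\<lambda>\<beta>. of_nat (t n) * single (t(n := t n - 1)) \<beta>)"
        by (rule ext) (rule der_op_single)
      \<comment> \<open>The exponent of \<open>Q\<^sub>n\<close> is at most 1, so the second derivative vanishes.\<close>
      have "t n \<le> 1" using t_val[of n] by simp
      then show ?thesis using True
        by (intro ext) (simp add: osc_chev_n[OF n1] der linop_smult[OF linop_der] der_op_single)
    next
      case False
      then have "der_op i (single t) = (\<lambda>\<beta>. 0)" using t_val[of i] by (intro ext) (simp add: der_op_single)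
      then show ?thesis using False i by (intro ext) (simp add: osc_chev mul_op_def)
    qed
    moreover have "?T (\<lambda>\<beta>. 0) = (\<lambda>Q. 0)" by (rule ext) (rule to_sec_zero)
    ultimately show ?thesis using chev(1)[OF t i] by simp
  qed
  have h: "act ?M H (?T (single t)) = \<mu> H \<odot>\<^bsub>?M\<^esub> ?T (single t)" if H: "H \<in> cartan n" for H
  proof -
    have "H \<in> sp n \<and> act ?M H (?T (single t)) = \<mu> H \<odot>\<^bsub>?M\<^esub> ?T (single t)"
      using H n1
    proof (rule cartan_spanned)
      fix i assume i: "1 \<le> i" "i \<le> n"
      have "osc n (chev_h n i) (single t) = (\<lambda>\<beta>. \<mu> (chev_h n i) * single t \<beta>)"
      proof (cases "i = n")
        case True
        then show ?thesis using n1 by (intro ext) (simp add: osc_chev_n euler \<mu> t_val algebra_simps)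
      next
        case False
        then show ?thesis using i by (intro ext) (simp add: osc_chev euler \<mu> t_val)
      qed
      moreover have "?T (\<lambda>\<beta>. a * single t \<beta>) = (\<lambda>Q. a * ?T (single t) Q)" for a
        by (rule ext) (rule to_sec_smult[OF t])
      ultimately show "chev_h n i \<in> sp n \<and> act ?M (chev_h n i) (?T (single t)) = \<mu> (chev_h n i) \<odot>\<^bsub>?M\<^esub> ?T (single t)"
        using chev(2)[OF t i] chev_sp(3)[OF i] by simp
    next
      fix X Y assume "X \<in> sp n \<and> act ?M X (?T (single t)) = \<mu> X \<odot>\<^bsub>?M\<^esub> ?T (single t)"
        "Y \<in> sp n \<and> act ?M Y (?T (single t)) = \<mu> Y \<odot>\<^bsub>?M\<^esub> ?T (single t)"
      then show "X + Y \<in> sp n \<and> act ?M (X + Y) (?T (single t)) = \<mu> (X + Y) \<odot>\<^bsub>?M\<^esub> ?T (single t)"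
        using M.act_add_mat[OF _ _ v, of X Y] by (simp add: sp_add \<mu>_add distrib_right)
    next
      fix c X assume "X \<in> sp n \<and> act ?M X (?T (single t)) = \<mu> X \<odot>\<^bsub>?M\<^esub> ?T (single t)"
      then show "c \<cdot>\<^sub>m X \<in> sp n \<and> act ?M (c \<cdot>\<^sub>m X) (?T (single t)) = \<mu> (c \<cdot>\<^sub>m X) \<odot>\<^bsub>?M\<^esub> ?T (single t)"
        using M.act_smult_mat[OF _ v, of X c] by (simp add: sp_smult \<mu>_smult mult.assoc)
    qed
    then show ?thesis by blast
  qed
  show ?thesis by (rule irreducible_iso_simple_hw_module[OF n1 irr v nz e h])
qed

theorem theorem1p4:
  fixes n :: nat and l :: int
  assumes "n \<ge> 2" and "l \<le> 0"
  shows "(\<exists>\<rho>. sp_structure n l \<rho>) \<and>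
    (\<forall>\<rho>. sp_structure n l \<rho> \<longrightarrow>
      sp_iso n (H0_mod n l \<rho>)
        (if even l then simple_hw_module n (\<lambda>H. - (1 / 2) * fund_weight n H)
         else simple_hw_module n (\<lambda>H. fund_weight (n - 1) H - (3 / 2) * fund_weight n H)))"
proof -
  obtain k where l: "l = - int k" using assms(2) by (metis nonpos_int_cases)
  note lin = fund_weight_linear[OF sp_carrier sp_carrier]
  have "sp_iso n (H0_mod n (- int k) \<rho>)
      (if even l then simple_hw_module n (\<lambda>H. - (1 / 2) * fund_weight n H)
       else simple_hw_module n (\<lambda>H. fund_weight (n - 1) H - (3 / 2) * fund_weight n H))"
    if \<rho>: "sp_structure n (- int k) \<rho>" for \<rho>
  proof (cases "even k")
    case True
    then have k: "k mod 2 = 0" by presburger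
    have "sp_iso n (H0_mod n (- int k) \<rho>) (simple_hw_module n (\<lambda>H. - (1 / 2) * fund_weight n H))"
      by (rule H0_iso_simple_hw_module[OF assms(1) \<rho>])
        (use assms(1) in \<open>auto simp: k lin fund_weight_chev_h algebra_simps\<close>)
    then show ?thesis using True by (simp add: l)
  next
    case False
    then have k: "k mod 2 = 1" by presburger
    have "sp_iso n (H0_mod n (- int k) \<rho>) (simple_hw_module n (\<lambda>H. fund_weight (n - 1) H - (3 / 2) * fund_weight n H))"
      by (rule H0_iso_simple_hw_module[OF assms(1) \<rho>])
        (use assms(1) in \<open>auto simp: k lin fund_weight_chev_h algebra_simps\<close>)
    then show ?thesis using False by (simp add: l)
  qed
  then show ?thesis using sp_structure_exists[OF assms(1), of k] by (simp add: l)
qed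

end
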